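(* Let $\pi^*$ be a second-order stationary (SOS) Nash policy, let $\mu>0$ and let $\mathcal B$ be a neighborhood of $\pi^*$ in $\Pi$ such that $\langle v(\pi),\pi-\pi^*\rangle\le-\mu\|\pi-\pi^*\|^2$ for all $\pi\in\mathcal B$. Let $(\pi_n)$ be generated by (PG) with $\gamma_n=\gamma/(n+m)^p$, $p\in(1/2,1]$, and gradient estimates with $B_n=O(1/n^{\ell_b})$, $\sigma_n=O(n^{\ell_\sigma})$, $p+\ell_b>1$, $p-\ell_\sigma>1/2$. Then: (1) There is a neighborhood $\mathcal U$ of $\pi^*$ in $\Pi$ such that for every $\delta>0$ the event $E=\{\pi_n\in\mathcal B\text{ for all }n\ge1\}$ satisfies $\mathbb P(E\mid\pi_1\in\mathcal U)\ge1-\delta$ if $m$ is large enough relative to $\delta$. (2) $\pi_n\to\pi^*$ with probability $1$ on $E$; in particular $\mathbb P(\pi_n\to\pi^*\mid\pi_1\in\mathcal U)\ge1-\delta$ if $m$ is large enough relative to $\delta$. Moreover, with $q=\min\{\ell_b,\,p-2\ell_\sigma\}$, $$\mathbb E\big[\|\pi_n-\pi^*\|^2\,\big|\,E\big]=\begin{cases}O(1/n^{2\mu\gamma}) & \text{if } p=1 \text{ and } 2\mu\gamma<q,\\ O(1/n^{q}) & \text{otherwise.}\end{cases}$$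
   Context: Standing setting. Consider a finite $N$-player stochastic game with random stopping: a player set $\mathcal N=\{1,\dots,N\}$; a finite state set $\mathcal S$; for each player $i$ a finite action set $\mathcal A_i$, $\mathcal A=\prod_i\mathcal A_i$; rewards $r_i:\mathcal S\times\mathcal A\to[-1,1]$; nonnegative transition weights $P(s'\mid s,a)$ with positive stopping probability $\zeta_{s,a}=1-\sum_{s'}P(s'\mid s,a)$, $\zeta:=\min_{s,a}\zeta_{s,a}>0$; initial distribution $\rho\in\Delta(\mathcal S)$. Policies $\pi_i\in\Pi_i:=\Delta(\mathcal A_i)^{\mathcal S}\subset\mathbb R^{\mathcal S\times\mathcal A_i}$, $\Pi=\prod_i\Pi_i$ (Euclidean norm). Episodes: $s_0\sim\rho$; at each $t$ players independently draw $a_{i,t}\sim\pi_i(\cdot\mid s_t)$; the episode stops with probability $\zeta_{s_t,a_t}$ ($T(\tau)=t$), else moves to $s'$ with probability $P(s'\mid s_t,a_t)$. $V_{i,\rho}(\pi)=\mathbb E_\pi[\sum_{t=0}^{T(\tau)}r_i(s_t,a_t)]$; $v_i(\pi)=\nabla_{\pi_i}V_{i,\rho}(\pi)$ (gradient in player $i$'s entries, $V_{i,\rho}$ smooth on a neighborhood of $\Pi$); $v=(v_i)_i$; $J_v(\pi)$ is the Jacobian of $v$. A Nash policy $\pi^*$ satisfies $V_{i,\rho}(\pi^* )\ge V_{i,\rho}(\pi_i;\pi^*_{-i})$ for all $i,\pi_i\in\Pi_i$. It is second-order stationary (SOS) if $(\pi-\pi^* )^\top J_v(\pi^* )(\pi-\pi^*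 )<0$ for all $\pi\in\Pi\setminus\{\pi^*\}$. (PG): $\pi_{n+1}=\mathrm{Proj}_\Pi(\pi_n+\gamma_n\hat v_n)$ with Euclidean projection. With $\mathcal F_n=\sigma(\pi_1,\dots,\pi_n)$, write $\hat v_n=v(\pi_n)+U_n+b_n$, $U_n=\hat v_n-\mathbb E[\hat v_n\mid\mathcal F_n]$, $b_n=\mathbb E[\hat v_n\mid\mathcal F_n]-v(\pi_n)$, and assume $\mathbb E[\|b_n\|\mid\mathcal F_n]\le B_n$, $\mathbb E[\|U_n\|^2\mid\mathcal F_n]\le\sigma_n^2$ for deterministic sequences $B_n,\sigma_n$ (with $\ell_b=\infty$ allowed when $B_n=0$). *)

theory Defs
  imports "HOL-Probability.Probability" "HOL-Library.Landau_Symbols"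
begin

text \<open>
Finite N-player stochastic game with random stopping.
Players: finite type 'i; states: finite type 's; actions: every player i has a
finite nonempty action set A i, a subset of a common finite type 'a.
Joint actions are functions a :: 'i => 'a with a i in A i.
A policy profile is a vector x :: real^('i*'s*'a); the coordinate (i,s,a) is
pi_i(a|s).  Coordinates with a outside A i are fixed to 0 on the policy space,
so the Euclidean norm / projection agree with those on prod_i R^(S x A_i).
\<close>

type_synonym ('i,'s,'a) pol = "real ^ ('i \<times> 's \<times> 'a)"

definition joint :: "('i::finite \<Rightarrow> 'a set) \<Rightarrow> ('i \<Rightarrow> 'a) set" where
  "joint A = Pi UNIV A"

definition game_ok ::
  "('i::finite \<Rightarrow> 'a::finite set) \<Rightarrow> ('s::finite \<Rightarrow> ('i \<Rightarrow> 'a) \<Rightarrow> 's \<Rightarrow> real)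
   \<Rightarrow> ('i \<Rightarrow> 's \<Rightarrow> ('i \<Rightarrow> 'a) \<Rightarrow> real) \<Rightarrow> ('s \<Rightarrow> real) \<Rightarrow> bool" where
  "game_ok A P r \<rho> \<longleftrightarrow>
     (\<forall>i. A i \<noteq> {}) \<and>
     (\<forall>i s a. a \<in> joint A \<longrightarrow> \<bar>r i s a\<bar> \<le> 1) \<and>
     (\<forall>s a s'. a \<in> joint A \<longrightarrow> P s a s' \<ge> 0) \<and>
     (\<forall>s a. a \<in> joint A \<longrightarrow> 1 - (\<Sum>s'\<in>UNIV. P s a s') > 0) \<and>
     (\<forall>s. \<rho> s \<ge> 0) \<and> (\<Sum>s\<in>UNIV. \<rho> s) = 1"

definition polspace :: "('i::finite \<Rightarrow> 'a::finite set) \<Rightarrow> ('i,'s::finite,'a) pol set" where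
  "polspace A = {x. \<forall>i s. (\<forall>a. x $ (i,s,a) \<ge> 0) \<and> (\<forall>a. a \<notin> A i \<longrightarrow> x $ (i,s,a) = 0)
                     \<and> (\<Sum>a\<in>A i. x $ (i,s,a)) = 1}"

definition jprob :: "('i::finite,'s::finite,'a::finite) pol \<Rightarrow> 's \<Rightarrow> ('i \<Rightarrow> 'a) \<Rightarrow> real" where
  "jprob x s a = (\<Prod>i\<in>UNIV. x $ (i,s,a i))"

definition trans_mat :: "('i::finite \<Rightarrow> 'a::finite set) \<Rightarrow> ('s::finite \<Rightarrow> ('i \<Rightarrow> 'a) \<Rightarrow> 's \<Rightarrow> real)
   \<Rightarrow> ('i,'s,'a) pol \<Rightarrow> 's \<Rightarrow> 's \<Rightarrow> real" where
  "trans_mat A P x s s' = (\<Sum>a\<in>joint A. jprob x s a * P s a s')"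

definition rew_vec :: "('i::finite \<Rightarrow> 'a::finite set) \<Rightarrow> ('i \<Rightarrow> 's::finite \<Rightarrow> ('i \<Rightarrow> 'a) \<Rightarrow> real)
   \<Rightarrow> ('i,'s,'a) pol \<Rightarrow> 'i \<Rightarrow> 's \<Rightarrow> real" where
  "rew_vec A r x i s = (\<Sum>a\<in>joint A. jprob x s a * r i s a)"

text \<open>mpow t s s' = probability that the episode has not stopped before time t
  and s_t = s', starting from s.\<close>
fun mpow :: "('i::finite \<Rightarrow> 'a::finite set) \<Rightarrow> ('s::finite \<Rightarrow> ('i \<Rightarrow> 'a) \<Rightarrow> 's \<Rightarrow> real)
   \<Rightarrow> ('i,'s,'a) pol \<Rightarrow> nat \<Rightarrow> 's \<Rightarrow> 's \<Rightarrow> real" where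
  "mpow A P x 0 s s' = (if s = s' then 1 else 0)"
| "mpow A P x (Suc t) s s' = (\<Sum>u\<in>UNIV. mpow A P x t s u * trans_mat A P x u s')"

text \<open>Value V_{i,rho}(x) = E_x[sum_{t=0}^{T} r_i(s_t,a_t)]
  = sum_t sum_{s0,s} rho(s0) Pr(T >= t, s_t = s | s0) E[r_i(s,a_t)],
  i.e. the expectation of the episode return written out by linearity;
  the same formula gives the (smooth) extension to a neighborhood of Pi.\<close>
definition game_value :: "('i::finite \<Rightarrow> 'a::finite set) \<Rightarrow> ('s::finite \<Rightarrow> ('i \<Rightarrow> 'a) \<Rightarrow> 's \<Rightarrow> real)
   \<Rightarrow> ('i \<Rightarrow> 's \<Rightarrow> ('i \<Rightarrow> 'a) \<Rightarrow> real) \<Rightarrow> ('s \<Rightarrow> real) \<Rightarrow> 'i \<Rightarrow> ('i,'s,'a) pol \<Rightarrow> real" where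
  "game_value A P r \<rho> i x = (\<Sum>t. \<Sum>s0\<in>UNIV. \<Sum>s\<in>UNIV. \<rho> s0 * mpow A P x t s0 s * rew_vec A r x i s)"

definition gradfield :: "('i::finite \<Rightarrow> 'a::finite set) \<Rightarrow> ('s::finite \<Rightarrow> ('i \<Rightarrow> 'a) \<Rightarrow> 's \<Rightarrow> real)
   \<Rightarrow> ('i \<Rightarrow> 's \<Rightarrow> ('i \<Rightarrow> 'a) \<Rightarrow> real) \<Rightarrow> ('s \<Rightarrow> real) \<Rightarrow> ('i,'s,'a) pol \<Rightarrow> ('i,'s,'a) pol" where
  "gradfield A P r \<rho> x = (\<chi> j. case j of (i,s,a) \<Rightarrow>
       if a \<in> A i then deriv (\<lambda>t. game_value A P r \<rho> i (x + t *\<^sub>R axis (i,s,a) 1)) 0 else 0)"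

definition deviate :: "('i::finite,'s::finite,'a::finite) pol \<Rightarrow> 'i \<Rightarrow> ('i,'s,'a) pol \<Rightarrow> ('i,'s,'a) pol" where
  "deviate x i y = (\<chi> j. case j of (k,s,a) \<Rightarrow> if k = i then y $ (k,s,a) else x $ (k,s,a))"

definition is_nash where
  "is_nash A P r \<rho> xs \<longleftrightarrow> xs \<in> polspace A \<and>
     (\<forall>i. \<forall>y\<in>polspace A. game_value A P r \<rho> i xs \<ge> game_value A P r \<rho> i (deviate xs i y))"

definition is_sos where
  "is_sos A P r \<rho> xs \<longleftrightarrow>
     (\<forall>x\<in>polspace A. x \<noteq> xs \<longrightarrow>
        (x - xs) \<bullet> frechet_derivative (gradfield A P r \<rho>) (at xs) (x - xs) < 0)"

definition nbhd_in :: "'b::topological_space set \<Rightarrow> 'b \<Rightarrow> 'b set \<Rightarrow> bool" where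
  "nbhd_in S x U \<longleftrightarrow> U \<subseteq> S \<and> (\<exists>V. open V \<and> x \<in> V \<and> V \<inter> S \<subseteq> U)"

definition natfilt :: "'w measure \<Rightarrow> (nat \<Rightarrow> 'w \<Rightarrow> 'b::topological_space) \<Rightarrow> nat \<Rightarrow> 'w measure" where
  "natfilt M \<pi> n = sigma (space M)
      {\<pi> k -` S \<inter> space M | k S. 1 \<le> k \<and> k \<le> n \<and> S \<in> sets borel}"

definition vcond_exp :: "'w measure \<Rightarrow> 'w measure \<Rightarrow> ('w \<Rightarrow> real ^ 'n) \<Rightarrow> 'w \<Rightarrow> real ^ 'n" where
  "vcond_exp M F f = (\<lambda>w. \<chi> j. real_cond_exp M F (\<lambda>w. f w $ j) w)"

definition pg_run ::
  "'w measure \<Rightarrow> (real ^ 'n) set \<Rightarrow> (real ^ 'n \<Rightarrow> real ^ 'n) \<Rightarrow> real \<Rightarrow> real \<Rightarrow> real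
   \<Rightarrow> (nat \<Rightarrow> real) \<Rightarrow> (nat \<Rightarrow> real) \<Rightarrow> (nat \<Rightarrow> 'w \<Rightarrow> real ^ 'n) \<Rightarrow> (nat \<Rightarrow> 'w \<Rightarrow> real ^ 'n) \<Rightarrow> bool" where
  "pg_run M S v g p m B sig \<pi> vh \<longleftrightarrow> prob_space M \<and>
     (\<forall>n\<ge>1. \<pi> n \<in> borel_measurable M \<and> vh n \<in> borel_measurable M \<and>
              (\<forall>j. integrable M (\<lambda>w. vh n w $ j))) \<and>
     (\<forall>w\<in>space M. \<pi> 1 w \<in> S) \<and>
     (\<forall>n\<ge>1. \<forall>w\<in>space M.
        \<pi> (Suc n) w = closest_point S (\<pi> n w + (g / (real n + m) powr p) *\<^sub>R vh n w)) \<and>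
     (\<forall>n\<ge>1. AE w in M. nn_cond_exp M (natfilt M \<pi> n)
        (\<lambda>w. ennreal (norm (vcond_exp M (natfilt M \<pi> n) (vh n) w - v (\<pi> n w)))) w \<le> ennreal (B n)) \<and>
     (\<forall>n\<ge>1. AE w in M. nn_cond_exp M (natfilt M \<pi> n)
        (\<lambda>w. ennreal ((norm (vh n w - vcond_exp M (natfilt M \<pi> n) (vh n) w))\<^sup>2)) w \<le> ennreal ((sig n)\<^sup>2))"

end

(*
Idea. At a second-order stationary Nash policy the value of a player, restricted to one of its blocks
(one player, one state), changes by t * k * nu(t), nu(t) being an expected number of visits. It is
therefore locally constant, which second-order stationarity excludes, or it decreases at least
linearly. So the equilibrium is a sharp vertex of the policy polytope: v(xs) . (y - xs) <= -c |y - xs|.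

Given sharpness, everything follows from one-step inequalities for two Lyapunov functions. With
s = |x - xs|^2, the function (max 0 (s - r^2))^2 vanishes on the starting ball, so the probability of
leaving a larger ball is bounded by the accumulated noise; this gives the confinement for large m
and, restarted at late times, almost sure convergence. The function s + kappa s^2 contracts at a rate
strictly larger than 2 mu and its error term contains only the noise and the bias (near xs the
projection absorbs v itself). The strict gain removes the logarithm at 2 mu gamma = q, and
the absence of v from the error gives the rate q also when q > p.
*)

theory Submission
  imports Defs "HOL-Real_Asymp.Real_Asymp"
begin

section \<open>One step of projected gradient ascent\<close>

text \<open>Second-order stationarity concerns a quadratic form and yields first-order information
  only through single blocks: for such d, d . J d is the second derivative of one player's value
  along a segment, so local constancy would force it to vanish. A direction mixing players has no
  such meaning; it is recovered as a sum of blocks, and the uniform c comes from the finitely many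
  vertices of the polytope. Two obstacles shape the probabilistic half. The event E looks at the
  whole future, so no conditional expectation can be taken on it: the recursions run on the events
  of having stayed in \<open>\<B>\<close> up to time n, known at time n, and E is compared with them
  only at the end. And m may depend on \<delta> but not on the probability space or the run, while U
  may not even depend on \<delta>: the exit constant is therefore fixed first, uniformly in m, and
  the total noise is made small by dominated summation. All derivatives are two-sided, so the value
  must be smooth around the policy space and not only on it; Cramer's rule writes it there as a
  quotient of polynomials.\<close>

lemma projected_step:
  fixes S :: "'b::euclidean_space set"
  assumes S: "convex S" "closed S" and x: "x \<in> S" and z: "z \<in> S"
    and x': "x' = closest_point S (x + \<gamma> *\<^sub>R w)"
  shows "(norm (x' - z))\<^sup>2 \<le> (norm (x - z))\<^sup>2 - (norm (x' - x))\<^sup>2 + 2 * \<gamma> * (w \<bullet> (x' - z))"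
    and "(norm (x' - z))\<^sup>2 \<le> (norm (x - z))\<^sup>2 + 2 * \<gamma> * (w \<bullet> (x - z)) + \<gamma>\<^sup>2 * (norm w)\<^sup>2"
    and "norm (x' - x) \<le> norm (\<gamma> *\<^sub>R w)"
proof -
  \<comment> \<open>Variational inequality of the projection. The first form pairs \<open>w\<close>
    with the new point and keeps the gain \<open>- (norm (x' - x))^2\<close>; near a sharp
    equilibrium both are essential.\<close>
  have "(x + \<gamma> *\<^sub>R w - x') \<bullet> (z - x') \<le> 0"
    unfolding x' by (rule closest_point_dot[OF S z])
  moreover have "(x + \<gamma> *\<^sub>R w - x') \<bullet> (z - x') = (x' - x) \<bullet> (x' - z) - \<gamma> * (w \<bullet> (x' - z))"
    by (simp add: inner_simps right_diff_distrib)
  moreover have "(norm ((x' - z) - (x' - x)))\<^sup>2 =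
      (norm (x' - z))\<^sup>2 + (norm (x' - x))\<^sup>2 - 2 * ((x' - x) \<bullet> (x' - z))"
    unfolding power2_norm_eq_inner inner_diff_left[of "x' - z" "x' - x"] inner_diff_right[of _ "x' - z" "x' - x"]
    by (simp add: inner_commute[of "x' - z" "x' - x"])
  ultimately show 1: "(norm (x' - z))\<^sup>2 \<le> (norm (x - z))\<^sup>2 - (norm (x' - x))\<^sup>2 + 2 * \<gamma> * (w \<bullet> (x' - z))"
    by simp
  \<comment> \<open>Young's inequality: moving the pairing from \<open>x' - z\<close> back to
    \<open>x - z\<close> spends the gained square and costs \<gamma>^2 |w|^2.\<close>
  have "(norm (x' - x - \<gamma> *\<^sub>R w))\<^sup>2 \<ge> 0" by simp
  then have "2 * \<gamma> * (w \<bullet> (x' - x)) \<le> (norm (x' - x))\<^sup>2 + \<gamma>\<^sup>2 * (norm w)\<^sup>2"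
    unfolding power2_norm_eq_inner inner_diff_left[of "x' - x"] inner_diff_right[of _ "x' - x"]
    by (simp add: inner_commute[of "x' - x" w] power2_eq_square)
  moreover have "2 * \<gamma> * (w \<bullet> (x' - z)) = 2 * \<gamma> * (w \<bullet> (x - z)) + 2 * \<gamma> * (w \<bullet> (x' - x))"
    by (simp add: algebra_simps)
  ultimately show "(norm (x' - z))\<^sup>2 \<le> (norm (x - z))\<^sup>2 + 2 * \<gamma> * (w \<bullet> (x - z)) + \<gamma>\<^sup>2 * (norm w)\<^sup>2"
    using 1 by linarith
  have "dist x' (closest_point S x) \<le> dist (x + \<gamma> *\<^sub>R w) x"
    unfolding x' using closest_point_lipschitz[OF S] x by blast
  then show "norm (x' - x) \<le> norm (\<gamma> *\<^sub>R w)"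
    by (simp add: closest_point_self[OF x] dist_norm)
qed

lemma norm_sum3_square_le:
  fixes a b c :: "'b::real_inner"
  shows "(norm (a + b + c))\<^sup>2 \<le> 3 * ((norm a)\<^sup>2 + (norm b)\<^sup>2 + (norm c)\<^sup>2)"
proof -
  \<comment> \<open>The three squares sum to exactly the right side minus the left side of the
    claim.\<close>
  have "(norm (a - b))\<^sup>2 + (norm (b - c))\<^sup>2 + (norm (a - c))\<^sup>2 \<ge> 0" by simp
  then show ?thesis
    by (simp add: power2_norm_eq_inner inner_simps inner_commute[of b a] inner_commute[of c a] inner_commute[of c b])
qed

lemma norm_square_diff_le:
  fixes x x' z :: "'b::real_inner"
  assumes "norm (x - z) \<le> D" "norm (x' - z) \<le> D"
  shows "((norm (x' - z))\<^sup>2 - (norm (x - z))\<^sup>2)\<^sup>2 \<le> 4 * D\<^sup>2 * (norm (x' - x))\<^sup>2"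
proof -
  let ?a = "norm (x' - z)" and ?b = "norm (x - z)"
  have D: "D \<ge> 0" using assms norm_ge_zero[of "x - z"] by linarith
  have *: "\<bar>?a - ?b\<bar> \<le> norm (x' - x)"
    using norm_triangle_ineq3[of "x' - z" "x - z"] by simp
  have "?a\<^sup>2 - ?b\<^sup>2 = (?a - ?b) * (?a + ?b)"
    unfolding power2_eq_square ring_distribs by (simp only: mult.commute)
  then have "\<bar>?a\<^sup>2 - ?b\<^sup>2\<bar> = \<bar>?a - ?b\<bar> * (?a + ?b)"
    by (simp only: abs_mult) simp
  also have "\<dots> \<le> norm (x' - x) * (2 * D)"
    by (rule mult_mono) (use * assms D in auto)
  finally have "\<bar>?a\<^sup>2 - ?b\<^sup>2\<bar>\<^sup>2 \<le> (norm (x' - x) * (2 * D))\<^sup>2"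
    by (rule power_mono) simp
  then show ?thesis unfolding power2_abs power_mult_distrib by (simp only: mult.commute) simp
qed

text \<open>The truncated quadratic vanishes up to radius \<open>r\<close>; this is what makes the exit probability
  proportional to the accumulated noise alone, whatever the starting point of the ball.\<close>

lemma exit_lyapunov_step:
  fixes S :: "'b::euclidean_space set" and v :: "'b \<Rightarrow> 'b"
  assumes S: "convex S" "compact S" and z: "z \<in> S" and v: "continuous_on S v"
  obtains C where "C \<ge> 0"
    "\<And>x x' \<gamma> u b. x \<in> S \<Longrightarrow> v x \<bullet> (x - z) \<le> 0 \<Longrightarrow> 0 < \<gamma> \<Longrightarrow>
       x' = closest_point S (x + \<gamma> *\<^sub>R (v x + b + u)) \<Longrightarrow>
       (max 0 ((norm (x' - z))\<^sup>2 - r))\<^sup>2 \<le> (max 0 ((norm (x - z))\<^sup>2 - r))\<^sup>2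
         + \<gamma> * (u \<bullet> ((4 * max 0 ((norm (x - z))\<^sup>2 - r)) *\<^sub>R (x - z)))
         + C * (\<gamma>\<^sup>2 * (norm u)\<^sup>2 + \<gamma> * norm b + \<gamma>\<^sup>2 * (norm b)\<^sup>2) + C * \<gamma>\<^sup>2"
proof -
  have cl: "closed S" using S compact_imp_closed by blast
  obtain D0 where D0: "\<And>x. x \<in> S \<Longrightarrow> norm (x - z) \<le> D0"
    using compact_imp_bounded[OF S(2)] bounded_any_center[of S z] by (auto simp: dist_norm norm_minus_commute)
  define D where "D = max D0 1"
  have D: "\<And>x. x \<in> S \<Longrightarrow> norm (x - z) \<le> D" "D \<ge> 1" using D0 by (auto simp: D_def le_max_iff_disj)
  obtain V where V: "\<And>x. x \<in> S \<Longrightarrow> norm (v x) \<le> V"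
    using compact_imp_bounded[OF compact_continuous_image[OF v S(2)]] by (auto simp: bounded_iff)
  \<comment> \<open>In this lemma \<open>r\<close> is the square of the radius. \<open>R\<close>
    bounds the truncated square; \<open>K\<close> is the factor of \<gamma>^2 |w|^2, one part from
    the linear term and one from the second-order term.\<close>
  define R where "R = D\<^sup>2 + \<bar>r\<bar>"
  have R: "R \<ge> 0" by (simp add: R_def)
  define K where "K = 2 * R + 4 * D\<^sup>2"
  have K: "K \<ge> 0" using R by (simp add: K_def)
  \<comment> \<open>The part 3 K V^2 stems from \<open>v\<close> and ends in the separate term
    \<open>C * \<gamma>^2\<close>, which is summable for p > 1/2 and hence harmless for an exit
    bound.\<close>
  define C where "C = 4 * R * D + 3 * K + 3 * K * V\<^sup>2"
  have C: "C \<ge> 0" using R K D by (simp add: C_def)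
  show thesis
  proof (rule that[OF C])
    fix x x' u b and \<gamma> :: real
    assume x: "x \<in> S" and neg: "v x \<bullet> (x - z) \<le> 0" and g: "0 < \<gamma>"
      and x': "x' = closest_point S (x + \<gamma> *\<^sub>R (v x + b + u))"
    let ?w = "v x + b + u"
    let ?s = "(norm (x - z))\<^sup>2" and ?t = "(norm (x' - z))\<^sup>2"
    define p where "p = max 0 (?s - r)"
    have x'S: "x' \<in> S" unfolding x' using closest_point_in_set[OF cl] x by blast
    note st = projected_step[OF S(1) cl x z x']
    have p0: "p \<ge> 0" by (simp add: p_def)
    have sD: "?s \<le> D\<^sup>2" using D(1)[OF x] by (simp add: power_mono)
    have pR: "p \<le> R" using sD by (auto simp: p_def R_def)
    have w2: "(norm ?w)\<^sup>2 \<le> 3 * (V\<^sup>2 + (norm b)\<^sup>2 + (norm u)\<^sup>2)"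
      using norm_sum3_square_le[of "v x" b u] power_mono[OF V[OF x], of 2] by simp
    have "(?t - ?s)\<^sup>2 \<le> 4 * D\<^sup>2 * (norm (x' - x))\<^sup>2"
      by (rule norm_square_diff_le[OF D(1)[OF x] D(1)[OF x'S]])
    also have "\<dots> \<le> 4 * D\<^sup>2 * (\<gamma>\<^sup>2 * (norm ?w)\<^sup>2)"
      using power_mono[OF st(3), of 2] by (intro mult_left_mono) (auto simp: power_mult_distrib)
    finally have ts: "(?t - ?s)\<^sup>2 \<le> 4 * D\<^sup>2 * (\<gamma>\<^sup>2 * (norm ?w)\<^sup>2)" .
    \<comment> \<open>\<open>p\<close> dominates s - r, so squaring this bound replaces a case
      distinction at the truncation point.\<close>
    have "max 0 (?t - r) \<le> \<bar>p + (?t - ?s)\<bar>" unfolding p_def by auto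
    then have "(max 0 (?t - r))\<^sup>2 \<le> \<bar>p + (?t - ?s)\<bar>\<^sup>2" by (rule power_mono) simp
    also have "\<dots> = p\<^sup>2 + 2 * p * (?t - ?s) + (?t - ?s)\<^sup>2" by (simp add: power2_sum)
    also have "\<dots> \<le> p\<^sup>2 + 2 * p * (2 * \<gamma> * (?w \<bullet> (x - z)) + \<gamma>\<^sup>2 * (norm ?w)\<^sup>2) + 4 * D\<^sup>2 * (\<gamma>\<^sup>2 * (norm ?w)\<^sup>2)"
      using ts st(2) p0 by (intro add_mono mult_left_mono) auto
    also have "\<dots> \<le> p\<^sup>2 + 4 * p * \<gamma> * (?w \<bullet> (x - z)) + K * (\<gamma>\<^sup>2 * (norm ?w)\<^sup>2)"
    proof -
      have "(2 * p) * (\<gamma>\<^sup>2 * (norm ?w)\<^sup>2) \<le> (2 * R) * (\<gamma>\<^sup>2 * (norm ?w)\<^sup>2)"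
        by (rule mult_right_mono) (use pR in auto)
      then show ?thesis by (simp add: K_def algebra_simps)
    qed
    also have "K * (\<gamma>\<^sup>2 * (norm ?w)\<^sup>2) \<le> K * (\<gamma>\<^sup>2 * (3 * (V\<^sup>2 + (norm b)\<^sup>2 + (norm u)\<^sup>2)))"
      using w2 K by (intro mult_left_mono) auto
    also have "4 * p * \<gamma> * (?w \<bullet> (x - z)) \<le> 4 * p * \<gamma> * (u \<bullet> (x - z)) + 4 * R * \<gamma> * (norm b * D)"
    proof -
      have bD: "b \<bullet> (x - z) \<le> norm b * D"
        using norm_cauchy_schwarz[of b "x - z"] mult_left_mono[OF D(1)[OF x], of "norm b"] by simp
      have "4 * p * \<gamma> * (?w \<bullet> (x - z)) \<le> 4 * p * \<gamma> * (u \<bullet> (x - z) + norm b * D)"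
        using neg bD p0 g by (intro mult_left_mono) (auto simp: inner_add_left)
      moreover have "4 * p * \<gamma> * (norm b * D) \<le> 4 * R * \<gamma> * (norm b * D)"
        using pR g D by (intro mult_right_mono) auto
      ultimately show ?thesis by (simp add: algebra_simps)
    qed
    finally have 1: "(max 0 (?t - r))\<^sup>2 \<le> p\<^sup>2 + (4 * p * \<gamma> * (u \<bullet> (x - z)) + 4 * R * \<gamma> * (norm b * D)) +
        K * (\<gamma>\<^sup>2 * (3 * (V\<^sup>2 + (norm b)\<^sup>2 + (norm u)\<^sup>2)))" by simp
    have m: "4 * R * D \<le> C" "3 * K \<le> C" "3 * K * V\<^sup>2 \<le> C"
      using R K D by (auto simp: C_def)
    have "4 * R * D * (\<gamma> * norm b) \<le> C * (\<gamma> * norm b)"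
      "3 * K * (\<gamma>\<^sup>2 * (norm b)\<^sup>2) \<le> C * (\<gamma>\<^sup>2 * (norm b)\<^sup>2)"
      "3 * K * (\<gamma>\<^sup>2 * (norm u)\<^sup>2) \<le> C * (\<gamma>\<^sup>2 * (norm u)\<^sup>2)"
      "3 * K * V\<^sup>2 * \<gamma>\<^sup>2 \<le> C * \<gamma>\<^sup>2"
      by (intro mult_right_mono m; use g in simp)+
    with 1 show "(max 0 (?t - r))\<^sup>2 \<le> (max 0 (?s - r))\<^sup>2
         + \<gamma> * (u \<bullet> ((4 * max 0 (?s - r)) *\<^sub>R (x - z)))
         + C * (\<gamma>\<^sup>2 * (norm u)\<^sup>2 + \<gamma> * norm b + \<gamma>\<^sup>2 * (norm b)\<^sup>2) + C * \<gamma>\<^sup>2"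
      unfolding p_def[symmetric] by (simp add: algebra_simps)
  qed
qed

text \<open>The quartic correction makes the far part of \<open>B\<close>, where only the constant \<open>\<mu>\<close> is available,
  contract with a constant strictly above \<open>2 * \<mu>\<close>. Close to \<open>z\<close> the sharp linear decrease
  \<open>c * norm (x' - z)\<close> of the implicit form of the step does the same, and there \<open>v x\<close> itself does
  not contribute to the error term.\<close>

lemma rate_lyapunov_step:
  fixes S :: "'b::euclidean_space set" and v :: "'b \<Rightarrow> 'b"
  assumes S: "convex S" "compact S" and z: "z \<in> S" and v: "continuous_on S v"
    and c: "c > 0" and sharp: "\<And>y. y \<in> S \<Longrightarrow> v z \<bullet> (y - z) \<le> - c * norm (y - z)"
    and mu: "\<mu> > 0" and BS: "B \<subseteq> S"
    and strong: "\<And>x. x \<in> B \<Longrightarrow> v x \<bullet> (x - z) \<le> - \<mu> * (norm (x - z))\<^sup>2"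
  obtains \<kappa> \<alpha> C \<gamma>0 where "\<kappa> > 0" "\<alpha> > 2 * \<mu>" "C \<ge> 0" "\<gamma>0 > 0"
    "\<And>x x' \<gamma> u b. x \<in> B \<Longrightarrow> 0 < \<gamma> \<Longrightarrow> \<gamma> \<le> \<gamma>0 \<Longrightarrow>
       x' = closest_point S (x + \<gamma> *\<^sub>R (v x + b + u)) \<Longrightarrow>
       (norm (x' - z))\<^sup>2 + \<kappa> * ((norm (x' - z))\<^sup>2)\<^sup>2
       \<le> (1 - \<alpha> * \<gamma> + C * \<gamma>\<^sup>2) * ((norm (x - z))\<^sup>2 + \<kappa> * ((norm (x - z))\<^sup>2)\<^sup>2)
         + \<gamma> * (u \<bullet> ((2 * (1 + 2 * \<kappa> * (norm (x - z))\<^sup>2)) *\<^sub>R (x - z)))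
         + C * (\<gamma>\<^sup>2 * (norm u)\<^sup>2 + \<gamma> * norm b + \<gamma>\<^sup>2 * (norm b)\<^sup>2)"
proof -
  have cl: "closed S" using S compact_imp_closed by blast
  obtain D0 where D0: "\<And>x. x \<in> S \<Longrightarrow> norm (x - z) \<le> D0"
    using compact_imp_bounded[OF S(2)] bounded_any_center[of S z] by (auto simp: dist_norm norm_minus_commute)
  define D where "D = max D0 1"
  have D: "\<And>x. x \<in> S \<Longrightarrow> norm (x - z) \<le> D" "D \<ge> 1" using D0 by (auto simp: D_def le_max_iff_disj)
  obtain V where V: "\<And>x. x \<in> S \<Longrightarrow> norm (v x) \<le> V"
    using compact_imp_bounded[OF compact_continuous_image[OF v S(2)]] by (auto simp: bounded_iff)
  obtain \<epsilon>0 where e0: "\<epsilon>0 > 0" "\<And>x. x \<in> S \<Longrightarrow> dist x z < \<epsilon>0 \<Longrightarrow> dist (v x) (v z) < c / 2"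
    using v z c unfolding continuous_on_iff by (meson half_gt_zero)
  \<comment> \<open>Within \<epsilon> of \<open>z\<close> the field still has half of the sharpness,
    and c / (16 \<mu>) makes the linear decrease dominate the quadratic one: 8 \<mu> \<epsilon> <= c
    / 2.\<close>
  define \<epsilon> where "\<epsilon> = min (\<epsilon>0 / 2) (min 1 (c / (16 * \<mu>)))"
  have e: "\<epsilon> > 0" "\<epsilon> < \<epsilon>0" "\<epsilon> \<le> 1" "\<epsilon> \<le> c / (16 * \<mu>)"
    using e0 c mu by (auto simp: \<epsilon>_def min_less_iff_disj)
  \<comment> \<open>Small enough that the second-order term of the quartic costs at most a quarter
    of |x' - x|^2, and that its derivative \<open>l\<close> stays in [1, 9/8].\<close>
  define \<kappa> where "\<kappa> = 1 / (16 * D\<^sup>2)"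
  have D2: "D\<^sup>2 \<ge> 1" using D(2) by simp
  have kap: "\<kappa> > 0" "\<kappa> * D\<^sup>2 = 1/16" "\<kappa> \<le> 1/16" using D2 by (auto simp: \<kappa>_def divide_simps)
  \<comment> \<open>The surplus \<kappa> \<epsilon>^2 / 2 is what the quartic gains at distance at
    least \<epsilon> from \<open>z\<close>.\<close>
  define \<alpha> where "\<alpha> = 2 * \<mu> * (1 + \<kappa> * \<epsilon>\<^sup>2 / 2)"
  have "\<kappa> * \<epsilon>\<^sup>2 \<le> 1/16 * 1" using kap e by (intro mult_mono) (auto simp: power_le_one)
  then have al: "\<alpha> > 2 * \<mu>" "\<alpha> \<le> 4 * \<mu>" "\<alpha> > 0" using mu kap e by (auto simp: \<alpha>_def add_pos_pos)
  \<comment> \<open>The summand 6 V^2 / \<epsilon>^2 turns the additive error \<gamma>^2 V^2 of the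
    far region, where f >= \<epsilon>^2, into the multiplicative C \<gamma>^2 f.\<close>
  define C where "C = 9 + 3 * D + 6 * V\<^sup>2 / \<epsilon>\<^sup>2"
  have C: "C \<ge> 0" using D by (simp add: C_def)
  define \<gamma>0 where "\<gamma>0 = 1 / (64 * \<mu>)"
  have g0: "\<gamma>0 > 0" using mu by (simp add: \<gamma>0_def)
  show thesis
  proof (rule that[OF kap(1) al(1) C g0])
    fix x x' u b and \<gamma> :: real
    assume xB: "x \<in> B" and g: "0 < \<gamma>" "\<gamma> \<le> \<gamma>0"
      and x': "x' = closest_point S (x + \<gamma> *\<^sub>R (v x + b + u))"
    have x: "x \<in> S" using xB BS by blast
    have x'S: "x' \<in> S" unfolding x' using closest_point_in_set[OF cl] x by blast
    let ?w = "v x + b + u"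
    define s where "s = (norm (x - z))\<^sup>2"
    define t where "t = (norm (x' - z))\<^sup>2"
    define h where "h = (norm (x' - x))\<^sup>2"
    define f where "f = s + \<kappa> * s\<^sup>2"
    define W where "W = u \<bullet> (x - z)"
    define l where "l = 1 + 2 * \<kappa> * s"
    note st = projected_step[OF S(1) cl x z x', folded s_def t_def h_def]
    have s: "0 \<le> s" "s \<le> D\<^sup>2" using D(1)[OF x] by (auto simp: s_def power_mono)
    have h0: "h \<ge> 0" by (simp add: h_def)
    have ks: "\<kappa> * s \<le> 1/16" "\<kappa> * s \<ge> 0" using mult_left_mono[OF s(2), of \<kappa>] kap s by auto
    have l: "1 \<le> l" "l \<le> 9/8" using ks by (auto simp: l_def)
    have f_le: "f \<le> 2 * s" "f \<ge> s"
      using ks mult_right_mono[OF ks(1) s(1)] kap s by (auto simp: f_def power2_eq_square algebra_simps)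
    have "(t - s)\<^sup>2 \<le> 4 * D\<^sup>2 * h"
      unfolding s_def t_def h_def by (rule norm_square_diff_le[OF D(1)[OF x] D(1)[OF x'S]])
    then have "\<kappa> * (t - s)\<^sup>2 \<le> \<kappa> * (4 * D\<^sup>2 * h)" using kap by (intro mult_left_mono) auto
    also have "\<dots> = h / 4" using kap by (simp add: algebra_simps)
    finally have q: "\<kappa> * (t - s)\<^sup>2 \<le> h / 4" .
    \<comment> \<open>Exact expansion of s + \<kappa> s^2 around s, with derivative
      \<open>l\<close>.\<close>
    have f': "t + \<kappa> * t\<^sup>2 = f + l * (t - s) + \<kappa> * (t - s)\<^sup>2"
      by (simp add: f_def l_def power2_eq_square algebra_simps)
    have bD: "b \<bullet> (y - z) \<le> norm b * D" if "y \<in> S" for y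
      using norm_cauchy_schwarz[of b "y - z"] mult_left_mono[OF D(1)[OF that], of "norm b"] by simp
    have nb: "norm b * D \<ge> 0" using D by simp
    define e where "e = C * (\<gamma>\<^sup>2 * (norm u)\<^sup>2 + \<gamma> * norm b + \<gamma>\<^sup>2 * (norm b)\<^sup>2)"
    have main: "t + \<kappa> * t\<^sup>2 \<le> (1 - \<alpha> * \<gamma> + C * \<gamma>\<^sup>2) * f + 2 * \<gamma> * l * W + e"
    proof (cases "norm (x - z) \<le> \<epsilon>")
      \<comment> \<open>Near \<open>z\<close> the step is used in implicit form. The gain h = |x' -
        x|^2 is spent as 1/4 on the noise, 1/4 on the quartic, and 1/2 on the contraction.\<close>
      case True
      let ?d = "norm (x - z)" and ?d' = "norm (x' - z)"
      have vx: "v x \<bullet> (x' - z) \<le> - (c / 2) * ?d'"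
      proof -
        have "norm (v x - v z) \<le> c / 2"
          using e0(2)[OF x] True e by (simp add: dist_norm)
        then have "(v x - v z) \<bullet> (x' - z) \<le> c / 2 * ?d'"
          using norm_cauchy_schwarz[of "v x - v z" "x' - z"] mult_right_mono[of "norm (v x - v z)" "c / 2" ?d']
          by (meson norm_ge_zero order_trans)
        with sharp[OF x'S] show ?thesis by (simp add: inner_diff_left algebra_simps)
      qed
      \<comment> \<open>The implicit form pairs the noise with x', which depends on it; returning to
        the pairing with x, whose expectation vanishes, costs 4 \<gamma>^2 |u|^2 and h / 4.\<close>
      have "u \<bullet> (x' - x) * (2 * \<gamma>) \<le> 4 * \<gamma>\<^sup>2 * (norm u)\<^sup>2 + h / 4"
      proof -
        have "(norm ((2 * \<gamma>) *\<^sub>R u - (1/2) *\<^sub>R (x' - x)))\<^sup>2 \<ge> 0" by simp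
        then show ?thesis
          unfolding h_def
          by (simp only: power2_norm_eq_inner inner_diff_left inner_diff_right inner_scaleR_left inner_scaleR_right)
            (simp add: inner_commute power2_eq_square algebra_simps add_divide_distrib diff_divide_distrib)
      qed
      then have "2 * \<gamma> * (u \<bullet> (x' - z)) \<le> 2 * \<gamma> * W + 4 * \<gamma>\<^sup>2 * (norm u)\<^sup>2 + h / 4"
        by (simp add: W_def algebra_simps)
      moreover have "2 * \<gamma> * (v x \<bullet> (x' - z)) \<le> - \<gamma> * c * ?d'"
        using mult_left_mono[OF vx, of "2 * \<gamma>"] g by simp
      moreover have "2 * \<gamma> * (b \<bullet> (x' - z)) \<le> 2 * \<gamma> * (norm b * D)"
        using bD[OF x'S] g by (intro mult_left_mono) auto
      ultimately have "t - s \<le> 2 * \<gamma> * W + (4 * \<gamma>\<^sup>2 * (norm u)\<^sup>2 + 2 * \<gamma> * (norm b * D)) - (\<gamma> * c * ?d' + 3/4 * h)"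
        using st(1) by (simp add: inner_add_left algebra_simps)
      then have "l * (t - s) \<le> l * (2 * \<gamma> * W + (4 * \<gamma>\<^sup>2 * (norm u)\<^sup>2 + 2 * \<gamma> * (norm b * D)) - (\<gamma> * c * ?d' + 3/4 * h))"
        using l by (intro mult_left_mono) auto
      also have "\<dots> = 2 * \<gamma> * l * W + l * (4 * \<gamma>\<^sup>2 * (norm u)\<^sup>2 + 2 * \<gamma> * (norm b * D)) - l * (\<gamma> * c * ?d' + 3/4 * h)"
        by (simp add: algebra_simps)
      also have "l * (4 * \<gamma>\<^sup>2 * (norm u)\<^sup>2 + 2 * \<gamma> * (norm b * D)) \<le> 9/8 * (4 * \<gamma>\<^sup>2 * (norm u)\<^sup>2 + 2 * \<gamma> * (norm b * D))"
        using l g nb by (intro mult_right_mono) auto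
      also have "\<dots> \<le> e"
      proof -
        have cs: "9/8 * 4 \<le> C" "9/8 * 2 * D \<le> C" using D by (auto simp: C_def)
        have "9/8 * 4 * (\<gamma>\<^sup>2 * (norm u)\<^sup>2) \<le> C * (\<gamma>\<^sup>2 * (norm u)\<^sup>2)"
          "9/8 * 2 * D * (\<gamma> * norm b) \<le> C * (\<gamma> * norm b)"
          by (intro mult_right_mono cs; use g in simp)+
        moreover have "0 \<le> C * (\<gamma>\<^sup>2 * (norm b)\<^sup>2)" using C by simp
        ultimately show ?thesis by (simp add: e_def algebra_simps)
      qed
      finally have A: "l * (t - s) \<le> 2 * \<gamma> * l * W + e - l * (\<gamma> * c * ?d' + 3/4 * h)" by simp
      have B: "l * (\<gamma> * c * ?d' + 3/4 * h) \<ge> \<gamma> * c * ?d' + 3/4 * h"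
        using mult_right_mono[OF l(1), of "\<gamma> * c * ?d' + 3/4 * h"] g c h0 by simp
      have E: "\<alpha> * \<gamma> * f \<le> \<gamma> * c * ?d' + h / 2"
      proof -
        have "\<alpha> * \<gamma> * f \<le> (4 * \<mu>) * \<gamma> * (2 * s)"
          using al g f_le s mu by (intro mult_mono) auto
        also have "\<dots> = 8 * \<mu> * \<gamma> * ?d\<^sup>2" by (simp add: s_def)
        also have "\<dots> \<le> \<gamma> * c * ?d' + h / 2"
        \<comment> \<open>After a short move x' is at least half as far from \<open>z\<close> as x,
          and the sharp term \<gamma> c |x' - z| suffices; after a long one h >= |x - z|^2 / 4, and
          \<gamma>0 is chosen so that 8 \<mu> \<gamma> <= 1/8.\<close>
        proof (cases "norm (x' - x) \<le> ?d / 2")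
          case T: True
          have "?d \<le> norm (x' - x) + ?d'"
            using norm_triangle_ineq[of "x - x'" "x' - z"] by (simp add: norm_minus_commute)
          with T have d': "?d \<le> 2 * ?d'" by simp
          have "8 * \<mu> * \<epsilon> \<le> c / 2" using e mu by (simp add: field_simps)
          moreover have "8 * \<mu> * ?d \<le> 8 * \<mu> * \<epsilon>" using True mu by simp
          ultimately have "8 * \<mu> * ?d \<le> c / 2" by linarith
          then have "\<gamma> * (8 * \<mu> * ?d * ?d) \<le> \<gamma> * (c / 2 * (2 * ?d'))"
            using g d' c by (intro mult_left_mono mult_mono) auto
          then show ?thesis using h0 by (simp add: power2_eq_square algebra_simps)
        next
          case False
          then have "(?d / 2)\<^sup>2 \<le> h" unfolding h_def by (intro power_mono) auto
          then have "?d\<^sup>2 / 8 \<le> h / 2" by (simp add: power_divide)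
          moreover have "8 * \<mu> * \<gamma> * ?d\<^sup>2 \<le> 8 * \<mu> * \<gamma>0 * ?d\<^sup>2"
            using g mu by (intro mult_right_mono) auto
          moreover have "8 * \<mu> * \<gamma>0 = 1 / 8" using mu by (simp add: \<gamma>0_def)
          moreover have "0 \<le> \<gamma> * c * ?d'" using g c by simp
          ultimately show ?thesis by simp
        qed
        finally show ?thesis .
      qed
      have "0 \<le> C * \<gamma>\<^sup>2 * f" using C f_le s by simp
      with A B E q h0 show ?thesis unfolding f' by (simp add: algebra_simps)
    next
      \<comment> \<open>Far from \<open>z\<close> the explicit form and the constant \<mu> are used;
        s >= \<epsilon>^2 turns the growth of \<open>l\<close> with s into the surplus of
        \<alpha>.\<close>
      case False
      have se: "\<epsilon>\<^sup>2 \<le> s" unfolding s_def using False e by (intro power_mono) auto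
      have vx: "v x \<bullet> (x - z) \<le> - \<mu> * s" using strong[OF xB] by (simp add: s_def)
      have w2: "(norm ?w)\<^sup>2 \<le> 3 * (V\<^sup>2 + (norm b)\<^sup>2 + (norm u)\<^sup>2)"
        using norm_sum3_square_le[of "v x" b u] power_mono[OF V[OF x], of 2] by simp
      have hw: "h \<le> \<gamma>\<^sup>2 * (norm ?w)\<^sup>2"
        using power_mono[OF st(3), of 2] by (simp add: h_def power_mult_distrib)
      define Q where "Q = \<gamma>\<^sup>2 * (norm ?w)\<^sup>2"
      have Q0: "Q \<ge> 0" by (simp add: Q_def)
      have "2 * \<gamma> * (?w \<bullet> (x - z)) \<le> 2 * \<gamma> * (- \<mu> * s + norm b * D + W)"
        using g vx bD[OF x] by (intro mult_left_mono) (auto simp: inner_add_left W_def)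
      then have "t - s \<le> - 2 * \<gamma> * \<mu> * s + 2 * \<gamma> * (norm b * D) + 2 * \<gamma> * W + Q"
        using st(2)[folded Q_def] by (simp add: algebra_simps)
      then have "l * (t - s) \<le> l * (- 2 * \<gamma> * \<mu> * s + 2 * \<gamma> * (norm b * D) + 2 * \<gamma> * W + Q)"
        using l by (intro mult_left_mono) auto
      also have "\<dots> = - (l * (2 * \<gamma> * \<mu> * s)) + 2 * \<gamma> * l * W + l * (2 * \<gamma> * (norm b * D) + Q)"
        by (simp add: algebra_simps)
      also have "l * (2 * \<gamma> * (norm b * D) + Q) \<le> 9/8 * (2 * \<gamma> * (norm b * D) + Q)"
        using l g nb Q0 by (intro mult_right_mono) auto
      finally have A: "l * (t - s) + h / 4 \<le> - (l * (2 * \<gamma> * \<mu> * s)) + 2 * \<gamma> * l * W + 9/4 * \<gamma> * (norm b * D) + 2 * (Q)"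
        using hw[folded Q_def] Q0 by (simp add: algebra_simps)
      have E: "\<alpha> * \<gamma> * f \<le> l * (2 * \<gamma> * \<mu> * s)"
      proof -
        \<comment> \<open>The product exceeds 1 + \<kappa> s by two terms, each at most \<kappa> s /
          2: one by \<epsilon>^2 <= s, the other by \<kappa> \<epsilon>^2 <= 1.\<close>
        have "(1 + \<kappa> * \<epsilon>\<^sup>2 / 2) * (1 + \<kappa> * s) \<le> l"
        proof -
          have "\<kappa> * \<epsilon>\<^sup>2 \<le> \<kappa> * s" using se kap by simp
          moreover have "\<kappa> * \<epsilon>\<^sup>2 * (\<kappa> * s) \<le> \<kappa> * s * 1"
            using calculation ks kap by (intro mult_mono) auto
          ultimately show ?thesis unfolding l_def by (simp add: algebra_simps)
        qed
        then have "2 * \<mu> * \<gamma> * s * ((1 + \<kappa> * \<epsilon>\<^sup>2 / 2) * (1 + \<kappa> * s)) \<le> 2 * \<mu> * \<gamma> * s * l"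
          using mu g s by (intro mult_left_mono) auto
        moreover have "\<alpha> * \<gamma> * f = 2 * \<mu> * \<gamma> * s * ((1 + \<kappa> * \<epsilon>\<^sup>2 / 2) * (1 + \<kappa> * s))"
          unfolding \<alpha>_def f_def power2_eq_square by (simp only: algebra_simps)
        ultimately show ?thesis by (metis mult.commute mult.left_commute)
      qed
      have F: "9/4 * \<gamma> * (norm b * D) + 2 * (Q) \<le> e + C * \<gamma>\<^sup>2 * f"
      proof -
        have "2 * (Q) \<le> 2 * (\<gamma>\<^sup>2 * (3 * (V\<^sup>2 + (norm b)\<^sup>2 + (norm u)\<^sup>2)))"
          unfolding Q_def using w2 by (intro mult_left_mono) auto
        moreover have "6 * V\<^sup>2 * \<gamma>\<^sup>2 \<le> C * \<gamma>\<^sup>2 * f"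
        proof -
          have "6 * V\<^sup>2 = 6 * V\<^sup>2 / \<epsilon>\<^sup>2 * \<epsilon>\<^sup>2" using e by simp
          also have "\<dots> \<le> C * f" using se f_le D by (intro mult_mono) (auto simp: C_def)
          finally show ?thesis using mult_right_mono[of "6 * V\<^sup>2" "C * f" "\<gamma>\<^sup>2"] by (simp add: mult_ac)
        qed
        moreover have cs: "6 \<le> C" "9/4 * D \<le> C" using D by (auto simp: C_def intro!: add_nonneg_nonneg add_mono)
        moreover have "9/4 * D * (\<gamma> * norm b) \<le> C * (\<gamma> * norm b)"
          "6 * (\<gamma>\<^sup>2 * (norm b)\<^sup>2) \<le> C * (\<gamma>\<^sup>2 * (norm b)\<^sup>2)"
          "6 * (\<gamma>\<^sup>2 * (norm u)\<^sup>2) \<le> C * (\<gamma>\<^sup>2 * (norm u)\<^sup>2)"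
          by (intro mult_right_mono cs; use g in simp)+
        ultimately show ?thesis by (simp add: e_def algebra_simps)
      qed
      from A E F q show ?thesis unfolding f' by (simp add: algebra_simps)
    qed
    then show "(norm (x' - z))\<^sup>2 + \<kappa> * ((norm (x' - z))\<^sup>2)\<^sup>2
       \<le> (1 - \<alpha> * \<gamma> + C * \<gamma>\<^sup>2) * ((norm (x - z))\<^sup>2 + \<kappa> * ((norm (x - z))\<^sup>2)\<^sup>2)
         + \<gamma> * (u \<bullet> ((2 * (1 + 2 * \<kappa> * (norm (x - z))\<^sup>2)) *\<^sub>R (x - z)))
         + C * (\<gamma>\<^sup>2 * (norm u)\<^sup>2 + \<gamma> * norm b + \<gamma>\<^sup>2 * (norm b)\<^sup>2)"
      unfolding t_def[symmetric] s_def[symmetric] f_def e_def l_def W_def by (simp add: algebra_simps)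
  qed
qed

section \<open>Step sizes, error terms and the scalar recursion\<close>

text \<open>Landau bounds hold only eventually, whereas the exit estimate adds up the noise from the
  first step on; finitely many initial ratios are added to the constant.\<close>

lemma bigo_bound_from_one:
  fixes f h :: "nat \<Rightarrow> real"
  assumes f: "f \<in> O(h)" and h: "\<And>n. n \<ge> 1 \<Longrightarrow> h n > 0"
  obtains K where "K \<ge> 0" "\<And>n. n \<ge> 1 \<Longrightarrow> \<bar>f n\<bar> \<le> K * h n"
proof -
  obtain c where c: "c > 0" "eventually (\<lambda>n. norm (f n) \<le> c * norm (h n)) at_top"
    using landau_o.bigE[OF f] by blast
  then obtain N where N: "\<And>n. n \<ge> N \<Longrightarrow> norm (f n) \<le> c * norm (h n)"
    by (auto simp: eventually_at_top_linorder)
  define K where "K = c + (\<Sum>n\<in>{1..N}. \<bar>f n\<bar> / h n)"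
  have s0: "0 \<le> (\<Sum>n\<in>{1..N}. \<bar>f n\<bar> / h n)"
    using h by (intro sum_nonneg) (auto intro!: divide_nonneg_pos)
  show thesis
  proof (rule that)
    show "K \<ge> 0" using c s0 by (simp add: K_def)
    fix n :: nat assume n: "n \<ge> 1"
    show "\<bar>f n\<bar> \<le> K * h n"
    proof (cases "n \<le> N")
      case True
      have "\<bar>f n\<bar> / h n \<le> (\<Sum>n\<in>{1..N}. \<bar>f n\<bar> / h n)"
        using n True h by (intro member_le_sum) (auto intro!: divide_nonneg_pos)
      then have "\<bar>f n\<bar> / h n \<le> K" using c by (simp add: K_def)
      then show ?thesis using h[OF n] by (simp add: pos_divide_le_eq)
    next
      case False
      then have "\<bar>f n\<bar> \<le> c * h n" using N[of n] h[OF n] by simp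
      also have "\<dots> \<le> K * h n" using s0 h[OF n] by (intro mult_right_mono) (auto simp: K_def)
      finally show ?thesis .
    qed
  qed
qed

definition stepsize :: "real \<Rightarrow> real \<Rightarrow> real \<Rightarrow> nat \<Rightarrow> real" where
  "stepsize g p m n = g / (real n + m) powr p"

text \<open>Expected size of the error \<gamma>^2 |u|^2 + \<gamma> |b| + \<gamma>^2 |b|^2 common to
  both Lyapunov inequalities. The absolute value keeps it nonnegative for \<open>B\<close> of any
  sign.\<close>

definition noise :: "real \<Rightarrow> real \<Rightarrow> (nat \<Rightarrow> real) \<Rightarrow> (nat \<Rightarrow> real) \<Rightarrow> real \<Rightarrow> nat \<Rightarrow> real" where
  "noise g p B sig m n = (stepsize g p m n)\<^sup>2 * (sig n)\<^sup>2
     + stepsize g p m n * \<bar>B n\<bar> + (stepsize g p m n)\<^sup>2 * (B n)\<^sup>2"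

lemma noise_nonneg: "m \<ge> 0 \<Longrightarrow> g > 0 \<Longrightarrow> noise g p B sig m n \<ge> 0"
  by (simp add: noise_def stepsize_def)

text \<open>Chung's lemma, by induction on a n <= L n^(-\<theta>). The contraction \<beta> / n^p has
  to beat \<theta> / n, the relative decrease of the comparison sequence, with room \<eta> left for
  the noise: for p < 1 this holds for every \<theta>, for p = 1 it needs \<theta> < \<alpha>
  g.\<close>

lemma recursion_rate:
  fixes a :: "nat \<Rightarrow> real"
  assumes a0: "\<And>n. a n \<ge> 0" and p: "0 < p" "p \<le> 1" and g: "g > 0" and al: "\<alpha> > 0" and th: "\<theta> > 0"
    and sharp: "p = 1 \<Longrightarrow> \<theta> < \<alpha> * g" and m: "m \<ge> 0" and K: "K \<ge> 0"
    and rec: "eventually (\<lambda>n. a (Suc n) \<le>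
        (1 - \<alpha> * stepsize g p m n + C * (stepsize g p m n)\<^sup>2) * a n
          + K / real n powr (p + \<theta>)) at_top"
  shows "a \<in> O(\<lambda>n. 1 / real n powr \<theta>)"
proof -
  \<comment> \<open>Strictly below \<alpha> g, so that the gap eventually absorbs the shift m and
    the term C \<gamma>^2; for p = 1 still above \<theta>.\<close>
  define \<beta> where "\<beta> = (if p = 1 then (\<theta> + \<alpha> * g) / 2 else \<alpha> * g / 2)"
  have be: "\<beta> > 0" "\<beta> < \<alpha> * g" "p = 1 \<Longrightarrow> \<theta> < \<beta>" using sharp al g th by (auto simp: \<beta>_def add_pos_pos)
  have ev1: "eventually (\<lambda>n::nat. \<beta> < real n powr p * (\<alpha> * (g / (real n + m) powr p) - C * (g / (real n + m) powr p)\<^sup>2)) at_top"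
  proof -
    have "(\<lambda>n::nat. real n powr p * (\<alpha> * (g / (real n + m) powr p) - C * (g / (real n + m) powr p)\<^sup>2)) \<longlonglongrightarrow> \<alpha> * g"
    proof -
      have 1: "(\<lambda>n::nat. (real n / (real n + m)) powr p) \<longlonglongrightarrow> 1 powr p"
        by (intro tendsto_powr tendsto_const) (use m in real_asymp, simp)
      have 2: "(\<lambda>n::nat. g / (real n + m) powr p) \<longlonglongrightarrow> 0"
        using p by real_asymp
      have "(\<lambda>n::nat. (real n / (real n + m)) powr p * (\<alpha> * g) - C * g * (real n / (real n + m)) powr p * (g / (real n + m) powr p))
         \<longlonglongrightarrow> 1 powr p * (\<alpha> * g) - C * g * 1 powr p * 0"
        by (intro tendsto_intros 1 2)
      moreover have "(real n / (real n + m)) powr p = real n powr p / (real n + m) powr p" for n :: nat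
        using m by (simp add: powr_divide)
      ultimately show ?thesis by (simp add: power2_eq_square algebra_simps)
    qed
    then show ?thesis using be(2) by (rule order_tendstoD)
  qed
  \<comment> \<open>Keeps 1 - \<beta> / n^p nonnegative, so that the induction hypothesis may be
    multiplied by it.\<close>
  have ev2: "eventually (\<lambda>n::nat. \<beta> \<le> real n powr p) at_top" using p by real_asymp
  obtain \<eta> where eta: "\<eta> > 0" "eventually (\<lambda>n::nat. \<theta> * real n powr (p - 1) \<le> \<beta> - \<eta>) at_top"
  proof (cases "p = 1")
    case True
    have "eventually (\<lambda>n::nat. \<theta> * real n powr (p - 1) \<le> \<beta> - (\<beta> - \<theta>)) at_top"
      using eventually_gt_at_top[of 0] by eventually_elim (simp add: True)
    then show thesis using be(3)[OF True] that[of "\<beta> - \<theta>"] by simp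
  next
    case False
    then have "p - 1 < 0" using p by simp
    then have "(\<lambda>n::nat. \<theta> * real n powr (p - 1)) \<longlonglongrightarrow> \<theta> * 0"
      by (intro tendsto_mult tendsto_const tendsto_neg_powr filterlim_real_sequentially)
    then have "eventually (\<lambda>n::nat. \<theta> * real n powr (p - 1) < \<beta> / 2) at_top"
      using be by (intro order_tendstoD) auto
    then show thesis using be by (intro that[of "\<beta> / 2"]) (auto elim: eventually_mono)
  qed
  from eventually_conj[OF eventually_conj[OF rec[unfolded stepsize_def] ev1] eventually_conj[OF ev2 eta(2)]]
  obtain N0 where N0: "\<And>n. n \<ge> N0 \<Longrightarrow> a (Suc n) \<le>
        (1 - \<alpha> * (g / (real n + m) powr p) + C * (g / (real n + m) powr p)\<^sup>2) * a n
          + K / real n powr (p + \<theta>) \<and>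
       \<beta> < real n powr p * (\<alpha> * (g / (real n + m) powr p) - C * (g / (real n + m) powr p)\<^sup>2) \<and>
       \<beta> \<le> real n powr p \<and> \<theta> * real n powr (p - 1) \<le> \<beta> - \<eta>"
    unfolding eventually_at_top_linorder by blast
  define N where "N = max N0 1"
  \<comment> \<open>The first entry starts the induction, the second makes the noise affordable: K
    <= L \<eta>.\<close>
  define L where "L = max (a N * real N powr \<theta>) (K / \<eta>)"
  have "K / \<eta> \<le> L" "K / \<eta> \<ge> 0" using K eta by (auto simp: L_def)
  then have L: "L \<ge> 0" "K \<le> L * \<eta>" "a N * real N powr \<theta> \<le> L"
    by (simp_all add: L_def flip: pos_divide_le_eq[OF eta(1)])
  have bound: "a n \<le> L / real n powr \<theta>" if "n \<ge> N" for n
    using that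
  proof (induction n rule: nat_induct_at_least)
    case base
    then show ?case using L by (simp add: pos_le_divide_eq N_def)
  next
    case (Suc n)
    have n: "n \<ge> 1" "n \<ge> N0" using Suc by (auto simp: N_def)
    define x where "x = real n"
    define \<gamma> where "\<gamma> = g / (x + m) powr p"
    have x: "x \<ge> 1" using n by (simp add: x_def)
    note h = N0[OF n(2), folded x_def, folded \<gamma>_def]
    have ab: "\<beta> / x powr p \<le> \<alpha> * \<gamma> - C * \<gamma>\<^sup>2" using h x by (simp add: field_simps)
    have b1: "\<beta> / x powr p \<le> 1" using h x by simp
    have "a (Suc n) \<le> (1 - \<alpha> * \<gamma> + C * \<gamma>\<^sup>2) * a n + K / x powr (p + \<theta>)" using h by blast
    also have "\<dots> \<le> (1 - \<beta> / x powr p) * a n + K / x powr (p + \<theta>)"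
      using ab a0 by (intro add_right_mono mult_right_mono) auto
    also have "\<dots> \<le> (1 - \<beta> / x powr p) * (L / x powr \<theta>) + L * \<eta> / x powr (p + \<theta>)"
      using b1 Suc.IH L by (intro add_mono mult_left_mono divide_right_mono) (auto simp: x_def)
    also have "\<dots> = L / x powr \<theta> * (1 - (\<beta> - \<eta>) / x powr p)"
      using x by (simp add: powr_add field_simps)
    also have "\<dots> \<le> L / x powr \<theta> * (1 - \<theta> / x)"
    proof -
      have "\<theta> / x = \<theta> * x powr (p - 1) / x powr p" using x by (simp add: powr_diff)
      also have "\<dots> \<le> (\<beta> - \<eta>) / x powr p" using h by (intro divide_right_mono) auto
      finally show ?thesis using L by (intro mult_left_mono) auto
    qed
    \<comment> \<open>With y = 1 / x: 1 - \<theta> y <= exp (- \<theta> ln (1 + y)), since ln (1 +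
      y) <= y. This turns the factor into the quotient of consecutive powers.\<close>
    also have "\<dots> \<le> L / x powr \<theta> * (1 + 1 / x) powr (- \<theta>)"
    proof -
      have "ln (1 + 1 / x) \<le> 1 / x" using x by (intro ln_add_one_self_le_self) auto
      then have "1 - \<theta> / x \<le> 1 + (- \<theta> * ln (1 + 1 / x))" using th mult_left_mono[of "ln (1 + 1 / x)" "1 / x" \<theta>] by simp
      also have "\<dots> \<le> exp (- \<theta> * ln (1 + 1 / x))" by (rule exp_ge_add_one_self)
      also have "\<dots> = (1 + 1 / x) powr (- \<theta>)"
        using x add_pos_pos[of 1 "1 / x"] by (simp add: powr_def)
      finally show ?thesis using L by (intro mult_left_mono) auto
    qed
    also have "\<dots> = L / (x + 1) powr \<theta>"
    proof -
      have "x + 1 = x * (1 + 1 / x)" using x by (simp add: distrib_left)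
      then have "(x + 1) powr \<theta> = (x * (1 + 1 / x)) powr \<theta>" by (rule arg_cong)
      also have "\<dots> = x powr \<theta> * (1 + 1 / x) powr \<theta>" by (rule powr_mult)
      finally show ?thesis by (simp add: powr_minus divide_simps)
    qed
    finally show ?case by (simp add: x_def add.commute)
  qed
  show ?thesis
  proof (rule landau_o.bigI[of "L + 1"])
    show "L + 1 > 0" using L by simp
    show "eventually (\<lambda>n. norm (a n) \<le> (L + 1) * norm (1 / real n powr \<theta>)) at_top"
      using eventually_ge_at_top[of N]
    proof eventually_elim
      case (elim n)
      have "a n \<le> L / real n powr \<theta>" by (rule bound[OF elim])
      also have "\<dots> \<le> (L + 1) / real n powr \<theta>" by (intro divide_right_mono) auto
      finally show ?case using a0[of n] by simp
    qed
  qed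
qed

text \<open>The pointwise bound feeds the rate, summability for fixed m feeds the late restarts, and
  the vanishing total as m grows feeds the confinement from time 1. The bare squares of the step
  sizes are included because the exit inequality has them as an extra error.\<close>

lemma step_errors:
  fixes B sig :: "nat \<Rightarrow> real"
  assumes p: "1/2 < p" "p \<le> 1" and g: "g > 0"
    and B: "\<And>n. n \<ge> 1 \<Longrightarrow> \<bar>B n\<bar> \<le> K1 * (1 / real n powr l)" and K1: "K1 \<ge> 0" and pl: "p + l > 1"
    and sig: "\<And>n. n \<ge> 1 \<Longrightarrow> \<bar>sig n\<bar> \<le> K2 * real n powr ls" and K2: "K2 \<ge> 0" and pls: "p - ls > 1/2"
  obtains K where "K \<ge> 0"
    "\<And>m n. m \<ge> 0 \<Longrightarrow> n \<ge> 1 \<Longrightarrow> noise g p B sig m n \<le> K / real n powr (p + min l (p - 2 * ls))"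
    "\<And>m. m \<ge> 0 \<Longrightarrow> summable (\<lambda>n. noise g p B sig m (Suc n) + (stepsize g p m (Suc n))\<^sup>2)"
    "((\<lambda>m. \<Sum>n. noise g p B sig m (Suc n) + (stepsize g p m (Suc n))\<^sup>2) \<longlongrightarrow> 0) at_top"
proof -
  define \<gamma> where "\<gamma> = stepsize g p"
  define err where "err = noise g p B sig"
  define q where "q = min l (p - 2 * ls)"
  have l: "l \<ge> 0" using p pl by simp
  have gle: "0 \<le> \<gamma> m n" "\<gamma> m n \<le> g / real n powr p" "\<gamma> m n \<le> g" if "m \<ge> 0" "n \<ge> 1" for m n
  proof -
    show "0 \<le> \<gamma> m n" using g by (simp add: \<gamma>_def stepsize_def)
    show 1: "\<gamma> m n \<le> g / real n powr p"
      unfolding \<gamma>_def stepsize_def using that g p by (intro divide_left_mono powr_mono2 mult_pos_pos) auto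
    have "1 powr p \<le> real n powr p" using that p by (intro powr_mono2) auto
    then have "g / real n powr p \<le> g / 1" using g that by (intro divide_left_mono) auto
    then show "\<gamma> m n \<le> g" using 1 by simp
  qed
  define K where "K = g\<^sup>2 * K2\<^sup>2 + g * K1 + g\<^sup>2 * K1\<^sup>2"
  have K: "K \<ge> 0" using g K1 by (simp add: K_def)
  have err_le: "err m n \<le> K / real n powr (p + q)" if mn: "m \<ge> 0" "n \<ge> 1" for m n
  proof -
    define x where "x = real n"
    have x: "x \<ge> 1" using mn by (simp add: x_def)
    note ga = gle[OF mn, folded x_def]
    have t1: "(\<gamma> m n)\<^sup>2 * (sig n)\<^sup>2 \<le> g\<^sup>2 * K2\<^sup>2 / x powr (p + q)"
    proof -
      have "(\<gamma> m n)\<^sup>2 * (sig n)\<^sup>2 = (\<gamma> m n * \<bar>sig n\<bar>)\<^sup>2" by (simp add: power_mult_distrib)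
      also have "\<dots> \<le> (g / x powr p * (K2 * x powr ls))\<^sup>2"
        using ga sig[OF mn(2)] g by (intro power_mono mult_mono) (auto simp: x_def)
      also have "\<dots> = g\<^sup>2 * K2\<^sup>2 * x powr (2 * ls - 2 * p)"
        using x by (simp add: power2_eq_square powr_diff flip: powr_add)
      also have "\<dots> \<le> g\<^sup>2 * K2\<^sup>2 * x powr (- (p + q))"
        using x by (intro mult_left_mono powr_mono) (auto simp: q_def)
      also have "\<dots> = g\<^sup>2 * K2\<^sup>2 / x powr (p + q)" using powr_minus_divide[of x "p + q"] by simp
      finally show ?thesis .
    qed
    have t2: "\<gamma> m n * \<bar>B n\<bar> \<le> g * K1 / x powr (p + q)"
    proof -
      have "\<gamma> m n * \<bar>B n\<bar> \<le> g / x powr p * (K1 * (1 / x powr l))"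
        using ga B[OF mn(2)] g by (intro mult_mono) (auto simp: x_def)
      also have "\<dots> = g * K1 * x powr (- (p + l))" using powr_minus_divide[of x "p + l"] by (simp add: powr_add)
      also have "\<dots> \<le> g * K1 * x powr (- (p + q))"
        using x g K1 by (intro mult_left_mono powr_mono) (auto simp: q_def)
      also have "\<dots> = g * K1 / x powr (p + q)" using powr_minus_divide[of x "p + q"] by simp
      finally show ?thesis .
    qed
    have t3: "(\<gamma> m n)\<^sup>2 * (B n)\<^sup>2 \<le> g\<^sup>2 * K1\<^sup>2 / x powr (p + q)"
    proof -
      have "1 powr l \<le> x powr l" using x l by (intro powr_mono2) auto
      then have "1 / x powr l \<le> 1" using x by (simp add: divide_le_eq_1)
      then have "K1 * (1 / x powr l) \<le> K1 * 1" using K1 by (intro mult_left_mono) auto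
      then have "\<bar>B n\<bar> \<le> K1" using B[OF mn(2)] by (simp add: x_def)
      then have "\<gamma> m n * \<bar>B n\<bar> \<le> g * K1" using ga g by (intro mult_mono) auto
      then have "(\<gamma> m n * \<bar>B n\<bar>) * (\<gamma> m n * \<bar>B n\<bar>) \<le> (g * K1) * (g * K1 / x powr (p + q))"
        using t2 ga g K1 by (rule_tac mult_mono) auto
      then show ?thesis by (simp add: power2_eq_square mult_ac)
    qed
    show ?thesis using t1 t2 t3 by (simp add: err_def noise_def \<gamma>_def[symmetric] K_def add_divide_distrib x_def)
  qed
  \<comment> \<open>p + l > 1 and 2 (p - ls) > 1 give p + q > 1; p > 1/2 takes care of the bare
    squares.\<close>
  define r where "r = min (p + q) (2 * p)"
  have r: "r > 1" using p pl pls by (simp add: r_def q_def)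
  have E_le: "err m n + (\<gamma> m n)\<^sup>2 \<le> (K + g\<^sup>2) * real n powr (- r)" if mn: "m \<ge> 0" "n \<ge> 1" for m n
  proof -
    have x: "real n \<ge> 1" using mn by simp
    have "K / real n powr (p + q) \<le> K * real n powr (- r)"
      unfolding powr_minus_divide[symmetric] divide_inverse powr_minus[symmetric]
      using x K by (intro mult_left_mono powr_mono) (auto simp: r_def)
    moreover have "(\<gamma> m n)\<^sup>2 \<le> g\<^sup>2 * real n powr (- r)"
    proof -
      have "(\<gamma> m n)\<^sup>2 \<le> (g / real n powr p)\<^sup>2" using gle[OF mn] by (intro power_mono) auto
      also have "\<dots> = g\<^sup>2 * real n powr (- (2 * p))"
        using x by (simp add: power_divide powr_minus_divide powr_power mult.commute)
      also have "\<dots> \<le> g\<^sup>2 * real n powr (- r)"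
        using x by (intro mult_left_mono powr_mono) (auto simp: r_def)
      finally show ?thesis .
    qed
    ultimately show ?thesis using err_le[OF mn] by (simp add: distrib_right)
  qed
  have E0: "0 \<le> err m n + (\<gamma> m n)\<^sup>2" if "m \<ge> 0" "n \<ge> 1" for m n
    using gle(1)[OF that] by (simp add: err_def noise_def flip: \<gamma>_def)
  have sr: "summable (\<lambda>n. (K + g\<^sup>2) * real (Suc n) powr (- r))"
    using r by (intro summable_mult) (subst summable_Suc_iff, simp add: summable_real_powr_iff)
  have sm: "summable (\<lambda>n. err m (Suc n) + (\<gamma> m (Suc n))\<^sup>2)" if m: "m \<ge> 0" for m
  proof (rule summable_comparison_test'[OF sr, of 0])
    fix n
    show "norm (err m (Suc n) + (\<gamma> m (Suc n))\<^sup>2) \<le> (K + g\<^sup>2) * real (Suc n) powr (- r)"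
      using E0[OF m, of "Suc n"] E_le[OF m, of "Suc n"] by simp
  qed
  \<comment> \<open>The dominating series does not depend on m and every single term tends to 0, so
    sum and limit may be exchanged.\<close>
  have lim: "((\<lambda>m. \<Sum>n. err m (Suc n) + (\<gamma> m (Suc n))\<^sup>2) \<longlongrightarrow> (\<Sum>n::nat. 0)) at_top"
  proof (rule tannerys_theorem[THEN conjunct2, THEN conjunct2, OF _ _ sr])
    fix n
    have "((\<lambda>m. \<gamma> m (Suc n)) \<longlongrightarrow> 0) at_top"
      unfolding \<gamma>_def stepsize_def using p by real_asymp
    then have "((\<lambda>m. err m (Suc n) + (\<gamma> m (Suc n))\<^sup>2) \<longlongrightarrow>
        0\<^sup>2 * (sig (Suc n))\<^sup>2 + 0 * \<bar>B (Suc n)\<bar> + 0\<^sup>2 * (B (Suc n))\<^sup>2 + 0\<^sup>2) at_top"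
      unfolding err_def noise_def \<gamma>_def[symmetric] by (intro tendsto_intros)
    then show "((\<lambda>m. err m (Suc n) + (\<gamma> m (Suc n))\<^sup>2) \<longlongrightarrow> 0) at_top" by simp
  next
    show "\<forall>\<^sub>F (n, m) in at_top \<times>\<^sub>F at_top. norm (err m (Suc n) + (\<gamma> m (Suc n))\<^sup>2) \<le> (K + g\<^sup>2) * real (Suc n) powr (- r)"
      unfolding eventually_prod_filter
    proof (intro exI conjI allI impI)
      show "eventually (\<lambda>n::nat. True) at_top" by simp
      show "eventually (\<lambda>m::real. m \<ge> 0) at_top" by (rule eventually_ge_at_top)
    next
      fix n :: nat and m :: real assume "m \<ge> 0"
      then show "case (n, m) of (n, m) \<Rightarrow> norm (err m (Suc n) + (\<gamma> m (Suc n))\<^sup>2) \<le> (K + g\<^sup>2) * real (Suc n) powr (- r)"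
        using E0[of m "Suc n"] E_le[of m "Suc n"] by simp
    qed
  qed simp
  show thesis
    by (rule that[OF K]) (use err_le sm lim in \<open>auto simp: q_def \<gamma>_def err_def\<close>)
qed

section \<open>Expectation of one step\<close>

lemma space_natfilt [simp]: "space (natfilt M \<pi> n) = space M"
  unfolding natfilt_def by (rule space_measure_of) auto

lemma subalgebra_natfilt:
  assumes "\<And>k. k \<ge> 1 \<Longrightarrow> \<pi> k \<in> borel_measurable M"
  shows "subalgebra M (natfilt M \<pi> n)"
proof -
  have "{\<pi> k -` S \<inter> space M | k S. 1 \<le> k \<and> k \<le> n \<and> S \<in> sets borel} \<subseteq> sets M"
    using assms by (auto intro: measurable_sets)
  then have "sets (natfilt M \<pi> n) \<subseteq> sets M"
    using sets.sigma_sets_subset[of _ M]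
    unfolding natfilt_def by (subst sets_measure_of) auto
  then show ?thesis by (simp add: subalgebra_def)
qed

lemma measurable_natfilt:
  fixes \<pi> :: "nat \<Rightarrow> 'w \<Rightarrow> 'b::topological_space"
  assumes "1 \<le> k" "k \<le> n"
  shows "\<pi> k \<in> borel_measurable (natfilt M \<pi> n)"
proof (rule measurableI)
  fix S :: "'b set" assume "S \<in> sets borel"
  then show "\<pi> k -` S \<inter> space (natfilt M \<pi> n) \<in> sets (natfilt M \<pi> n)"
    unfolding space_natfilt unfolding natfilt_def using assms
    by (subst sets_measure_of) (auto intro!: sigma_sets.Basic)
qed simp

lemma borel_measurable_vecI:
  fixes f :: "'w \<Rightarrow> real ^ 'n"
  assumes "\<And>j. (\<lambda>w. f w $ j) \<in> borel_measurable M"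
  shows "f \<in> borel_measurable M"
  by (rule borel_measurable_euclidean_space[THEN iffD2])
    (use assms in \<open>auto simp: Basis_vec_def inner_axis\<close>)

lemma borel_measurable_vec_nth_comp:
  fixes f :: "'w \<Rightarrow> real ^ 'n"
  assumes "f \<in> borel_measurable M"
  shows "(\<lambda>w. f w $ j) \<in> borel_measurable M"
proof -
  have "continuous_on UNIV (\<lambda>x :: real ^ 'n. x $ j)"
    by (intro continuous_on_component continuous_on_id)
  from measurable_compose[OF assms borel_measurable_continuous_onI[OF this]] show ?thesis .
qed

lemma pg_run_in:
  assumes run: "pg_run M S v g p m B sig \<pi> vh" and S: "compact S" and n: "n \<ge> 1" and w: "w \<in> space M"
  shows "\<pi> n w \<in> S"
  using n
proof (induction n rule: nat_induct_at_least)
  case base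
  then show ?case using run w by (simp add: pg_run_def)
next
  case (Suc n)
  then have "\<pi> (Suc n) w = closest_point S (\<pi> n w + (g / (real n + m) powr p) *\<^sub>R vh n w)"
    using run w by (simp add: pg_run_def)
  then show ?case
    using closest_point_in_set[OF compact_imp_closed[OF S]] Suc.IH by (metis empty_iff)
qed

lemma integrable_pg:
  fixes M :: "'w measure" and S :: "(real ^ 'n) set" and \<Phi> :: "real ^ 'n \<Rightarrow> real"
  assumes run: "pg_run M S v g p m B sig \<pi> vh" and S: "compact S"
    and Phi: "continuous_on UNIV \<Phi>" and G: "G \<in> sets M" and k: "k \<ge> 1"
  shows "integrable M (\<lambda>w. indicator G w * \<Phi> (\<pi> k w))"
proof -
  interpret prob_space M using run by (simp add: pg_run_def)
  have "bounded (\<Phi> ` S)"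
    using Phi by (intro compact_imp_bounded compact_continuous_image S) (auto intro: continuous_on_subset)
  then obtain K where K: "\<And>x. x \<in> S \<Longrightarrow> norm (\<Phi> x) \<le> K" by (auto simp: bounded_iff)
  have "\<pi> k \<in> borel_measurable M" using run k by (simp add: pg_run_def)
  then have m: "(\<lambda>w. \<Phi> (\<pi> k w)) \<in> borel_measurable M"
    using measurable_compose[OF _ borel_measurable_continuous_onI[OF Phi]] by blast
  show ?thesis
  proof (rule integrable_const_bound[of _ "\<bar>K\<bar>"])
    show "AE w in M. norm (indicator G w * \<Phi> (\<pi> k w)) \<le> \<bar>K\<bar>"
      using K pg_run_in[OF run S k] by (intro AE_I2) (force simp: indicator_def)
    show "(\<lambda>w. indicator G w * \<Phi> (\<pi> k w)) \<in> borel_measurable M" using m G by measurable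
  qed
qed

text \<open>The pathwise inequality is demanded for every splitting b + u; the proof then inserts
  the splitting into bias and noise given by the conditional expectation. On an event
  \<open>G\<close> known at time n the linear noise term integrates to zero.\<close>

lemma pg_step_expectation:
  fixes M :: "'w measure" and S :: "(real ^ 'n) set" and H :: "real ^ 'n \<Rightarrow> real ^ 'n"
  assumes run: "pg_run M S v g p m B sig \<pi> vh" and S: "compact S" and v: "continuous_on S v"
    and Phi: "continuous_on UNIV \<Phi>" and H: "continuous_on UNIV H"
    and n: "n \<ge> 1" and G: "G \<in> sets (natfilt M \<pi> n)" and C: "C \<ge> 0" "C' \<ge> 0"
    and gam: "\<gamma> = stepsize g p m n" "\<gamma> \<ge> 0"
    and step: "\<And>w u b. w \<in> G \<Longrightarrow>
       \<pi> (Suc n) w = closest_point S (\<pi> n w + \<gamma> *\<^sub>R (v (\<pi> n w) + b + u)) \<Longrightarrow>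
       \<Phi> (\<pi> (Suc n) w) \<le> a * \<Phi> (\<pi> n w) + \<gamma> * (u \<bullet> H (\<pi> n w))
         + C * (\<gamma>\<^sup>2 * (norm u)\<^sup>2 + \<gamma> * norm b + \<gamma>\<^sup>2 * (norm b)\<^sup>2) + C'"
  shows "(LINT w|M. indicator G w * \<Phi> (\<pi> (Suc n) w)) \<le> a * (LINT w|M. indicator G w * \<Phi> (\<pi> n w))
    + (C * noise g p B sig m n + C') * measure M G"
proof -
  interpret prob_space M using run by (simp add: pg_run_def)
  define F where "F = natfilt M \<pi> n"
  have meas: "\<And>k. k \<ge> 1 \<Longrightarrow> \<pi> k \<in> borel_measurable M" "vh n \<in> borel_measurable M"
    and int_vh: "\<And>j. integrable M (\<lambda>w. vh n w $ j)"
    using run n by (auto simp: pg_run_def)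
  have subF: "subalgebra M F" unfolding F_def by (rule subalgebra_natfilt) (rule meas)
  interpret finite_measure_subalgebra M F by unfold_locales (rule subF)
  have fromF: "f \<in> borel_measurable F \<Longrightarrow> f \<in> borel_measurable M" for f :: "'w \<Rightarrow> real"
    by (rule measurable_from_subalg[OF subF])
  have piF: "\<pi> n \<in> borel_measurable F" unfolding F_def by (rule measurable_natfilt) (use n in auto)
  have spF: "space F = space M" by (simp add: F_def)
  have GF: "G \<in> sets F" using G by (simp add: F_def)
  have GM: "G \<in> sets M" using GF subF by (auto simp: subalgebra_def)
  have inS: "\<And>k w. k \<ge> 1 \<Longrightarrow> w \<in> space M \<Longrightarrow> \<pi> k w \<in> S" using pg_run_in[OF run S] by blast
  define c where "c = vcond_exp M F (vh n)"
  define u where "u = (\<lambda>w. vh n w - c w)"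
  define b where "b = (\<lambda>w. c w - v (\<pi> n w))"
  have cj: "c w $ j = real_cond_exp M F (\<lambda>w. vh n w $ j) w" for w j
    by (simp add: c_def vcond_exp_def)
  have cF: "c \<in> borel_measurable F"
    by (rule borel_measurable_vecI) (simp add: cj)
  have cM: "c \<in> borel_measurable M" by (rule measurable_from_subalg[OF subF cF])
  have uM: "u \<in> borel_measurable M" unfolding u_def using cM meas by simp
  \<comment> \<open>\<open>v\<close> is continuous only on \<open>S\<close>, so measurability goes
    through its extension by 0; the iterates never leave \<open>S\<close>.\<close>
  have vF: "(\<lambda>w. v (\<pi> n w)) \<in> borel_measurable F"
  proof -
    have "(\<lambda>x. if x \<in> S then v x else 0) \<in> borel_measurable borel"
      using v S by (intro borel_measurable_continuous_on_if) (auto intro: compact_imp_closed borel_closed)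
    then have "(\<lambda>w. if \<pi> n w \<in> S then v (\<pi> n w) else 0) \<in> borel_measurable F"
      using piF by (rule measurable_compose[rotated])
    then show ?thesis
      by (rule measurable_cong[THEN iffD1, rotated]) (use inS n spF in auto)
  qed
  have bF: "b \<in> borel_measurable F" unfolding b_def using cF vF by simp
  \<comment> \<open>The bias is measurable at time n, so conditioning leaves |b| unchanged and the
    assumed conditional bound becomes an almost sure one.\<close>
  have b_le: "AE w in M. norm (b w) \<le> \<bar>B n\<bar>"
  proof -
    have "(\<lambda>w. ennreal (norm (b w))) \<in> borel_measurable F" using bF by measurable
    from nn_cond_exp_F_meas[OF this]
    have "AE w in M. ennreal (norm (b w)) = nn_cond_exp M F (\<lambda>w. ennreal (norm (b w))) w" .
    moreover have "AE w in M. nn_cond_exp M F (\<lambda>w. ennreal (norm (b w))) w \<le> ennreal (B n)"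
      using run n by (auto simp: pg_run_def F_def b_def c_def)
    ultimately show ?thesis
    proof eventually_elim
      case (elim w)
      then have "ennreal (norm (b w)) \<le> ennreal \<bar>B n\<bar>" by (metis abs_ge_self ennreal_leI order_trans)
      then show ?case by simp
    qed
  qed
  \<comment> \<open>Integrating the conditional second moment over \<open>G\<close> keeps the factor
    \<open>emeasure M G\<close>; this makes the final estimate proportional to the probability of
    \<open>G\<close>.\<close>
  have nn: "(\<integral>\<^sup>+w. indicator G w * ennreal ((norm (u w))\<^sup>2) \<partial>M) \<le> ennreal ((sig n)\<^sup>2) * emeasure M G"
  proof -
    have "(\<integral>\<^sup>+w. indicator G w * ennreal ((norm (u w))\<^sup>2) \<partial>M) =
        (\<integral>\<^sup>+w. indicator G w * nn_cond_exp M F (\<lambda>w. ennreal ((norm (u w))\<^sup>2)) w \<partial>M)"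
      using GF uM by (intro nn_cond_exp_intg[symmetric]) auto
    also have "\<dots> \<le> (\<integral>\<^sup>+w. indicator G w * ennreal ((sig n)\<^sup>2) \<partial>M)"
    proof (rule nn_integral_mono_AE)
      have "AE w in M. nn_cond_exp M F (\<lambda>w. ennreal ((norm (u w))\<^sup>2)) w \<le> ennreal ((sig n)\<^sup>2)"
        using run n by (auto simp: pg_run_def F_def u_def c_def)
      then show "AE w in M. indicator G w * nn_cond_exp M F (\<lambda>w. ennreal ((norm (u w))\<^sup>2)) w
          \<le> indicator G w * ennreal ((sig n)\<^sup>2)"
        by eventually_elim (auto intro: mult_left_mono)
    qed
    also have "\<dots> = ennreal ((sig n)\<^sup>2) * emeasure M G"
      using GM by (simp add: nn_integral_multc mult.commute)
    finally show ?thesis .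
  qed
  have nn': "(\<integral>\<^sup>+w. ennreal (indicator G w * (norm (u w))\<^sup>2) \<partial>M) \<le> ennreal ((sig n)\<^sup>2 * measure M G)"
    using nn by (simp add: ennreal_mult' emeasure_eq_measure ennreal_indicator flip: ennreal_indicator)
  have int_u2: "integrable M (\<lambda>w. indicator G w * (norm (u w))\<^sup>2)"
  proof (rule integrableI_bounded)
    show "(\<lambda>w. indicator G w * (norm (u w))\<^sup>2) \<in> borel_measurable M" using uM GM by measurable
    have "(\<integral>\<^sup>+w. ennreal (norm (indicator G w * (norm (u w))\<^sup>2)) \<partial>M)
        = (\<integral>\<^sup>+w. ennreal (indicator G w * (norm (u w))\<^sup>2) \<partial>M)" by simp
    also have "\<dots> < \<infinity>" using nn' by (simp add: order_le_less_trans)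
    finally show "(\<integral>\<^sup>+w. ennreal (norm (indicator G w * (norm (u w))\<^sup>2)) \<partial>M) < \<infinity>" .
  qed
  have u2_le: "(LINT w|M. indicator G w * (norm (u w))\<^sup>2) \<le> (sig n)\<^sup>2 * measure M G"
  proof -
    have "ennreal (LINT w|M. indicator G w * (norm (u w))\<^sup>2) \<le> ennreal ((sig n)\<^sup>2 * measure M G)"
      using nn' int_u2 by (subst nn_integral_eq_integral[symmetric]) auto
    then show ?thesis by simp
  qed
  have bdd: "\<exists>K. \<forall>x\<in>S. norm (f x) \<le> K" if "continuous_on UNIV f" for f :: "real ^ 'n \<Rightarrow> real ^ 'n"
  proof -
    have "continuous_on S f" using that continuous_on_subset by blast
    then have "bounded (f ` S)" by (intro compact_imp_bounded compact_continuous_image S)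
    then show ?thesis by (auto simp: bounded_iff)
  qed
  have HF: "(\<lambda>w. H (\<pi> n w)) \<in> borel_measurable F"
    using measurable_compose[OF piF borel_measurable_continuous_onI[OF H]] .
  obtain KH where KH: "\<And>x. x \<in> S \<Longrightarrow> norm (H x) \<le> KH" using bdd[OF H] by auto
  \<comment> \<open>Pull-out property, coordinate by coordinate: the bounded factor is measurable at
    time n, hence integrates equally against \<open>vh n\<close> and its conditional
    expectation.\<close>
  have mart: "integrable M (\<lambda>w. indicator G w * H (\<pi> n w) $ j * u w $ j) \<and>
      (LINT w|M. indicator G w * H (\<pi> n w) $ j * u w $ j) = 0" for j
  proof -
    define f where "f = (\<lambda>w. indicator G w * H (\<pi> n w) $ j :: real)"
    have fF: "f \<in> borel_measurable F"
      unfolding f_def using GF borel_measurable_vec_nth_comp[OF HF] by measurable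
    have fb: "\<bar>f w\<bar> \<le> KH" if "w \<in> space M" for w
    proof -
      have "\<bar>H (\<pi> n w) $ j\<bar> \<le> KH"
        using component_le_norm_cart[of "H (\<pi> n w)" j] KH[OF inS[OF n that]] by linarith
      then show ?thesis by (auto simp: f_def indicator_def)
    qed
    have vj: "(\<lambda>w. vh n w $ j) \<in> borel_measurable M" by (rule borel_measurable_vec_nth_comp) (rule meas)
    have i: "integrable M (\<lambda>w. f w * vh n w $ j)"
    proof (rule Bochner_Integration.integrable_bound)
      show "integrable M (\<lambda>w. KH * vh n w $ j)" using int_vh by simp
      show "(\<lambda>w. f w * vh n w $ j) \<in> borel_measurable M" using fromF[OF fF] vj by measurable
      show "AE w in M. norm (f w * vh n w $ j) \<le> norm (KH * vh n w $ j)"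
        using fb by (auto simp: abs_mult intro!: mult_right_mono order_trans[OF fb abs_ge_self])
    qed
    note r = real_cond_exp_intg[OF i fF vj]
    have eq: "indicator G w * H (\<pi> n w) $ j * u w $ j =
        f w * vh n w $ j - f w * real_cond_exp M F (\<lambda>w. vh n w $ j) w" for w
      by (simp add: f_def u_def cj right_diff_distrib)
    show ?thesis unfolding eq using i r by simp
  qed
  have int_mart: "integrable M (\<lambda>w. indicator G w * (u w \<bullet> H (\<pi> n w)))"
    and mart0: "(LINT w|M. indicator G w * (u w \<bullet> H (\<pi> n w))) = 0"
  proof -
    have eq: "indicator G w * (u w \<bullet> H (\<pi> n w)) = (\<Sum>j\<in>UNIV. indicator G w * H (\<pi> n w) $ j * u w $ j)" for w
      by (simp add: inner_vec_def sum_distrib_left mult_ac)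
    show "integrable M (\<lambda>w. indicator G w * (u w \<bullet> H (\<pi> n w)))"
      unfolding eq using mart by (intro Bochner_Integration.integrable_sum) blast
    show "(LINT w|M. indicator G w * (u w \<bullet> H (\<pi> n w))) = 0"
      unfolding eq using mart by (subst Bochner_Integration.integral_sum) auto
  qed
  have int_Phi: "integrable M (\<lambda>w. indicator G w * \<Phi> (\<pi> k w))" if k: "k \<ge> 1" for k
    by (rule integrable_pg[OF run S Phi GM k])
  have int_G: "integrable M (indicator G :: 'w \<Rightarrow> real)" using GM by (simp add: emeasure_eq_measure)
  have LG: "(LINT w|M. indicator G w) = measure M G" using GM by simp
  define K where "K = C * (\<gamma> * \<bar>B n\<bar> + \<gamma>\<^sup>2 * (B n)\<^sup>2) + C'"
  have le: "AE w in M. indicator G w * \<Phi> (\<pi> (Suc n) w) \<le>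
     a * (indicator G w * \<Phi> (\<pi> n w)) + \<gamma> * (indicator G w * (u w \<bullet> H (\<pi> n w)))
     + C * \<gamma>\<^sup>2 * (indicator G w * (norm (u w))\<^sup>2) + K * indicator G w"
    using b_le AE_space
  proof eventually_elim
    case (elim w)
    show ?case
    proof (cases "w \<in> G")
      case True
      have "\<pi> (Suc n) w = closest_point S (\<pi> n w + \<gamma> *\<^sub>R (v (\<pi> n w) + b w + u w))"
        using run n elim by (simp add: pg_run_def gam stepsize_def b_def u_def)
      from step[OF True this]
      have "\<Phi> (\<pi> (Suc n) w) \<le> a * \<Phi> (\<pi> n w) + \<gamma> * (u w \<bullet> H (\<pi> n w))
         + C * (\<gamma>\<^sup>2 * (norm (u w))\<^sup>2 + \<gamma> * norm (b w) + \<gamma>\<^sup>2 * (norm (b w))\<^sup>2) + C'" .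
      also have "C * (\<gamma>\<^sup>2 * (norm (u w))\<^sup>2 + \<gamma> * norm (b w) + \<gamma>\<^sup>2 * (norm (b w))\<^sup>2)
          \<le> C * (\<gamma>\<^sup>2 * (norm (u w))\<^sup>2 + \<gamma> * \<bar>B n\<bar> + \<gamma>\<^sup>2 * (B n)\<^sup>2)"
        using elim(1) C gam(2) power_mono[OF elim(1), of 2]
        by (intro mult_left_mono add_mono) auto
      finally show ?thesis using True by (simp add: K_def algebra_simps)
    qed simp
  qed
  have "(LINT w|M. indicator G w * \<Phi> (\<pi> (Suc n) w)) \<le>
     (LINT w|M. a * (indicator G w * \<Phi> (\<pi> n w)) + \<gamma> * (indicator G w * (u w \<bullet> H (\<pi> n w)))
     + C * \<gamma>\<^sup>2 * (indicator G w * (norm (u w))\<^sup>2) + K * indicator G w)"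
    by (rule integral_mono_AE[OF _ _ le])
      (use int_Phi n int_mart int_u2 int_G in \<open>auto intro!: Bochner_Integration.integrable_add\<close>)
  also have "\<dots> = a * (LINT w|M. indicator G w * \<Phi> (\<pi> n w)) + \<gamma> * (LINT w|M. indicator G w * (u w \<bullet> H (\<pi> n w)))
     + C * \<gamma>\<^sup>2 * (LINT w|M. indicator G w * (norm (u w))\<^sup>2) + K * (LINT w|M. indicator G w)"
    using int_Phi[OF n] int_mart int_u2 int_G by simp
  also have "\<dots> \<le> a * (LINT w|M. indicator G w * \<Phi> (\<pi> n w)) + C * \<gamma>\<^sup>2 * ((sig n)\<^sup>2 * measure M G) + K * measure M G"
    unfolding mart0 LG using u2_le C by (simp add: mult_left_mono)
  finally show ?thesis unfolding noise_def gam(1)[symmetric] by (simp add: K_def algebra_simps)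
qed

section \<open>Staying close to the equilibrium\<close>

lemma sets_natfilt_mono:
  assumes "n \<le> n'"
  shows "sets (natfilt M \<pi> n) \<subseteq> sets (natfilt M \<pi> n')"
  unfolding natfilt_def using assms
  by (subst (1 2) sets_measure_of) (auto intro!: sigma_sets_mono' intro: order_trans)

lemma sets_natfilt_forall:
  fixes \<pi> :: "nat \<Rightarrow> 'w \<Rightarrow> 'b::topological_space"
  assumes N: "N \<ge> 1" and S: "S \<in> sets borel" and G: "G \<in> sets (natfilt M \<pi> N)" and n: "N \<le> n"
  shows "{w \<in> G. \<forall>k\<in>{N..n}. \<pi> k w \<in> S} \<in> sets (natfilt M \<pi> n)"
proof -
  have "\<pi> k -` S \<inter> space (natfilt M \<pi> n) \<in> sets (natfilt M \<pi> n)" if "k \<in> {N..n}" for k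
    using that N by (intro measurable_sets[OF measurable_natfilt S]) auto
  then have "(\<Inter>k\<in>{N..n}. \<pi> k -` S \<inter> space (natfilt M \<pi> n)) \<in> sets (natfilt M \<pi> n)"
    using n by (intro sets.finite_INT) (auto simp del: space_natfilt)
  moreover have "G \<in> sets (natfilt M \<pi> n)" using sets_natfilt_mono[OF n] G by blast
  moreover have "{w \<in> G. \<forall>k\<in>{N..n}. \<pi> k w \<in> S} = G \<inter> (\<Inter>k\<in>{N..n}. \<pi> k -` S \<inter> space (natfilt M \<pi> n))"
    using sets.sets_into_space[OF G] n by auto
  ultimately show ?thesis by (metis sets.Int)
qed

text \<open>A maximal inequality for a stopped almost-supermartingale. The start (\<open>N\<close>,
  \<open>G\<close>) is arbitrary, to serve both time 1 and late restarts, and the factor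
  \<open>measure M G\<close> makes it a bound for a conditional probability. \<open>C\<close> is
  fixed before m and the probability space.\<close>

lemma pg_no_exit:
  fixes S :: "(real ^ 'n) set" and v :: "real ^ 'n \<Rightarrow> real ^ 'n"
  assumes S: "convex S" "compact S" and z: "z \<in> S" and v: "continuous_on S v"
    and r: "0 \<le> r" "r < R" and nonpos: "\<And>x. x \<in> S \<Longrightarrow> norm (x - z) < R \<Longrightarrow> v x \<bullet> (x - z) \<le> 0"
    and g: "g > 0"
  shows "\<exists>C\<ge>0. \<forall>m\<ge>0. \<forall>(M :: 'w measure) \<pi> vh N G T. pg_run M S v g p m B sig \<pi> vh \<longrightarrow> N \<ge> 1 \<longrightarrow>
       G \<in> sets (natfilt M \<pi> N) \<longrightarrow> (\<forall>w\<in>G. norm (\<pi> N w - z) \<le> r) \<longrightarrow>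
       (\<forall>n. (\<Sum>k\<in>{N..<n}. noise g p B sig m k + (stepsize g p m k)\<^sup>2) \<le> T) \<longrightarrow>
       measure M G - measure M {w\<in>G. \<forall>k\<ge>N. norm (\<pi> k w - z) < R} \<le> C * T * measure M G"
proof -
  define \<Psi> where "\<Psi> = (\<lambda>x. (max 0 ((norm (x - z))\<^sup>2 - r\<^sup>2))\<^sup>2)"
  define H where "H = (\<lambda>x. (4 * max 0 ((norm (x - z))\<^sup>2 - r\<^sup>2)) *\<^sub>R (x - z))"
  have cPsi: "continuous_on UNIV \<Psi>" and cH: "continuous_on UNIV H"
    unfolding \<Psi>_def H_def by (intro continuous_intros)+
  obtain C where C: "C \<ge> 0"
    "\<And>x x' \<gamma> u b. x \<in> S \<Longrightarrow> v x \<bullet> (x - z) \<le> 0 \<Longrightarrow> 0 < \<gamma> \<Longrightarrow>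
       x' = closest_point S (x + \<gamma> *\<^sub>R (v x + b + u)) \<Longrightarrow>
       \<Psi> x' \<le> \<Psi> x + \<gamma> * (u \<bullet> H x)
         + C * (\<gamma>\<^sup>2 * (norm u)\<^sup>2 + \<gamma> * norm b + \<gamma>\<^sup>2 * (norm b)\<^sup>2) + C * \<gamma>\<^sup>2"
    using exit_lyapunov_step[OF S z v, of "r\<^sup>2"] unfolding \<Psi>_def H_def by metis
  \<comment> \<open>Value of the truncated square on the sphere of radius \<open>R\<close>: any exit
    must climb at least to this level.\<close>
  define d where "d = (R\<^sup>2 - r\<^sup>2)\<^sup>2"
  have rR: "r\<^sup>2 < R\<^sup>2" using r by (intro power_strict_mono) auto
  then have d: "d > 0" by (simp add: d_def)
  have Psi0: "\<Psi> x \<ge> 0" for x by (simp add: \<Psi>_def)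
  have Psid: "\<Psi> x \<ge> d" if "\<not> norm (x - z) < R" for x
  proof -
    have "R\<^sup>2 \<le> (norm (x - z))\<^sup>2" using that r by (intro power_mono) auto
    then show ?thesis unfolding \<Psi>_def d_def using rR by (intro power_mono) auto
  qed
  show ?thesis
  proof (intro exI[of _ "C / d"] conjI allI impI)
    show "0 \<le> C / d" using C d by simp
    fix m and M :: "'w measure" and \<pi> vh N G T
    assume m: "m \<ge> 0" and run: "pg_run M S v g p m B sig \<pi> vh" and N: "N \<ge> 1"
      and G: "G \<in> sets (natfilt M \<pi> N)" and Gr': "\<forall>w\<in>G. norm (\<pi> N w - z) \<le> r"
      and T': "\<forall>n. (\<Sum>k\<in>{N..<n}. noise g p B sig m k + (stepsize g p m k)\<^sup>2) \<le> T"
    note Gr = Gr'[rule_format] and T = T'[rule_format]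
    interpret prob_space M using run by (simp add: pg_run_def)
    define W where "W = {x. norm (x - z) < R}"
    have Wb: "W \<in> sets borel"
      unfolding W_def by (intro borel_open open_Collect_less continuous_intros)
    define F where "F = (\<lambda>n. {w \<in> G. \<forall>k\<in>{N..n}. \<pi> k w \<in> W})"
    have sub: "sets (natfilt M \<pi> n) \<subseteq> sets M" for n
      using subalgebra_natfilt[of \<pi> M n] run by (auto simp: subalgebra_def pg_run_def)
    have FF: "F n \<in> sets (natfilt M \<pi> n)" if "N \<le> n" for n
      unfolding F_def by (rule sets_natfilt_forall[OF N Wb G that])
    have GM: "G \<in> sets M" using G sub by blast
    have FM: "F n \<in> sets M" if "N \<le> n" for n using FF[OF that] sub by blast
    have FN: "F N = G" using Gr r by (force simp: F_def W_def)
    define c where "c = (\<lambda>n. LINT w|M. indicator (F n) w * \<Psi> (\<pi> n w))"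
    let ?E = "\<lambda>k. noise g p B sig m k + (stepsize g p m k)\<^sup>2"
    have gam: "stepsize g p m k > 0" if "k \<ge> 1" for k
      using g m that by (simp add: stepsize_def)
    \<comment> \<open>A run leaving at time \<open>Suc n\<close> drops out of
      \<open>c (Suc n)\<close> while carrying \<Psi> >= d; the lost probability therefore enters the
      balance with weight d, and the sum over n telescopes.\<close>
    have step: "c (Suc n) + d * (prob (F n) - prob (F (Suc n))) \<le> c n + C * ?E n * prob G" if n: "N \<le> n" for n
    proof -
      have n1: "n \<ge> 1" "Suc n \<ge> 1" using n N by auto
      have FS: "F (Suc n) \<subseteq> F n" by (auto simp: F_def)
      have "(LINT w|M. indicator (F n) w * \<Psi> (\<pi> (Suc n) w)) \<le> 1 * c n
          + (C * noise g p B sig m n + C * (stepsize g p m n)\<^sup>2) * prob (F n)"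
        unfolding c_def
      proof (rule pg_step_expectation[OF run S(2) v cPsi cH n1(1) FF[OF n] C(1) _ refl])
        show "0 \<le> C * (stepsize g p m n)\<^sup>2" using C by simp
        show "0 \<le> stepsize g p m n" using gam[OF n1(1)] by simp
        fix w u b assume w: "w \<in> F n"
          and eq: "\<pi> (Suc n) w = closest_point S (\<pi> n w + stepsize g p m n *\<^sub>R (v (\<pi> n w) + b + u))"
        have "w \<in> space M" using w FM[OF n] sets.sets_into_space by blast
        then have x: "\<pi> n w \<in> S" by (rule pg_run_in[OF run S(2) n1(1)])
        have "norm (\<pi> n w - z) < R" using w n by (auto simp: F_def W_def)
        from C(2)[OF x nonpos[OF x this] gam[OF n1(1)] eq]
        show "\<Psi> (\<pi> (Suc n) w) \<le> 1 * \<Psi> (\<pi> n w) + stepsize g p m n * (u \<bullet> H (\<pi> n w)) +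
          C * ((stepsize g p m n)\<^sup>2 * (norm u)\<^sup>2 + stepsize g p m n * norm b + (stepsize g p m n)\<^sup>2 * (norm b)\<^sup>2) +
          C * (stepsize g p m n)\<^sup>2" by simp
      qed
      also have "(C * noise g p B sig m n + C * (stepsize g p m n)\<^sup>2) * prob (F n) = C * ?E n * prob (F n)"
        by (simp add: algebra_simps)
      also have "\<dots> \<le> C * ?E n * prob G"
        using C noise_nonneg[OF m g] GM
        by (intro mult_left_mono finite_measure_mono) (auto simp: F_def)
      finally have 1: "(LINT w|M. indicator (F n) w * \<Psi> (\<pi> (Suc n) w)) \<le> c n + C * ?E n * prob G" by simp
      have i1: "integrable M (\<lambda>w. indicator (F k) w * \<Psi> (\<pi> (Suc n) w))" if "N \<le> k" for k
        by (rule integrable_pg[OF run S(2) cPsi FM[OF that] n1(2)])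
      have i2: "integrable M (\<lambda>w. indicator (F k) w :: real)" if "N \<le> k" for k
        using FM[OF that] by (simp add: emeasure_eq_measure)
      have "c (Suc n) + d * (prob (F n) - prob (F (Suc n))) =
         (LINT w|M. indicator (F (Suc n)) w * \<Psi> (\<pi> (Suc n) w) + d * (indicator (F n) w - indicator (F (Suc n)) w))"
        unfolding c_def using i1[of "Suc n"] i2[of n] i2[of "Suc n"] FM[of n] FM[of "Suc n"] n
          sets.sets_into_space[OF FM[of n]] sets.sets_into_space[OF FM[of "Suc n"]]
        by (simp add: Int_absorb2)
      also have "\<dots> \<le> (LINT w|M. indicator (F n) w * \<Psi> (\<pi> (Suc n) w))"
      proof (rule integral_mono)
        show "integrable M (\<lambda>w. indicator (F (Suc n)) w * \<Psi> (\<pi> (Suc n) w) + d * (indicator (F n) w - indicator (F (Suc n)) w))"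
          using i1[of "Suc n"] i2[of n] i2[of "Suc n"] n by simp
        show "integrable M (\<lambda>w. indicator (F n) w * \<Psi> (\<pi> (Suc n) w))" by (rule i1[OF n])
        fix w assume "w \<in> space M"
        show "indicator (F (Suc n)) w * \<Psi> (\<pi> (Suc n) w) + d * (indicator (F n) w - indicator (F (Suc n)) w)
           \<le> indicator (F n) w * \<Psi> (\<pi> (Suc n) w)"
        proof (cases "w \<in> F (Suc n)")
          case True
          then show ?thesis using FS by (auto simp: indicator_def)
        next
          case False
          show ?thesis
          proof (cases "w \<in> F n")
            case True
            then have "\<not> norm (\<pi> (Suc n) w - z) < R"
              using False n by (auto simp: F_def W_def atLeastAtMostSuc_conv)
            then show ?thesis using Psid True False by (simp add: indicator_def)
          qed (use False in \<open>simp add: indicator_def\<close>)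
        qed
      qed
      finally show ?thesis using 1 by linarith
    qed
    have tot: "c n + d * (prob G - prob (F n)) \<le> C * (\<Sum>k\<in>{N..<n}. ?E k) * prob G" if "n \<ge> N" for n
      using that
    proof (induction n rule: nat_induct_at_least)
      case base
      have "indicator G w * \<Psi> (\<pi> N w) = 0" for w
      proof (cases "w \<in> G")
        case True
        then have "(norm (\<pi> N w - z))\<^sup>2 \<le> r\<^sup>2" using Gr by (intro power_mono) auto
        then show ?thesis by (simp add: \<Psi>_def)
      qed simp
      then have "c N = (LINT w|M. 0)" unfolding c_def FN by (simp only:)
      then show ?case by (simp add: FN)
    next
      case (Suc n)
      have "(\<Sum>k\<in>{N..<Suc n}. ?E k) = (\<Sum>k\<in>{N..<n}. ?E k) + ?E n" using Suc by simp
      then show ?case using step[OF Suc(1)] Suc.IH by (simp add: algebra_simps)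
    qed
    have c0: "c n \<ge> 0" for n unfolding c_def using Psi0 by (intro Bochner_Integration.integral_nonneg) auto
    have fin: "prob G - C / d * T * prob G \<le> prob (F n)" if "n \<ge> N" for n
    proof -
      have "d * (prob G - prob (F n)) \<le> C * (\<Sum>k\<in>{N..<n}. ?E k) * prob G" using tot[OF that] c0[of n] by linarith
      also have "\<dots> \<le> C * T * prob G" using T C by (intro mult_right_mono mult_left_mono) auto
      finally have "prob G - prob (F n) \<le> C * T * prob G / d" using d by (simp add: pos_le_divide_eq mult.commute)
      then show ?thesis by simp
    qed
    \<comment> \<open>The events of no exit up to time n decrease to the event of no exit at
      all.\<close>
    have lim: "(\<lambda>n. prob (F (n + N))) \<longlonglongrightarrow> prob (\<Inter>n. F (n + N))"
      using FM by (intro finite_Lim_measure_decseq) (auto simp: F_def decseq_def)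
    have "prob G - C / d * T * prob G \<le> prob (\<Inter>n. F (n + N))"
      by (rule LIMSEQ_le_const[OF lim]) (use fin in auto)
    moreover have "(\<Inter>n. F (n + N)) = {w\<in>G. \<forall>k\<ge>N. norm (\<pi> k w - z) < R}"
      unfolding F_def W_def by (auto, metis atLeastAtMost_iff le_add1 le_add2 order_refl)
    ultimately show "prob G - prob {w\<in>G. \<forall>k\<ge>N. norm (\<pi> k w - z) < R} \<le> C / d * T * prob G" by simp
  qed
qed

section \<open>Rates and convergence near a sharp equilibrium\<close>

text \<open>The indicator of having stayed in \<open>\<B>\<close> up to time n replaces the
  indicator of staying forever, which is not measurable at time n. The exponent \<theta> = 2 \<mu> g
  is allowed although the recursion wants strict inequality: the Lyapunov constant exceeds 2
  \<mu>.\<close>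

lemma pg_rate:
  fixes S :: "(real ^ 'n) set" and v :: "real ^ 'n \<Rightarrow> real ^ 'n" and M :: "'w measure"
  assumes S: "convex S" "compact S" and z: "z \<in> S" and v: "continuous_on S v"
    and c: "c > 0" and sharp: "\<And>y. y \<in> S \<Longrightarrow> v z \<bullet> (y - z) \<le> - c * norm (y - z)"
    and mu: "\<mu> > 0" and BS: "\<B> \<subseteq> S" "\<B> \<in> sets borel"
    and strong: "\<And>x. x \<in> \<B> \<Longrightarrow> v x \<bullet> (x - z) \<le> - \<mu> * (norm (x - z))\<^sup>2"
    and p: "0 < p" "p \<le> 1" and g: "g > 0" and m: "m \<ge> 0"
    and noise: "\<And>n. n \<ge> 1 \<Longrightarrow> noise g p B sig m n \<le> K / real n powr (p + q)" and K: "K \<ge> 0"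
    and th: "\<theta> > 0" "\<theta> \<le> q" "p = 1 \<Longrightarrow> \<theta> \<le> 2 * \<mu> * g"
    and run: "pg_run M S v g p m B sig \<pi> vh"
  shows "(\<lambda>n. LINT w|M. indicator {w \<in> space M. \<forall>k\<in>{1..n}. \<pi> k w \<in> \<B>} w * (norm (\<pi> n w - z))\<^sup>2)
     \<in> O(\<lambda>n. 1 / real n powr \<theta>)"
proof -
  interpret prob_space M using run by (simp add: pg_run_def)
  define E where "E = (\<lambda>n. {w \<in> space M. \<forall>k\<in>{1..n}. \<pi> k w \<in> \<B>})"
  obtain \<kappa> \<alpha> C \<gamma>0 where kap: "\<kappa> > 0" and al: "\<alpha> > 2 * \<mu>" and C: "C \<ge> 0" and g0: "\<gamma>0 > 0"
    and st: "\<And>x x' \<gamma> u b. x \<in> \<B> \<Longrightarrow> 0 < \<gamma> \<Longrightarrow> \<gamma> \<le> \<gamma>0 \<Longrightarrow>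
       x' = closest_point S (x + \<gamma> *\<^sub>R (v x + b + u)) \<Longrightarrow>
       (norm (x' - z))\<^sup>2 + \<kappa> * ((norm (x' - z))\<^sup>2)\<^sup>2
       \<le> (1 - \<alpha> * \<gamma> + C * \<gamma>\<^sup>2) * ((norm (x - z))\<^sup>2 + \<kappa> * ((norm (x - z))\<^sup>2)\<^sup>2)
         + \<gamma> * (u \<bullet> ((2 * (1 + 2 * \<kappa> * (norm (x - z))\<^sup>2)) *\<^sub>R (x - z)))
         + C * (\<gamma>\<^sup>2 * (norm u)\<^sup>2 + \<gamma> * norm b + \<gamma>\<^sup>2 * (norm b)\<^sup>2)"
    using rate_lyapunov_step[OF S z v c sharp mu BS(1) strong] by metis
  define \<Phi> where "\<Phi> = (\<lambda>x. (norm (x - z))\<^sup>2 + \<kappa> * ((norm (x - z))\<^sup>2)\<^sup>2)"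
  define H where "H = (\<lambda>x. (2 * (1 + 2 * \<kappa> * (norm (x - z))\<^sup>2)) *\<^sub>R (x - z))"
  have cPhi: "continuous_on UNIV \<Phi>" and cH: "continuous_on UNIV H"
    unfolding \<Phi>_def H_def by (intro continuous_intros)+
  have Phi0: "\<Phi> x \<ge> (norm (x - z))\<^sup>2" for x using kap by (simp add: \<Phi>_def)
  have sub: "sets (natfilt M \<pi> n) \<subseteq> sets M" for n
    using subalgebra_natfilt[of \<pi> M n] run by (auto simp: subalgebra_def pg_run_def)
  have EF: "E n \<in> sets (natfilt M \<pi> n)" if "n \<ge> 1" for n
    unfolding E_def using sets_natfilt_forall[OF order_refl BS(2), of "space M" M \<pi> n] that
      sets.top[of "natfilt M \<pi> 1"] by simp
  have EM: "E n \<in> sets M" if "n \<ge> 1" for n using EF[OF that] sub by blast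
  define a where "a = (\<lambda>n. LINT w|M. indicator (E n) w * \<Phi> (\<pi> n w))"
  have a0: "a n \<ge> 0" for n
    unfolding a_def using Phi0 by (intro Bochner_Integration.integral_nonneg) (meson mult_nonneg_nonneg indicator_pos_le order_trans zero_le_power2)
  have gam: "stepsize g p m n > 0" if "n \<ge> 1" for n
    using g m that by (simp add: stepsize_def)
  have "(\<lambda>n::nat. stepsize g p m n) \<longlonglongrightarrow> 0" unfolding stepsize_def using p by real_asymp
  then have evg: "eventually (\<lambda>n. stepsize g p m n < \<gamma>0) at_top" using g0 by (rule order_tendstoD)
  have rec: "a (Suc n) \<le> (1 - \<alpha> * stepsize g p m n + C * (stepsize g p m n)\<^sup>2) * a n
      + C * K / real n powr (p + \<theta>)" if n: "n \<ge> 1" and gn: "stepsize g p m n < \<gamma>0" for n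
  proof -
    \<comment> \<open>Since \<Phi> >= 0, exchanging \<open>E (Suc n)\<close> for the larger
      \<open>E n\<close>, which is known at time n, can only increase the integral.\<close>
    have "a (Suc n) \<le> (LINT w|M. indicator (E n) w * \<Phi> (\<pi> (Suc n) w))"
      unfolding a_def
    proof (rule integral_mono)
      show "integrable M (\<lambda>w. indicator (E (Suc n)) w * \<Phi> (\<pi> (Suc n) w))"
        by (rule integrable_pg[OF run S(2) cPhi EM]) auto
      show "integrable M (\<lambda>w. indicator (E n) w * \<Phi> (\<pi> (Suc n) w))"
        by (rule integrable_pg[OF run S(2) cPhi EM[OF n]]) auto
      fix w
      show "indicator (E (Suc n)) w * \<Phi> (\<pi> (Suc n) w) \<le> indicator (E n) w * \<Phi> (\<pi> (Suc n) w)"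
        using order_trans[OF zero_le_power2 Phi0]
        by (intro mult_right_mono) (auto simp: indicator_def E_def)
    qed
    also have "\<dots> \<le> (1 - \<alpha> * stepsize g p m n + C * (stepsize g p m n)\<^sup>2) * a n
        + (C * noise g p B sig m n + 0) * prob (E n)"
      unfolding a_def
    proof (rule pg_step_expectation[OF run S(2) v cPhi cH n EF[OF n] C order_refl refl])
      show "0 \<le> stepsize g p m n" using gam[OF n] by simp
      fix w u b assume w: "w \<in> E n"
        and eq: "\<pi> (Suc n) w = closest_point S (\<pi> n w + stepsize g p m n *\<^sub>R (v (\<pi> n w) + b + u))"
      have "\<pi> n w \<in> \<B>" using w n by (auto simp: E_def)
      from st[OF this gam[OF n] less_imp_le[OF gn] eq]
      show "\<Phi> (\<pi> (Suc n) w) \<le> (1 - \<alpha> * stepsize g p m n + C * (stepsize g p m n)\<^sup>2) * \<Phi> (\<pi> n w)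
          + stepsize g p m n * (u \<bullet> H (\<pi> n w)) +
          C * ((stepsize g p m n)\<^sup>2 * (norm u)\<^sup>2 + stepsize g p m n * norm b + (stepsize g p m n)\<^sup>2 * (norm b)\<^sup>2) + 0"
        unfolding \<Phi>_def H_def by simp
    qed
    also have "(C * noise g p B sig m n + 0) * prob (E n) \<le> C * noise g p B sig m n * 1"
      using C noise_nonneg[OF m g] by (simp only: add_0_right) (intro mult_left_mono, auto)
    also have "\<dots> \<le> C * (K / real n powr (p + q)) * 1"
      using C noise[OF n] by (intro mult_right_mono mult_left_mono) auto
    also have "\<dots> \<le> C * (K / real n powr (p + \<theta>)) * 1"
      using C K th n by (intro mult_left_mono mult_right_mono divide_left_mono powr_mono mult_pos_pos) auto
    finally show ?thesis by simp
  qed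
  have evrec: "eventually (\<lambda>n. a (Suc n) \<le> (1 - \<alpha> * stepsize g p m n + C * (stepsize g p m n)\<^sup>2) * a n
      + (C * K) / real n powr (p + \<theta>)) at_top"
    using eventually_ge_at_top[of 1] evg by eventually_elim (rule rec)
  have "2 * \<mu> * g < \<alpha> * g" using al g by simp
  then have "a \<in> O(\<lambda>n. 1 / real n powr \<theta>)"
    by (intro recursion_rate[OF a0 p g _ th(1) _ m _ evrec]) (use al mu C K th(3) in auto)
  moreover have "(\<lambda>n. LINT w|M. indicator (E n) w * (norm (\<pi> n w - z))\<^sup>2) \<in> O(a)"
  proof (rule landau_o.big_mono)
    show "eventually (\<lambda>n. norm (LINT w|M. indicator (E n) w * (norm (\<pi> n w - z))\<^sup>2) \<le> norm (a n)) at_top"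
      using eventually_ge_at_top[of 1]
    proof eventually_elim
      case (elim n)
      have "(LINT w|M. indicator (E n) w * (norm (\<pi> n w - z))\<^sup>2) \<le> a n"
        unfolding a_def
      proof (rule integral_mono)
        show "integrable M (\<lambda>w. indicator (E n) w * (norm (\<pi> n w - z))\<^sup>2)"
          by (rule integrable_pg[OF run S(2) _ EM[OF elim] elim]) (intro continuous_intros)
        show "integrable M (\<lambda>w. indicator (E n) w * \<Phi> (\<pi> n w))"
          by (rule integrable_pg[OF run S(2) cPhi EM[OF elim] elim])
        show "indicator (E n) w * (norm (\<pi> n w - z))\<^sup>2 \<le> indicator (E n) w * \<Phi> (\<pi> n w)" for w
          using Phi0 by (intro mult_left_mono) auto
      qed
      moreover have "(LINT w|M. indicator (E n) w * (norm (\<pi> n w - z))\<^sup>2) \<ge> 0"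
        by (intro Bochner_Integration.integral_nonneg) auto
      ultimately show ?case using a0[of n] by simp
    qed
  qed
  ultimately show ?thesis unfolding E_def by (rule landau_o.big_trans[rotated])
qed

text \<open>Mean-square decay only gives convergence in probability. It guarantees closeness at one
  late time up to small probability; the exit estimate restarted there, with the small tail
  \<open>T N\<close> as total noise, excludes later excursions.\<close>

lemma pg_converges:
  fixes S :: "(real ^ 'n) set" and v :: "real ^ 'n \<Rightarrow> real ^ 'n" and M :: "'w measure"
  assumes S: "convex S" "compact S" and z: "z \<in> S" and v: "continuous_on S v" and BS: "\<B> \<in> sets borel"
    and R: "R > 0" and nonpos: "\<And>x. x \<in> S \<Longrightarrow> norm (x - z) < R \<Longrightarrow> v x \<bullet> (x - z) \<le> 0"
    and g: "g > 0" and m: "m \<ge> 0"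
    and summ: "summable (\<lambda>n. noise g p B sig m (Suc n) + (stepsize g p m (Suc n))\<^sup>2)"
    and run: "pg_run M S v g p m B sig \<pi> vh"
    and L2: "(\<lambda>n. LINT w|M. indicator {w \<in> space M. \<forall>k\<in>{1..n}. \<pi> k w \<in> \<B>} w * (norm (\<pi> n w - z))\<^sup>2) \<longlonglongrightarrow> 0"
  shows "AE w in M. (\<forall>n\<ge>1. \<pi> n w \<in> \<B>) \<longrightarrow> (\<lambda>n. \<pi> n w) \<longlonglongrightarrow> z"
proof -
  interpret prob_space M using run by (simp add: pg_run_def)
  define E where "E = (\<lambda>n. {w \<in> space M. \<forall>k\<in>{1..n}. \<pi> k w \<in> \<B>})"
  have sub: "sets (natfilt M \<pi> n) \<subseteq> sets M" for n
    using subalgebra_natfilt[of \<pi> M n] run by (auto simp: subalgebra_def pg_run_def)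
  have pm: "\<pi> n \<in> borel_measurable M" if "n \<ge> 1" for n using run that by (simp add: pg_run_def)
  have EM: "E n \<in> sets M" if "n \<ge> 1" for n
    unfolding E_def using sets_natfilt_forall[OF order_refl BS, of "space M" M \<pi> n] that
      sets.top[of "natfilt M \<pi> 1"] sub[of n] by auto
  define e where "e = (\<lambda>k. noise g p B sig m k + (stepsize g p m k)\<^sup>2)"
  have e0: "e k \<ge> 0" for k using noise_nonneg[OF m g] by (simp add: e_def)
  have se: "summable (\<lambda>n. e (Suc n))" using summ by (simp add: e_def)
  define T where "T = (\<lambda>N. \<Sum>k. e (Suc (k + N)))"
  have T: "(\<Sum>k\<in>{Suc N..<n}. e k) \<le> T N" for N n
  proof -
    have "(\<Sum>k\<in>{Suc N..<n}. e k) = (\<Sum>k\<in>{0 + Suc N..<(n - Suc N) + Suc N}. e k)"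
      by (cases "n \<ge> Suc N") auto
    also have "\<dots> = (\<Sum>k\<in>{0..<n - Suc N}. e (k + Suc N))" by (rule sum.shift_bounds_nat_ivl)
    also have "\<dots> \<le> T N"
      unfolding T_def using e0 summable_ignore_initial_segment[OF se, of N]
      by (intro order_trans[OF _ sum_le_suminf[of _ "{0..<n - Suc N}"]]) auto
    finally show ?thesis .
  qed
  have T0: "T N \<ge> 0" for N
    unfolding T_def using e0 summable_ignore_initial_segment[OF se, of N] by (intro suminf_nonneg) auto
  have Tlim: "T \<longlonglongrightarrow> 0"
    unfolding T_def using suminf_exist_split2[OF se] by simp
  \<comment> \<open>The bad event for radius \<epsilon>: the run stays in \<open>\<B>\<close>
    forever without ever settling in the \<epsilon>-ball.\<close>
  define Z where "Z = (\<lambda>\<epsilon>. {w \<in> space M. (\<forall>n\<ge>1. \<pi> n w \<in> \<B>) \<and> \<not> (\<exists>N\<ge>1. \<forall>k\<ge>N. norm (\<pi> k w - z) < \<epsilon>)})"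
  have null: "AE w in M. w \<notin> Z \<epsilon>" if eps: "0 < \<epsilon>" "\<epsilon> \<le> R" for \<epsilon>
  proof -
    define r where "r = \<epsilon> / 2"
    have r: "0 \<le> r" "r < \<epsilon>" "r > 0" using eps by (auto simp: r_def)
    have np: "v x \<bullet> (x - z) \<le> 0" if "x \<in> S" "norm (x - z) < \<epsilon>" for x
      using nonpos that eps by simp
    obtain C where C: "C \<ge> 0"
      "\<forall>m\<ge>0. \<forall>(M :: 'w measure) \<pi> vh N G T. pg_run M S v g p m B sig \<pi> vh \<longrightarrow> N \<ge> 1 \<longrightarrow>
       G \<in> sets (natfilt M \<pi> N) \<longrightarrow> (\<forall>w\<in>G. norm (\<pi> N w - z) \<le> r) \<longrightarrow>
       (\<forall>n. (\<Sum>k\<in>{N..<n}. noise g p B sig m k + (stepsize g p m k)\<^sup>2) \<le> T) \<longrightarrow>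
       measure M G - measure M {w\<in>G. \<forall>k\<ge>N. norm (\<pi> k w - z) < \<epsilon>} \<le> C * T * measure M G"
      using pg_no_exit[OF S z v r(1,2) np g, where p = p and B = B and sig = sig and 'w = 'w] by blast
    define s where "s = (\<lambda>n. LINT w|M. indicator (E n) w * (norm (\<pi> n w - z))\<^sup>2)"
    have Zm: "{w \<in> space M. norm (\<pi> k w - z) < \<epsilon>} \<in> sets M" if "k \<ge> 1" for k
      using pm[OF that] by measurable
    have Bm: "{w \<in> space M. \<pi> n w \<in> \<B>} \<in> sets M" if "n \<ge> 1" for n
      using measurable_sets[OF pm[OF that] BS] by (simp add: vimage_def Int_def conj_commute)
    have ZM: "Z \<epsilon> \<in> sets M"
    proof -
      have "Z \<epsilon> = (\<Inter>n\<in>{1..}. {w \<in> space M. \<pi> n w \<in> \<B>}) - (\<Union>N\<in>{1..}. \<Inter>k\<in>{N..}. {w \<in> space M. norm (\<pi> k w - z) < \<epsilon>})"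
        by (auto simp: Z_def)
      also have "\<dots> \<in> sets M"
        using Zm Bm by (intro sets.Diff sets.countable_INT'' sets.countable_UN'' sets.countable_INT') auto
      finally show ?thesis .
    qed
    \<comment> \<open>At time N + 1 a bad run is either at distance above r, which Markov's
      inequality bounds (event \<open>Y\<close>), or within r and leaves the \<epsilon>-ball later
      (event \<open>G - F\<close>). N is free and both bounds tend to 0.\<close>
    have bnd: "prob (Z \<epsilon>) \<le> s (Suc N) / r\<^sup>2 + C * T N" for N
    proof -
      define G where "G = {w \<in> space M. norm (\<pi> (Suc N) w - z) \<le> r}"
      have "\<pi> (Suc N) -` {x. norm (x - z) \<le> r} \<inter> space (natfilt M \<pi> (Suc N)) \<in> sets (natfilt M \<pi> (Suc N))"
        by (intro measurable_sets[OF measurable_natfilt] borel_closed closed_Collect_le continuous_intros) auto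
      also have "\<pi> (Suc N) -` {x. norm (x - z) \<le> r} \<inter> space (natfilt M \<pi> (Suc N)) = G"
        by (auto simp: G_def)
      finally have GF: "G \<in> sets (natfilt M \<pi> (Suc N))" .
      have GM: "G \<in> sets M" using GF sub by blast
      define F where "F = {w\<in>G. \<forall>k\<ge>Suc N. norm (\<pi> k w - z) < \<epsilon>}"
      have FM: "F \<in> sets M"
      proof -
        have "F = G \<inter> (\<Inter>k\<in>{Suc N..}. {w \<in> space M. norm (\<pi> k w - z) < \<epsilon>})"
          by (auto simp: F_def G_def)
        also have "\<dots> \<in> sets M" using Zm GM by (intro sets.Int sets.countable_INT') auto
        finally show ?thesis .
      qed
      have FG: "F \<subseteq> G" by (auto simp: F_def)
      have "prob G - prob F \<le> C * T N * prob G"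
        unfolding F_def by (rule C(2)[rule_format, OF m run _ GF]) (use T in \<open>auto simp: G_def e_def\<close>)
      also have "\<dots> \<le> C * T N * 1"
        using C(1) T0 by (intro mult_left_mono) auto
      finally have 1: "prob (G - F) \<le> C * T N"
        using finite_measure_Diff[OF GM FM FG] by simp
      define Y where "Y = E (Suc N) - G"
      have YM: "Y \<in> sets M" using EM[of "Suc N"] GM by (auto simp: Y_def)
      have 2: "prob Y \<le> s (Suc N) / r\<^sup>2"
      proof -
        have "r\<^sup>2 * prob Y = (LINT w|M. r\<^sup>2 * indicator Y w)"
          using YM sets.sets_into_space[OF YM] by (simp add: Int_absorb2)
        also have "\<dots> \<le> s (Suc N)"
          unfolding s_def
        proof (rule integral_mono)
          show "integrable M (\<lambda>w. r\<^sup>2 * indicator Y w)" using YM by (simp add: emeasure_eq_measure)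
          show "integrable M (\<lambda>w. indicator (E (Suc N)) w * (norm (\<pi> (Suc N) w - z))\<^sup>2)"
            by (rule integrable_pg[OF run S(2) _ EM]) (auto intro!: continuous_intros)
          fix w assume w: "w \<in> space M"
          show "r\<^sup>2 * indicator Y w \<le> indicator (E (Suc N)) w * (norm (\<pi> (Suc N) w - z))\<^sup>2"
          proof (cases "w \<in> Y")
            case True
            then have "r \<le> norm (\<pi> (Suc N) w - z)" using w by (auto simp: Y_def G_def)
            then have "r\<^sup>2 \<le> (norm (\<pi> (Suc N) w - z))\<^sup>2" using r by (intro power_mono) auto
            then show ?thesis using True by (simp add: Y_def)
          qed simp
        qed
        finally show ?thesis using r by (simp add: pos_le_divide_eq mult.commute)
      qed
      have "Z \<epsilon> \<subseteq> Y \<union> (G - F)"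
        by (auto simp: Z_def Y_def E_def F_def)
      then have "prob (Z \<epsilon>) \<le> prob (Y \<union> (G - F))"
        using YM GM FM by (intro finite_measure_mono) auto
      also have "\<dots> \<le> prob Y + prob (G - F)"
        using YM GM FM by (intro measure_Un_le) auto
      finally show ?thesis using 1 2 by linarith
    qed
    have "s \<longlonglongrightarrow> 0" using L2 by (simp add: s_def E_def)
    then have "(\<lambda>N. s (Suc N) / r\<^sup>2 + C * T N) \<longlonglongrightarrow> 0 / r\<^sup>2 + C * 0"
      by (intro tendsto_intros Tlim filterlim_compose[OF _ filterlim_Suc]) (use r in auto)
    then have "prob (Z \<epsilon>) \<le> 0"
      using bnd by (intro LIMSEQ_le_const[where X = "\<lambda>N. s (Suc N) / r\<^sup>2 + C * T N"]) auto
    then have "prob (Z \<epsilon>) = 0" by (simp add: measure_le_0_iff)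
    then have "Z \<epsilon> \<in> null_sets M" using ZM by (simp add: null_sets_def emeasure_eq_measure)
    then show ?thesis by (rule AE_not_in)
  qed
  \<comment> \<open>Countably many radii, all at most \<open>R\<close>, suffice for convergence and
    allow a common null set.\<close>
  have "AE w in M. \<forall>j. w \<notin> Z (R / real (Suc j))"
    unfolding AE_all_countable using R null by (auto simp: divide_le_eq)
  then show ?thesis
    using AE_space
  proof eventually_elim
    case (elim w)
    show ?case
    proof
      assume B: "\<forall>n\<ge>1. \<pi> n w \<in> \<B>"
      show "(\<lambda>n. \<pi> n w) \<longlonglongrightarrow> z"
      proof (rule metric_LIMSEQ_I)
        fix \<delta> :: real assume "\<delta> > 0"
        then have "\<delta> / R > 0" using R by simp
        from reals_Archimedean[OF this] obtain j where "inverse (real (Suc j)) < \<delta> / R" by blast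
        then have j: "R / real (Suc j) < \<delta>" using R by (simp add: field_simps)
        have "w \<notin> Z (R / real (Suc j))" using elim by blast
        with B elim(2) obtain N where "\<forall>k\<ge>N. norm (\<pi> k w - z) < R / real (Suc j)"
          unfolding Z_def by blast
        then show "\<exists>N. \<forall>n\<ge>N. dist (\<pi> n w) z < \<delta>"
          using j by (intro exI[of _ N]) (force simp: dist_norm)
      qed
    qed
  qed
qed

text \<open>The probabilistic half without the game: only convexity and compactness of
  \<open>S\<close>, continuity of \<open>v\<close> on it and sharpness at \<open>z\<close> enter,
  besides the assumptions on \<open>\<B>\<close> and the estimates.\<close>

theorem pg_sharp_equilibrium:
  fixes S :: "(real ^ 'n) set" and v :: "real ^ 'n \<Rightarrow> real ^ 'n" and lb :: ereal
  assumes S: "convex S" "compact S" and z: "z \<in> S" and v: "continuous_on S v"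
    and c: "c > 0" and sharp: "\<And>y. y \<in> S \<Longrightarrow> v z \<bullet> (y - z) \<le> - c * norm (y - z)"
    and mu: "\<mu> > 0" and nb: "nbhd_in S z \<B>" and measB: "\<B> \<in> sets borel"
    and strong: "\<forall>x\<in>\<B>. v x \<bullet> (x - z) \<le> - \<mu> * (norm (x - z))\<^sup>2"
    and g: "g > 0"
    and p: "1/2 < p" "p \<le> 1"
    and bias: "(lb = \<infinity> \<and> (\<forall>n. B n = 0)) \<or>
               (\<exists>l. lb = ereal l \<and> B \<in> O(\<lambda>n. 1 / real n powr l))"
    and var: "sig \<in> O(\<lambda>n. real n powr ls)"
    and pb: "ereal p + lb > 1"
    and ps: "p - ls > 1/2"
  shows "\<exists>U. nbhd_in S z U \<and> U \<in> sets borel \<and>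
     (\<forall>\<delta>>0. \<exists>m0. \<forall>m\<ge>m0. \<forall>(M :: 'w measure) \<pi> vh.
        pg_run M S v g p m B sig \<pi> vh \<longrightarrow>
          measure M {w\<in>space M. \<pi> 1 w \<in> U \<and> (\<forall>n\<ge>1. \<pi> n w \<in> \<B>)}
            \<ge> (1 - \<delta>) * measure M {w\<in>space M. \<pi> 1 w \<in> U} \<and>
          measure M {w\<in>space M. \<pi> 1 w \<in> U \<and> (\<lambda>n. \<pi> n w) \<longlonglongrightarrow> z}
            \<ge> (1 - \<delta>) * measure M {w\<in>space M. \<pi> 1 w \<in> U}) \<and>
     (\<forall>m\<ge>0. \<forall>(M :: 'w measure) \<pi> vh.
        pg_run M S v g p m B sig \<pi> vh \<longrightarrow>
          (let E = {w\<in>space M. \<forall>n\<ge>1. \<pi> n w \<in> \<B>};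
               q = real_of_ereal (min lb (ereal (p - 2 * ls)));
               e = (\<lambda>n. (LINT w|M. indicator E w * (norm (\<pi> n w - z))\<^sup>2) / measure M E)
           in (AE w in M. w \<in> E \<longrightarrow> (\<lambda>n. \<pi> n w) \<longlonglongrightarrow> z) \<and>
              (if p = 1 \<and> 2 * \<mu> * g < q then e \<in> O(\<lambda>n. 1 / real n powr (2 * \<mu> * g))
               else e \<in> O(\<lambda>n. 1 / real n powr q))))"
proof -
  have BS: "\<B> \<subseteq> S" using nb by (simp add: nbhd_in_def)
  obtain R where R: "R > 0" and RB: "\<And>x. x \<in> S \<Longrightarrow> norm (x - z) < R \<Longrightarrow> x \<in> \<B>"
  proof -
    obtain W where W: "open W" "z \<in> W" "W \<inter> S \<subseteq> \<B>" using nb by (auto simp: nbhd_in_def)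
    then obtain R where "R > 0" "ball z R \<subseteq> W" using open_contains_ball by blast
    then have "x \<in> W" if "norm (x - z) < R" for x
      using that by (auto simp: dist_norm norm_minus_commute subset_iff)
    with W \<open>R > 0\<close> show thesis by (intro that[of R]) auto
  qed
  have strong': "v x \<bullet> (x - z) \<le> - \<mu> * (norm (x - z))\<^sup>2" if "x \<in> \<B>" for x using strong that by blast
  have nonpos: "v x \<bullet> (x - z) \<le> 0" if "x \<in> S" "norm (x - z) < R" for x
    using strong'[OF RB[OF that]] mu by (smt (verit) mult_nonneg_nonneg zero_le_power2 mult_minus_left)
  obtain l K1 where l: "p + l > 1" "min lb (ereal (p - 2 * ls)) = ereal (min l (p - 2 * ls))"
    and K1: "K1 \<ge> 0" "\<And>n. n \<ge> 1 \<Longrightarrow> \<bar>B n\<bar> \<le> K1 * (1 / real n powr l)"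
  proof (cases "lb = \<infinity>")
    case True
    then have B0: "B n = 0" for n using bias by auto
    \<comment> \<open>Without bias any finite exponent is a valid substitute for infinity; this one
      satisfies p + l > 1 and leaves the minimum with p - 2 ls unchanged.\<close>
    show thesis
      by (rule that[of "max 1 (p - 2 * ls)" 0]) (use True p B0 in auto)
  next
    case False
    then obtain l where l: "lb = ereal l" "B \<in> O(\<lambda>n. 1 / real n powr l)" using bias by auto
    obtain K where "K \<ge> 0" "\<And>n. n \<ge> 1 \<Longrightarrow> \<bar>B n\<bar> \<le> K * (1 / real n powr l)"
      using bigo_bound_from_one[OF l(2)] by auto
    moreover have "p + l > 1" using pb l by (simp add: one_ereal_def)
    ultimately show thesis using l by (intro that[of l K]) (auto simp: min_def)
  qed
  obtain K2 where K2: "K2 \<ge> 0" "\<And>n. n \<ge> 1 \<Longrightarrow> \<bar>sig n\<bar> \<le> K2 * real n powr ls"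
    using bigo_bound_from_one[OF var] by auto
  define q where "q = min l (p - 2 * ls)"
  have q: "q > 0" "real_of_ereal (min lb (ereal (p - 2 * ls))) = q"
    using l(1) p ps by (auto simp: q_def) (simp only: l(2) q_def real_of_ereal.simps)
  obtain K where K: "K \<ge> 0"
    "\<And>m n. m \<ge> 0 \<Longrightarrow> n \<ge> 1 \<Longrightarrow> noise g p B sig m n \<le> K / real n powr (p + q)"
    and summ: "\<And>m. m \<ge> 0 \<Longrightarrow> summable (\<lambda>n. noise g p B sig m (Suc n) + (stepsize g p m (Suc n))\<^sup>2)"
    and lim: "((\<lambda>m. \<Sum>n. noise g p B sig m (Suc n) + (stepsize g p m (Suc n))\<^sup>2) \<longlongrightarrow> 0) at_top"
    using step_errors[OF p g K1(2,1) l(1) K2(2,1) ps] unfolding q_def by blast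
  have p0: "p > 0" using p by simp
  have meas: "\<pi> n \<in> borel_measurable M" if "pg_run M S v g p m B sig \<pi> vh" "n \<ge> 1"
    for M :: "'w measure" and \<pi> vh m n using that by (simp add: pg_run_def)
  have Bm: "{w \<in> space M. \<forall>n\<ge>1. \<pi> n w \<in> \<B>} \<in> sets M" if run: "pg_run M S v g p m B sig \<pi> vh"
    for M :: "'w measure" and \<pi> vh m
  proof -
    have "{w \<in> space M. \<forall>n\<ge>1. \<pi> n w \<in> \<B>} = (\<Inter>n\<in>{1..}. \<pi> n -` \<B> \<inter> space M)" by auto
    also have "\<dots> \<in> sets M"
      using meas[OF run] measB by (intro sets.countable_INT') (auto intro: measurable_sets)
    finally show ?thesis .
  qed
  define rate where "rate = (\<lambda>(M :: 'w measure) (\<pi> :: nat \<Rightarrow> 'w \<Rightarrow> real ^ 'n) n.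
     LINT w|M. indicator {w \<in> space M. \<forall>k\<in>{1..n}. \<pi> k w \<in> \<B>} w * (norm (\<pi> n w - z))\<^sup>2)"
  have rate: "rate M \<pi> \<in> O(\<lambda>n. 1 / real n powr \<theta>)"
    if m: "m \<ge> 0" and run: "pg_run M S v g p m B sig \<pi> vh"
      and th: "\<theta> > 0" "\<theta> \<le> q" "p = 1 \<Longrightarrow> \<theta> \<le> 2 * \<mu> * g" for M :: "'w measure" and \<pi> vh m \<theta>
    unfolding rate_def
    by (rule pg_rate[OF S z v c sharp mu BS measB strong' p0 p(2) g m K(2)[OF m] K(1) th run])
  have conv: "AE w in M. (\<forall>n\<ge>1. \<pi> n w \<in> \<B>) \<longrightarrow> (\<lambda>n. \<pi> n w) \<longlonglongrightarrow> z"
    if m: "m \<ge> 0" and run: "pg_run M S v g p m B sig \<pi> vh" for M :: "'w measure" and \<pi> vh m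
  proof -
    \<comment> \<open>Some positive rate admissible in every case; convergence needs no
      more.\<close>
    define \<theta> where "\<theta> = min q (2 * \<mu> * g)"
    have th: "\<theta> > 0" using q mu g by (simp add: \<theta>_def)
    have "rate M \<pi> \<in> O(\<lambda>n. 1 / real n powr \<theta>)"
      by (rule rate[OF m run th]) (auto simp: \<theta>_def)
    then obtain c where ev: "eventually (\<lambda>n. norm (rate M \<pi> n) \<le> c * norm (1 / real n powr \<theta>)) at_top"
      by (rule landau_o.bigE)
    have "(\<lambda>n::nat. 1 / real n powr \<theta>) \<longlonglongrightarrow> 0"
      using th by real_asymp
    then have L2: "rate M \<pi> \<longlonglongrightarrow> 0"
      by (rule tendsto_0_le[where K = c]) (use ev in \<open>simp add: mult.commute\<close>)
    show ?thesis
      by (rule pg_converges[OF S z v measB R nonpos g m summ[OF m] run L2[unfolded rate_def]])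
  qed
  have ratE: "(\<lambda>n. (LINT w|M. indicator {w\<in>space M. \<forall>n\<ge>1. \<pi> n w \<in> \<B>} w * (norm (\<pi> n w - z))\<^sup>2)
       / measure M {w\<in>space M. \<forall>n\<ge>1. \<pi> n w \<in> \<B>}) \<in> O(\<lambda>n. 1 / real n powr \<theta>)"
    if m: "m \<ge> 0" and run: "pg_run M S v g p m B sig \<pi> vh"
      and th: "\<theta> > 0" "\<theta> \<le> q" "p = 1 \<Longrightarrow> \<theta> \<le> 2 * \<mu> * g" for M :: "'w measure" and \<pi> vh m \<theta>
  proof -
    let ?E = "{w\<in>space M. \<forall>n\<ge>1. \<pi> n w \<in> \<B>}"
    interpret prob_space M using run by (simp add: pg_run_def)
    \<comment> \<open>\<open>?E\<close> lies in every event of staying up to time n. If it is a null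
      set, both quotients by its probability are 0 and the bound is trivial.\<close>
    have "(\<lambda>n. (LINT w|M. indicator ?E w * (norm (\<pi> n w - z))\<^sup>2) / prob ?E) \<in> O(rate M \<pi>)"
    proof (rule bigoI)
      show "eventually (\<lambda>n. norm ((LINT w|M. indicator ?E w * (norm (\<pi> n w - z))\<^sup>2) / prob ?E)
          \<le> 1 / prob ?E * norm (rate M \<pi> n)) at_top"
        using eventually_ge_at_top[of 1]
      proof eventually_elim
        case (elim n)
        have c: "continuous_on UNIV (\<lambda>x. (norm (x - z))\<^sup>2)" by (intro continuous_intros)
        have "{w \<in> space M. \<forall>k\<in>{1..n}. \<pi> k w \<in> \<B>} = (\<Inter>k\<in>{1..n}. \<pi> k -` \<B> \<inter> space M)"
          using elim by fastforce
        also have "\<dots> \<in> sets M"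
          using meas[OF run] measB elim by (intro sets.finite_INT) (auto intro: measurable_sets)
        finally have En: "{w \<in> space M. \<forall>k\<in>{1..n}. \<pi> k w \<in> \<B>} \<in> sets M" .
        have "(LINT w|M. indicator ?E w * (norm (\<pi> n w - z))\<^sup>2) \<le> rate M \<pi> n"
          unfolding rate_def
          by (intro integral_mono integrable_pg[OF run S(2) c Bm[OF run] elim] integrable_pg[OF run S(2) c En elim])
            (auto simp: indicator_def)
        moreover have "(LINT w|M. indicator ?E w * (norm (\<pi> n w - z))\<^sup>2) \<ge> 0"
          by (intro Bochner_Integration.integral_nonneg) auto
        ultimately show ?case by (simp add: divide_right_mono)
      qed
    qed
    then show ?thesis using rate[OF m run th] by (rule landau_o.big_trans)
  qed
  \<comment> \<open>Half the radius leaves a gap to the \<open>R\<close>-ball, and the same U works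
    for every \<delta>.\<close>
  define U where "U = S \<inter> cball z (R / 2)"
  have Unb: "nbhd_in S z U"
    unfolding nbhd_in_def U_def by (intro conjI exI[of _ "ball z (R / 2)"]) (use R in auto)
  have Ub: "U \<in> sets borel"
    unfolding U_def using compact_imp_closed[OF S(2)] by (intro borel_closed closed_Int) auto
  have R2: "0 \<le> R / 2" "R / 2 < R" using R by auto
  obtain C where C: "C \<ge> 0" "\<forall>m\<ge>0. \<forall>(M :: 'w measure) \<pi> vh N G T. pg_run M S v g p m B sig \<pi> vh \<longrightarrow> N \<ge> 1 \<longrightarrow>
       G \<in> sets (natfilt M \<pi> N) \<longrightarrow> (\<forall>w\<in>G. norm (\<pi> N w - z) \<le> R / 2) \<longrightarrow>
       (\<forall>n. (\<Sum>k\<in>{N..<n}. noise g p B sig m k + (stepsize g p m k)\<^sup>2) \<le> T) \<longrightarrow>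
       measure M G - measure M {w\<in>G. \<forall>k\<ge>N. norm (\<pi> k w - z) < R} \<le> C * T * measure M G"
    using pg_no_exit[OF S z v R2 nonpos g, where p = p and B = B and sig = sig and 'w = 'w] by blast
  have part1: "\<exists>m0. \<forall>m\<ge>m0. \<forall>(M :: 'w measure) \<pi> vh.
        pg_run M S v g p m B sig \<pi> vh \<longrightarrow>
          measure M {w\<in>space M. \<pi> 1 w \<in> U \<and> (\<forall>n\<ge>1. \<pi> n w \<in> \<B>)}
            \<ge> (1 - \<delta>) * measure M {w\<in>space M. \<pi> 1 w \<in> U} \<and>
          measure M {w\<in>space M. \<pi> 1 w \<in> U \<and> (\<lambda>n. \<pi> n w) \<longlonglongrightarrow> z}
            \<ge> (1 - \<delta>) * measure M {w\<in>space M. \<pi> 1 w \<in> U}" if del: "\<delta> > 0" for \<delta>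
  proof -
    define T where "T = (\<lambda>m. \<Sum>n. noise g p B sig m (Suc n) + (stepsize g p m (Suc n))\<^sup>2)"
    have "((\<lambda>m. C * T m) \<longlongrightarrow> C * 0) at_top" unfolding T_def by (intro tendsto_intros lim)
    then have "eventually (\<lambda>m. C * T m < \<delta>) at_top" using del by (intro order_tendstoD) auto
    then obtain m1 where m1: "\<And>m. m \<ge> m1 \<Longrightarrow> C * T m < \<delta>" by (auto simp: eventually_at_top_linorder)
    show ?thesis
    \<comment> \<open>m is a real number; the maximum with 0 brings it into the range where the
      estimates hold.\<close>
    proof (intro exI[of _ "max m1 0"] allI impI)
      fix m and M :: "'w measure" and \<pi> vh
      assume "max m1 0 \<le> m" and run: "pg_run M S v g p m B sig \<pi> vh"
      then have m: "m \<ge> 0" and mT: "C * T m < \<delta>" using m1 by auto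
      interpret prob_space M using run by (simp add: pg_run_def)
      define G where "G = {w\<in>space M. \<pi> 1 w \<in> U}"
      have "\<pi> 1 -` U \<inter> space (natfilt M \<pi> 1) \<in> sets (natfilt M \<pi> 1)"
        by (intro measurable_sets[OF measurable_natfilt Ub]) auto
      also have "\<pi> 1 -` U \<inter> space (natfilt M \<pi> 1) = G" by (auto simp: G_def)
      finally have GF: "G \<in> sets (natfilt M \<pi> 1)" .
      have GM: "G \<in> sets M"
        using GF subalgebra_natfilt[of \<pi> M 1] meas[OF run] by (auto simp: subalgebra_def)
      have T: "(\<Sum>k\<in>{1..<n}. noise g p B sig m k + (stepsize g p m k)\<^sup>2) \<le> T m" for n
      proof -
        have "(\<Sum>k\<in>{1..<n}. noise g p B sig m k + (stepsize g p m k)\<^sup>2) =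
            (\<Sum>k\<in>{0..<n - 1}. noise g p B sig m (k + 1) + (stepsize g p m (k + 1))\<^sup>2)"
          using sum.shift_bounds_nat_ivl[of _ 0 1 "n - 1"] by (cases n) auto
        also have "\<dots> \<le> T m"
          unfolding T_def using noise_nonneg[OF m g] sum_le_suminf[OF summ[OF m], of "{0..<n - 1}"] by simp
        finally show ?thesis .
      qed
      define F where "F = {w\<in>G. \<forall>k\<ge>1. norm (\<pi> k w - z) < R}"
      have "measure M G - measure M F \<le> C * T m * measure M G"
        unfolding F_def
        by (rule C(2)[rule_format, OF m run order_refl GF])
          (use T in \<open>auto simp: G_def U_def dist_norm norm_minus_commute\<close>)
      also have "\<dots> \<le> \<delta> * measure M G" using mT by (intro mult_right_mono) auto
      finally have F: "(1 - \<delta>) * measure M G \<le> measure M F" by (simp add: algebra_simps)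
      have FE: "w \<in> F \<Longrightarrow> \<forall>n\<ge>1. \<pi> n w \<in> \<B>" for w
        using RB pg_run_in[OF run S(2)] by (auto simp: F_def G_def)
      have E: "{w\<in>space M. \<pi> 1 w \<in> U \<and> (\<forall>n\<ge>1. \<pi> n w \<in> \<B>)} = G \<inter> {w\<in>space M. \<forall>n\<ge>1. \<pi> n w \<in> \<B>}"
        by (auto simp: G_def)
      have EM: "G \<inter> {w\<in>space M. \<forall>n\<ge>1. \<pi> n w \<in> \<B>} \<in> sets M" using GM Bm[OF run] by blast
      have 1: "measure M F \<le> measure M (G \<inter> {w\<in>space M. \<forall>n\<ge>1. \<pi> n w \<in> \<B>})"
        using EM FE by (intro finite_measure_mono) (auto simp: F_def G_def)
      have LM: "{w\<in>space M. (\<lambda>n. \<pi> n w) \<longlonglongrightarrow> z} \<in> sets M"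
      proof -
        \<comment> \<open>The iterates are known to be measurable only from index 1 on, hence the
          shift.\<close>
        have "{w\<in>space M. (\<lambda>n. \<pi> (Suc n) w) \<longlonglongrightarrow> z} \<in> sets M"
          using meas[OF run] by measurable
        also have "{w\<in>space M. (\<lambda>n. \<pi> (Suc n) w) \<longlonglongrightarrow> z} = {w\<in>space M. (\<lambda>n. \<pi> n w) \<longlonglongrightarrow> z}"
          by (intro Collect_cong conj_cong refl filterlim_sequentially_Suc)
        finally show ?thesis .
      qed
      have L: "{w\<in>space M. \<pi> 1 w \<in> U \<and> (\<lambda>n. \<pi> n w) \<longlonglongrightarrow> z} = G \<inter> {w\<in>space M. (\<lambda>n. \<pi> n w) \<longlonglongrightarrow> z}"
        by (auto simp: G_def)
      have 2: "measure M (G \<inter> {w\<in>space M. \<forall>n\<ge>1. \<pi> n w \<in> \<B>}) \<le>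
          measure M (G \<inter> {w\<in>space M. (\<lambda>n. \<pi> n w) \<longlonglongrightarrow> z})"
        using conv[OF m run] GM LM by (intro finite_measure_mono_AE) auto
      show "measure M {w\<in>space M. \<pi> 1 w \<in> U \<and> (\<forall>n\<ge>1. \<pi> n w \<in> \<B>)}
            \<ge> (1 - \<delta>) * measure M {w\<in>space M. \<pi> 1 w \<in> U} \<and>
          measure M {w\<in>space M. \<pi> 1 w \<in> U \<and> (\<lambda>n. \<pi> n w) \<longlonglongrightarrow> z}
            \<ge> (1 - \<delta>) * measure M {w\<in>space M. \<pi> 1 w \<in> U}"
        unfolding E L G_def[symmetric] using F 1 2 by linarith
    qed
  qed
  show ?thesis
  proof (intro exI[of _ U] conjI Unb Ub allI impI)
    fix m and M :: "'w measure" and \<pi> vh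
    assume m: "0 \<le> m" and run: "pg_run M S v g p m B sig \<pi> vh"
    let ?E = "{w\<in>space M. \<forall>n\<ge>1. \<pi> n w \<in> \<B>}"
    let ?e = "\<lambda>n. (LINT w|M. indicator ?E w * (norm (\<pi> n w - z))\<^sup>2) / measure M ?E"
    have "AE w in M. w \<in> ?E \<longrightarrow> (\<lambda>n. \<pi> n w) \<longlonglongrightarrow> z" using conv[OF m run] by auto
    moreover have "?e \<in> O(\<lambda>n. 1 / real n powr (2 * \<mu> * g))" if "p = 1 \<and> 2 * \<mu> * g < q"
      by (rule ratE[OF m run]) (use that mu g in auto)
    moreover have "?e \<in> O(\<lambda>n. 1 / real n powr q)" if "\<not> (p = 1 \<and> 2 * \<mu> * g < q)"
      by (rule ratE[OF m run]) (use that q in auto)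
    ultimately show "let E = ?E; q = real_of_ereal (min lb (ereal (p - 2 * ls)));
               e = (\<lambda>n. (LINT w|M. indicator E w * (norm (\<pi> n w - z))\<^sup>2) / measure M E)
           in (AE w in M. w \<in> E \<longrightarrow> (\<lambda>n. \<pi> n w) \<longlonglongrightarrow> z) \<and>
              (if p = 1 \<and> 2 * \<mu> * g < q then e \<in> O(\<lambda>n. 1 / real n powr (2 * \<mu> * g))
               else e \<in> O(\<lambda>n. 1 / real n powr q))"
      unfolding Let_def q(2) by simp
  qed (rule part1)
qed

section \<open>The value function is rational near the policy space\<close>

text \<open>An open neighbourhood of the policy space on which the series of transition powers
  converges; absolute values, because entries may be negative there.\<close>

definition transient_region where
  "transient_region A P = {x. \<forall>s. (\<Sum>s'\<in>UNIV. \<bar>trans_mat A P x s s'\<bar>) < 1}"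

text \<open>Expected number of visits to s' from s, that is, the entry of the inverse of I -
  \<open>trans_mat A P x\<close>.\<close>

definition visits where
  "visits A P x s s' = (\<Sum>t. mpow A P x t s s')"

definition state_value where
  "state_value A P r x i s = (\<Sum>s'\<in>UNIV. visits A P x s s' * rew_vec A r x i s')"

section \<open>Polynomial dependence on the policy\<close>

lemma polynomial_jprob: "real_polynomial_function (\<lambda>x. jprob x s a)"
  unfolding jprob_def
  by (intro real_polynomial_function_prod finite real_polynomial_function.intros(1) bounded_linear_vec_nth)

lemma polynomial_trans_mat: "real_polynomial_function (\<lambda>x. trans_mat A P x s s')"
  unfolding trans_mat_def
  by (intro real_polynomial_function_sum finite real_polynomial_function.intros(4) polynomial_jprob real_polynomial_function.intros(2))

lemma polynomial_rew_vec: "real_polynomial_function (\<lambda>x. rew_vec A r x i s)"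
  unfolding rew_vec_def
  by (intro real_polynomial_function_sum finite real_polynomial_function.intros(4) polynomial_jprob real_polynomial_function.intros(2))

lemma polynomial_det:
  fixes f :: "'b::real_normed_vector \<Rightarrow> 'n::finite \<Rightarrow> 'n \<Rightarrow> real"
  assumes "\<And>i j. real_polynomial_function (\<lambda>x. f x i j)"
  shows "real_polynomial_function (\<lambda>x. det (\<chi> i j. f x i j))"
proof -
  have "real_polynomial_function (\<lambda>x. \<Sum>p | p permutes (UNIV :: 'n set). of_int (sign p) * (\<Prod>i\<in>UNIV. f x i (p i)))"
    by (intro real_polynomial_function_sum finite real_polynomial_function.intros(4) real_polynomial_function.intros(2)
        real_polynomial_function_prod assms)
  then show ?thesis by (simp add: det_def)
qed

text \<open>That each directional derivative is again a polynomial is what later makes the gradient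
  field itself differentiable.\<close>

lemma polynomial_has_derivative:
  fixes f :: "'b::real_normed_vector \<Rightarrow> real"
  assumes "real_polynomial_function f"
  shows "\<exists>f'. (\<forall>x. (f has_derivative f' x) (at x)) \<and> (\<forall>h. real_polynomial_function (\<lambda>x. f' x h))"
  using assms
proof induction
  case (linear f)
  then show ?case
    by (intro exI[of _ "\<lambda>x. f"]) (auto intro: bounded_linear_imp_has_derivative)
next
  case (const c)
  then show ?case by (intro exI[of _ "\<lambda>x h. 0"]) auto
next
  case (add f g)
  then obtain f' g' where "\<And>x. (f has_derivative f' x) (at x)" "\<And>h. real_polynomial_function (\<lambda>x. f' x h)"
    "\<And>x. (g has_derivative g' x) (at x)" "\<And>h. real_polynomial_function (\<lambda>x. g' x h)" by metis
  then show ?case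
    by (intro exI[of _ "\<lambda>x h. f' x h + g' x h"]) (auto intro!: derivative_intros)
next
  case (mult f g)
  then obtain f' g' where *: "\<And>x. (f has_derivative f' x) (at x)" "\<And>h. real_polynomial_function (\<lambda>x. f' x h)"
    "\<And>x. (g has_derivative g' x) (at x)" "\<And>h. real_polynomial_function (\<lambda>x. g' x h)" by metis
  show ?case
    by (intro exI[of _ "\<lambda>x h. f x * g' x h + f' x h * g x"] conjI allI has_derivative_mult
        real_polynomial_function.intros(3,4) mult.hyps *)
qed

lemma polynomial_differentiable:
  "real_polynomial_function f \<Longrightarrow> f differentiable (at x)" for f :: "'b::real_normed_vector \<Rightarrow> real"
  using polynomial_has_derivative[of f] by (auto simp: differentiable_def)

lemma polynomial_continuous_on:
  "real_polynomial_function f \<Longrightarrow> continuous_on S f" for f :: "'b::real_normed_vector \<Rightarrow> real"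
  by (intro continuous_at_imp_continuous_on ballI differentiable_imp_continuous_within polynomial_differentiable)

lemma open_transient_region: "open (transient_region A P)"
proof -
  have "transient_region A P = (\<Inter>s. {x. (\<Sum>s'\<in>UNIV. \<bar>trans_mat A P x s s'\<bar>) < 1})"
    by (auto simp: transient_region_def)
  also have "open \<dots>"
    by (intro open_INT ballI finite open_Collect_less continuous_intros polynomial_continuous_on polynomial_trans_mat)
  finally show ?thesis .
qed

lemma sum_jprob:
  assumes "x \<in> polspace A"
  shows "(\<Sum>a\<in>joint A. jprob x s a) = 1"
proof -
  have "(\<Sum>a\<in>joint A. jprob x s a) = (\<Prod>i\<in>UNIV. \<Sum>b\<in>A i. x $ (i, s, b))"
    unfolding jprob_def joint_def by (subst prod_sum_PiE) (auto simp: PiE_def extensional_def)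
  also have "\<dots> = 1" using assms by (simp add: polspace_def)
  finally show ?thesis .
qed

lemma jprob_nonneg: "x \<in> polspace A \<Longrightarrow> jprob x s a \<ge> 0"
  unfolding jprob_def by (rule prod_nonneg) (simp add: polspace_def)

lemma trans_mat_nonneg:
  assumes "game_ok A P r \<rho>" "x \<in> polspace A"
  shows "trans_mat A P x s s' \<ge> 0"
  unfolding trans_mat_def
proof (intro sum_nonneg mult_nonneg_nonneg)
  show "jprob x s a \<ge> 0" for a by (rule jprob_nonneg[OF assms(2)])
  show "P s a s' \<ge> 0" if "a \<in> joint A" for a using assms(1) that by (simp add: game_ok_def)
qed

lemma mpow_nonneg:
  assumes "game_ok A P r \<rho>" "x \<in> polspace A"
  shows "mpow A P x t s s' \<ge> 0"
proof (induction t arbitrary: s')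
  case (Suc t)
  show ?case
    unfolding mpow.simps by (intro sum_nonneg mult_nonneg_nonneg Suc trans_mat_nonneg[OF assms])
qed simp

lemma polspace_transient:
  assumes game: "game_ok A P r \<rho>" and x: "x \<in> polspace A"
  shows "x \<in> transient_region A P"
  unfolding transient_region_def
proof (intro CollectI allI)
  fix s
  have "\<exists>a\<in>joint A. jprob x s a > 0"
  proof (rule ccontr)
    assume "\<not> ?thesis"
    then have "\<And>a. a \<in> joint A \<Longrightarrow> jprob x s a = 0" using jprob_nonneg[OF x] by (metis less_eq_real_def)
    then show False using sum_jprob[OF x, of s] by simp
  qed
  then obtain a0 where a0: "a0 \<in> joint A" "jprob x s a0 > 0" by blast
  have le: "(\<Sum>s'\<in>UNIV. P s a s') < 1" if "a \<in> joint A" for a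
    using game that by (simp add: game_ok_def)
  have "(\<Sum>s'\<in>UNIV. \<bar>trans_mat A P x s s'\<bar>) = (\<Sum>s'\<in>UNIV. \<Sum>a\<in>joint A. jprob x s a * P s a s')"
    using trans_mat_nonneg[OF game x] by (simp add: trans_mat_def)
  also have "\<dots> = (\<Sum>a\<in>joint A. jprob x s a * (\<Sum>s'\<in>UNIV. P s a s'))"
    by (subst sum.swap) (simp add: sum_distrib_left)
  \<comment> \<open>A row sum is an average of continuation probabilities, all below 1; strictness
    needs one joint action of positive weight, namely \<open>a0\<close>.\<close>
  also have "\<dots> < (\<Sum>a\<in>joint A. jprob x s a)"
  proof (rule sum_strict_mono_ex1)
    show "\<forall>a\<in>joint A. jprob x s a * (\<Sum>s'\<in>UNIV. P s a s') \<le> jprob x s a"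
      using mult_left_mono[OF less_imp_le[OF le] jprob_nonneg[OF x]] by simp
    show "\<exists>a\<in>joint A. jprob x s a * (\<Sum>s'\<in>UNIV. P s a s') < jprob x s a"
      using a0 le by (intro bexI[of _ a0]) auto
  qed simp
  also have "\<dots> = 1" by (rule sum_jprob[OF x])
  finally show "(\<Sum>s'\<in>UNIV. \<bar>trans_mat A P x s s'\<bar>) < 1" .
qed

section \<open>Expected visits and Bellman's equation\<close>

lemma mpow_geometric:
  assumes "x \<in> transient_region A P"
  obtains k where "0 \<le> k" "k < 1" "\<And>t s s'. \<bar>mpow A P x t s s'\<bar> \<le> k ^ t"
proof -
  define k where "k = Max (range (\<lambda>s. \<Sum>s'\<in>UNIV. \<bar>trans_mat A P x s s'\<bar>))"
  have row: "(\<Sum>s'\<in>UNIV. \<bar>trans_mat A P x s s'\<bar>) \<le> k" for s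
    unfolding k_def by (intro Max_ge) auto
  have k1: "k < 1" unfolding k_def using assms by (subst Max_less_iff) (auto simp: transient_region_def)
  have k0: "k \<ge> 0" using row[of undefined] by (rule order_trans[rotated]) (simp add: sum_nonneg)
  have "(\<Sum>s'\<in>UNIV. \<bar>mpow A P x t s s'\<bar>) \<le> k ^ t" for t s
  proof (induction t)
    case (Suc t)
    have "(\<Sum>s'\<in>UNIV. \<bar>mpow A P x (Suc t) s s'\<bar>)
        \<le> (\<Sum>s'\<in>UNIV. \<Sum>u\<in>UNIV. \<bar>mpow A P x t s u\<bar> * \<bar>trans_mat A P x u s'\<bar>)"
      by (auto intro!: sum_mono order_trans[OF sum_abs] simp: abs_mult)
    also have "\<dots> = (\<Sum>u\<in>UNIV. \<bar>mpow A P x t s u\<bar> * (\<Sum>s'\<in>UNIV. \<bar>trans_mat A P x u s'\<bar>))"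
      by (subst sum.swap) (simp add: sum_distrib_left)
    also have "\<dots> \<le> (\<Sum>u\<in>UNIV. \<bar>mpow A P x t s u\<bar> * k)"
      by (intro sum_mono mult_left_mono row) auto
    also have "\<dots> \<le> k ^ t * k"
      using Suc k0 by (simp add: mult_right_mono flip: sum_distrib_right)
    finally show ?case by (simp add: mult.commute)
  qed simp
  then have "\<bar>mpow A P x t s s'\<bar> \<le> k ^ t" for t s s'
    using member_le_sum[of s' UNIV "\<lambda>s'. \<bar>mpow A P x t s s'\<bar>"] by (meson UNIV_I abs_ge_zero finite order_trans)
  then show thesis using that k0 k1 by blast
qed

lemma summable_mpow:
  assumes "x \<in> transient_region A P"
  shows "summable (\<lambda>t. mpow A P x t s s')"
proof -
  obtain k where k: "0 \<le> k" "k < 1" "\<And>t s s'. \<bar>mpow A P x t s s'\<bar> \<le> k ^ t"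
    using mpow_geometric[OF assms] by blast
  have "summable (\<lambda>t. k ^ t)" using k by (intro summable_geometric) simp
  then show ?thesis
    by (rule summable_comparison_test'[where N = 0]) (simp add: k(3))
qed

text \<open>\<open>mpow\<close> splits off the last transition; Bellman's equation needs the first
  one split off.\<close>

lemma mpow_Suc_left: "mpow A P x (Suc t) s s' = (\<Sum>u\<in>UNIV. trans_mat A P x s u * mpow A P x t u s')"
proof (induction t arbitrary: s')
  case 0
  have "(\<Sum>u\<in>UNIV. (if s = u then 1 else 0) * trans_mat A P x u s') = trans_mat A P x s s'"
    by (simp add: if_distrib[of "\<lambda>c. c * _"] cong: if_cong)
  moreover have "(\<Sum>u\<in>UNIV. trans_mat A P x s u * (if u = s' then 1 else 0)) = trans_mat A P x s s'"
    by (simp add: if_distrib[of "\<lambda>c. _ * c"] cong: if_cong)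
  ultimately show ?case by simp
next
  case (Suc t)
  have "mpow A P x (Suc (Suc t)) s s' = (\<Sum>v\<in>UNIV. (\<Sum>u\<in>UNIV. trans_mat A P x s u * mpow A P x t u v) * trans_mat A P x v s')"
    unfolding mpow.simps(2)[of A P x "Suc t"] Suc ..
  also have "\<dots> = (\<Sum>u\<in>UNIV. trans_mat A P x s u * (\<Sum>v\<in>UNIV. mpow A P x t u v * trans_mat A P x v s'))"
    unfolding sum_distrib_right sum_distrib_left by (subst sum.swap) (simp add: mult.assoc)
  finally show ?case by simp
qed

lemma visits_right:
  assumes "x \<in> transient_region A P"
  shows "visits A P x s s' = (if s = s' then 1 else 0) + (\<Sum>u\<in>UNIV. visits A P x s u * trans_mat A P x u s')"
proof -
  note sm = summable_mpow[OF assms]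
  have "visits A P x s s' = mpow A P x 0 s s' + (\<Sum>t. mpow A P x (Suc t) s s')"
    unfolding visits_def by (subst suminf_split_head[OF sm]) simp
  also have "(\<Sum>t. mpow A P x (Suc t) s s') = (\<Sum>u\<in>UNIV. \<Sum>t. mpow A P x t s u * trans_mat A P x u s')"
    unfolding mpow.simps by (intro suminf_sum summable_mult2 sm)
  also have "\<dots> = (\<Sum>u\<in>UNIV. visits A P x s u * trans_mat A P x u s')"
    unfolding visits_def by (intro sum.cong refl suminf_mult2[symmetric] sm)
  finally show ?thesis by simp
qed

lemma visits_left:
  assumes "x \<in> transient_region A P"
  shows "visits A P x s s' = (if s = s' then 1 else 0) + (\<Sum>u\<in>UNIV. trans_mat A P x s u * visits A P x u s')"
proof -
  note sm = summable_mpow[OF assms]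
  have "visits A P x s s' = mpow A P x 0 s s' + (\<Sum>t. mpow A P x (Suc t) s s')"
    unfolding visits_def by (subst suminf_split_head[OF sm]) simp
  also have "(\<Sum>t. mpow A P x (Suc t) s s') = (\<Sum>u\<in>UNIV. \<Sum>t. trans_mat A P x s u * mpow A P x t u s')"
    unfolding mpow_Suc_left by (intro suminf_sum summable_mult sm)
  also have "\<dots> = (\<Sum>u\<in>UNIV. trans_mat A P x s u * visits A P x u s')"
    unfolding visits_def by (intro sum.cong refl suminf_mult sm)
  finally show ?thesis by simp
qed

lemma game_value_eq:
  assumes "x \<in> transient_region A P"
  shows "game_value A P r \<rho> i x = (\<Sum>s\<in>UNIV. \<rho> s * state_value A P r x i s)"
proof -
  note sm = summable_mpow[OF assms]
  have "game_value A P r \<rho> i x = (\<Sum>s0\<in>UNIV. \<Sum>s\<in>UNIV. \<Sum>t. \<rho> s0 * mpow A P x t s0 s * rew_vec A r x i s)"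
    unfolding game_value_def
    by (subst suminf_sum, intro summable_sum summable_mult2 summable_mult sm)
      (intro sum.cong refl suminf_sum summable_mult2 summable_mult sm)
  also have "\<dots> = (\<Sum>s0\<in>UNIV. \<Sum>s\<in>UNIV. \<rho> s0 * visits A P x s0 s * rew_vec A r x i s)"
    unfolding visits_def
    by (intro sum.cong refl) (simp add: suminf_mult2[symmetric] suminf_mult sm summable_mult)
  also have "\<dots> = (\<Sum>s\<in>UNIV. \<rho> s * state_value A P r x i s)"
    unfolding state_value_def by (simp add: sum_distrib_left mult.assoc)
  finally show ?thesis .
qed

lemma bellman:
  assumes "x \<in> transient_region A P"
  shows "state_value A P r x i s = rew_vec A r x i s + (\<Sum>u\<in>UNIV. trans_mat A P x s u * state_value A P r x i u)"
proof -
  have "state_value A P r x i s = (\<Sum>s'\<in>UNIV. ((if s = s' then 1 else 0) + (\<Sum>u\<in>UNIV. trans_mat A P x s u * visits A P x u s')) * rew_vec A r x i s')"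
    unfolding state_value_def by (subst visits_left[OF assms]) simp
  also have "\<dots> = (\<Sum>s'\<in>UNIV. (if s = s' then 1 else 0) * rew_vec A r x i s')
      + (\<Sum>s'\<in>UNIV. (\<Sum>u\<in>UNIV. trans_mat A P x s u * visits A P x u s') * rew_vec A r x i s')"
    by (simp add: distrib_right sum.distrib)
  also have "(\<Sum>s'\<in>UNIV. (if s = s' then 1 else 0) * rew_vec A r x i s') = rew_vec A r x i s"
    by (simp add: if_distrib[of "\<lambda>c. c * _"] cong: if_cong)
  also have "(\<Sum>s'\<in>UNIV. (\<Sum>u\<in>UNIV. trans_mat A P x s u * visits A P x u s') * rew_vec A r x i s')
      = (\<Sum>u\<in>UNIV. trans_mat A P x s u * state_value A P r x i u)"
    unfolding state_value_def sum_distrib_right sum_distrib_left by (subst sum.swap) (simp add: mult.assoc)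
  finally show ?thesis .
qed

text \<open>Multiplying the equation by \<open>visits\<close> from the left and using visits * trans
  = visits - I cancels everything except \<open>D s\<close>.\<close>

lemma bellman_unique:
  assumes x: "x \<in> transient_region A P"
    and D: "\<And>s. D s = b s + (\<Sum>u\<in>UNIV. trans_mat A P x s u * D u)"
  shows "D s = (\<Sum>u\<in>UNIV. visits A P x s u * b u)"
proof -
  have "(\<Sum>u\<in>UNIV. visits A P x s u * D u) = (\<Sum>u\<in>UNIV. visits A P x s u * b u)
      + (\<Sum>u\<in>UNIV. visits A P x s u * (\<Sum>u'\<in>UNIV. trans_mat A P x u u' * D u'))"
    by (subst D) (simp add: distrib_left sum.distrib)
  also have "(\<Sum>u\<in>UNIV. visits A P x s u * (\<Sum>u'\<in>UNIV. trans_mat A P x u u' * D u'))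
      = (\<Sum>u'\<in>UNIV. (\<Sum>u\<in>UNIV. visits A P x s u * trans_mat A P x u u') * D u')"
    unfolding sum_distrib_right sum_distrib_left by (subst sum.swap) (simp add: mult.assoc)
  also have "\<dots> = (\<Sum>u'\<in>UNIV. (visits A P x s u' - (if s = u' then 1 else 0)) * D u')"
    by (subst (2) visits_right[OF x]) simp
  also have "\<dots> = (\<Sum>u'\<in>UNIV. visits A P x s u' * D u') - D s"
    by (simp add: left_diff_distrib sum_subtractf if_distrib[of "\<lambda>c. c * _"] cong: if_cong)
  finally show ?thesis by simp
qed

text \<open>Bellman's equation is a linear system with matrix I - trans, invertible because
  \<open>visits\<close> is a left inverse. Cramer's rule expresses the state values by determinants
  of polynomial entries, with common denominator \<open>Q\<close>.\<close>

lemma game_value_rational: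
  fixes A :: "'i::finite \<Rightarrow> 'a::finite set" and P :: "'s::finite \<Rightarrow> ('i \<Rightarrow> 'a) \<Rightarrow> 's \<Rightarrow> real"
  obtains N Q :: "('i, 's, 'a) pol \<Rightarrow> real" where "real_polynomial_function N" "real_polynomial_function Q"
    "\<And>x. x \<in> transient_region A P \<Longrightarrow> Q x \<noteq> 0 \<and> game_value A P r \<rho> i x = N x / Q x"
proof -
  define f where "f = (\<lambda>(x :: ('i, 's, 'a) pol) s s'. (if s = s' then 1 else 0) - trans_mat A P x s s')"
  have pf: "real_polynomial_function (\<lambda>x. f x s s')" for s s'
    unfolding f_def by (intro real_polynomial_function_diff real_polynomial_function.intros(2) polynomial_trans_mat)
  define Q where "Q = (\<lambda>x. det (\<chi> s s'. f x s s'))"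
  define N where "N = (\<lambda>x. \<Sum>k\<in>UNIV. \<rho> k * det (\<chi> s s'. if s' = k then rew_vec A r x i s else f x s s'))"
  have Q: "real_polynomial_function Q" unfolding Q_def by (rule polynomial_det[OF pf])
  have "real_polynomial_function (\<lambda>x. if s' = k then rew_vec A r x i s else f x s s')" for s s' k
    using pf polynomial_rew_vec by (cases "s' = k") auto
  then have N: "real_polynomial_function N"
    unfolding N_def
    by (intro real_polynomial_function_sum finite real_polynomial_function.intros(4) real_polynomial_function.intros(2) polynomial_det)
  show thesis
  proof (rule that[OF N Q])
    fix x :: "('i, 's, 'a) pol" assume x: "x \<in> transient_region A P"
    define I where "I = (\<chi> s s'. f x s s')"
    have "(\<chi> s s'. visits A P x s s') ** I = mat 1"
    proof -
      have "(\<Sum>u\<in>UNIV. visits A P x s u * f x u s') = (if s = s' then 1 else 0)" for s s'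
      proof -
        have "(\<Sum>u\<in>UNIV. visits A P x s u * f x u s') = visits A P x s s' - (\<Sum>u\<in>UNIV. visits A P x s u * trans_mat A P x u s')"
          by (simp add: f_def right_diff_distrib sum_subtractf if_distrib[of "\<lambda>c. _ * c"] cong: if_cong)
        then show ?thesis using visits_right[OF x, of s s'] by simp
      qed
      then show ?thesis by (simp add: matrix_matrix_mult_def mat_def I_def)
    qed
    then have "invertible I" using invertible_left_inverse by blast
    then have dI: "det I \<noteq> 0" by (simp add: invertible_det_nz)
    define b where "b = (\<chi> s. rew_vec A r x i s)"
    define y where "y = (\<chi> s. state_value A P r x i s)"
    have "I *v y = b"
    proof -
      have "(\<Sum>u\<in>UNIV. f x s u * state_value A P r x i u) = rew_vec A r x i s" for s
      proof -
        have "(\<Sum>u\<in>UNIV. f x s u * state_value A P r x i u) = state_value A P r x i s - (\<Sum>u\<in>UNIV. trans_mat A P x s u * state_value A P r x i u)"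
          by (simp add: f_def left_diff_distrib sum_subtractf if_distrib[of "\<lambda>c. c * _"] cong: if_cong)
        then show ?thesis using bellman[OF x, of r i s] by simp
      qed
      then show ?thesis by (simp add: matrix_vector_mult_def I_def y_def b_def)
    qed
    then have y: "y = (\<chi> k. det (\<chi> i j. if j = k then b $ i else I $ i $ j) / det I)"
      using cramer[OF dI] by blast
    have "state_value A P r x i k = det (\<chi> s s'. if s' = k then rew_vec A r x i s else f x s s') / Q x" for k
    proof -
      have "(\<chi> i j. if j = k then b $ i else I $ i $ j) = (\<chi> s s'. if s' = k then rew_vec A r x i s else f x s s')"
        by (simp add: b_def I_def vec_eq_iff)
      moreover have "state_value A P r x i k = det (\<chi> i j. if j = k then b $ i else I $ i $ j) / det I"
        using arg_cong[OF y, of "\<lambda>y. y $ k"] by (simp add: y_def)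
      ultimately show ?thesis by (simp add: I_def Q_def)
    qed
    then show "Q x \<noteq> 0 \<and> game_value A P r \<rho> i x = N x / Q x"
      using dI by (simp add: game_value_eq[OF x] N_def Q_def I_def sum_divide_distrib)
  qed
qed

lemma game_value_smooth:
  fixes A :: "'i::finite \<Rightarrow> 'a::finite set" and P :: "'s::finite \<Rightarrow> ('i \<Rightarrow> 'a) \<Rightarrow> 's \<Rightarrow> real"
  obtains V' where "\<And>i x. x \<in> transient_region A P \<Longrightarrow> (game_value A P r \<rho> i has_derivative V' i x) (at x)"
    "\<And>i x h. x \<in> transient_region A P \<Longrightarrow> (\<lambda>x. V' i x h) differentiable (at x)"
proof -
  have "\<exists>V'. (\<forall>x\<in>transient_region A P. (game_value A P r \<rho> i has_derivative V' x) (at x)) \<and>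
     (\<forall>h. \<forall>x\<in>transient_region A P. (\<lambda>x. V' x h) differentiable (at x))" for i
  proof -
    obtain N Q where NQ: "real_polynomial_function N" "real_polynomial_function Q"
      "\<And>x. x \<in> transient_region A P \<Longrightarrow> Q x \<noteq> 0 \<and> game_value A P r \<rho> i x = N x / Q x"
      using game_value_rational[of A P r \<rho> i] by metis
    obtain N' Q' where d: "\<And>x. (N has_derivative N' x) (at x)" "\<And>h. real_polynomial_function (\<lambda>x. N' x h)"
      "\<And>x. (Q has_derivative Q' x) (at x)" "\<And>h. real_polynomial_function (\<lambda>x. Q' x h)"
      using polynomial_has_derivative[OF NQ(1)] polynomial_has_derivative[OF NQ(2)] by metis
    define V' where "V' = (\<lambda>x h. (N' x h * Q x - N x * Q' x h) / (Q x * Q x))"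
    show ?thesis
    proof (intro exI[of _ V'] conjI ballI allI)
      fix x assume x: "x \<in> transient_region A P"
      have "((\<lambda>x. N x / Q x) has_derivative V' x) (at x)"
        unfolding V'_def by (rule has_derivative_divide'[OF d(1) d(3)]) (use NQ(3)[OF x] in blast)
      then show "(game_value A P r \<rho> i has_derivative V' x) (at x)"
        by (rule has_derivative_transform_within_open[OF _ open_transient_region x]) (use NQ(3) in auto)
      fix h
      have "Q x * Q x \<noteq> 0" using NQ(3)[OF x] by simp
      then show "(\<lambda>x. V' x h) differentiable (at x)"
        unfolding V'_def
        by (intro differentiable_divide differentiable_diff differentiable_mult polynomial_differentiable NQ d)
    qed
  qed
  then obtain V' where "\<forall>i. (\<forall>x\<in>transient_region A P. (game_value A P r \<rho> i has_derivative V' i x) (at x)) \<and>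
     (\<forall>h. \<forall>x\<in>transient_region A P. (\<lambda>x. V' i x h) differentiable (at x))" by metis
  then show thesis by (intro that[of V']) auto
qed

section \<open>Second-order stationary Nash policies are sharp\<close>

lemma gradfield_nth:
  fixes x :: "('i::finite, 's::finite, 'a::finite) pol"
  assumes x: "x \<in> transient_region A P" and V': "(game_value A P r \<rho> i has_derivative V') (at x)" and a: "a \<in> A i"
  shows "gradfield A P r \<rho> x $ (i, s, a) = V' (axis (i, s, a) 1)"
proof -
  let ?e = "axis (i, s, a) 1 :: ('i, 's, 'a) pol"
  have "((\<lambda>t. x + t *\<^sub>R ?e) has_derivative (\<lambda>t. t *\<^sub>R ?e)) (at 0)"
    by (auto intro!: derivative_eq_intros)
  moreover have "(game_value A P r \<rho> i has_derivative V') (at (x + 0 *\<^sub>R ?e))" using V' by simp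
  ultimately have "((\<lambda>t. game_value A P r \<rho> i (x + t *\<^sub>R ?e)) has_derivative (\<lambda>t. V' (t *\<^sub>R ?e))) (at 0)"
    by (rule has_derivative_compose)
  moreover have "V' (t *\<^sub>R ?e) = V' ?e * t" for t
    using linear_scale[OF has_derivative_linear[OF V']] by simp
  ultimately have "((\<lambda>t. game_value A P r \<rho> i (x + t *\<^sub>R ?e)) has_real_derivative V' ?e) (at 0)"
    by (simp add: has_field_derivative_def)
  then show ?thesis using a by (simp add: gradfield_def DERIV_imp_deriv)
qed

text \<open>Second-order stationarity is phrased with \<open>frechet_derivative\<close>, which says
  something about the Jacobian only where the derivative exists.\<close>

lemma gradfield_differentiable:
  fixes x :: "('i::finite, 's::finite, 'a::finite) pol"
  assumes x: "x \<in> transient_region A P"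
  shows "gradfield A P r \<rho> differentiable (at x)"
proof -
  obtain V' where V': "\<And>i x. x \<in> transient_region A P \<Longrightarrow> (game_value A P r \<rho> i has_derivative V' i x) (at x)"
    "\<And>i x h. x \<in> transient_region A P \<Longrightarrow> (\<lambda>x. V' i x h) differentiable (at x)"
    using game_value_smooth[of A P r \<rho>] by blast
  have diff: "(\<lambda>y. gradfield A P r \<rho> y $ j) differentiable (at x)" for j
  proof -
    obtain i s a where j: "j = (i, s, a)" by (cases j)
    show ?thesis
    proof (cases "a \<in> A i")
      case True
      from V'(2)[OF x, of i "axis j 1"] obtain D where "((\<lambda>x. V' i x (axis j 1)) has_derivative D) (at x)"
        by (auto simp: differentiable_def)
      then have "((\<lambda>y. gradfield A P r \<rho> y $ j) has_derivative D) (at x)"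
        by (rule has_derivative_transform_within_open[OF _ open_transient_region x])
          (simp add: j gradfield_nth[OF _ V'(1) True])
      then show ?thesis by (auto simp: differentiable_def)
    next
      case False
      then have "(\<lambda>y. gradfield A P r \<rho> y $ j) = (\<lambda>y. 0)" by (simp add: gradfield_def j)
      then show ?thesis by simp
    qed
  qed
  define D where "D = (\<lambda>j. frechet_derivative (\<lambda>y. gradfield A P r \<rho> y $ j) (at x))"
  have D: "((\<lambda>y. gradfield A P r \<rho> y $ j) has_derivative D j) (at x)" for j
    unfolding D_def using diff frechet_derivative_works by blast
  have "(gradfield A P r \<rho> has_derivative (\<lambda>h. \<chi> j. D j h)) (at x)"
    by (subst has_derivative_componentwise_within) (auto simp: Basis_vec_def inner_axis D)
  then show ?thesis by (auto simp: differentiable_def)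
qed

section \<open>Variations of one player in one state\<close>

definition block_dir :: "('i::finite, 's::finite, 'a::finite) pol \<Rightarrow> 'i \<Rightarrow> 's \<Rightarrow> ('i, 's, 'a) pol" where
  "block_dir d i s = (\<chi> j. case j of (k, u, a) \<Rightarrow> if k = i \<and> u = s then d $ (k, u, a) else 0)"

text \<open>The derivative of \<open>jprob x s a\<close> along \<open>block_dir d i s\<close>; the
  product has one factor of player i, so it is affine in that direction.\<close>

definition block_jprob :: "('i::finite, 's::finite, 'a::finite) pol \<Rightarrow> ('i, 's, 'a) pol \<Rightarrow> 'i \<Rightarrow> 's \<Rightarrow> ('i \<Rightarrow> 'a) \<Rightarrow> real" where
  "block_jprob x d i s a = d $ (i, s, a i) * (\<Prod>k\<in>UNIV - {i}. x $ (k, s, a k))"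

lemma jprob_block:
  "jprob (x + t *\<^sub>R block_dir d i s) u a = jprob x u a + t * (if u = s then block_jprob x d i s a else 0)"
proof -
  note split = prod.remove[OF finite UNIV_I[of i]]
  have "(x + t *\<^sub>R block_dir d i s) $ (i, u, a i) = x $ (i, u, a i) + t * (if u = s then d $ (i, u, a i) else 0)"
    by (simp add: block_dir_def)
  moreover have "(\<Prod>k\<in>UNIV - {i}. (x + t *\<^sub>R block_dir d i s) $ (k, u, a k)) = (\<Prod>k\<in>UNIV - {i}. x $ (k, u, a k))"
    by (intro prod.cong) (auto simp: block_dir_def)
  ultimately have "jprob (x + t *\<^sub>R block_dir d i s) u a =
     (x $ (i, u, a i) + t * (if u = s then d $ (i, u, a i) else 0)) * (\<Prod>k\<in>UNIV - {i}. x $ (k, u, a k))"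
    unfolding jprob_def split by simp
  moreover have "jprob x u a = x $ (i, u, a i) * (\<Prod>k\<in>UNIV - {i}. x $ (k, u, a k))"
    unfolding jprob_def split by simp
  ultimately show ?thesis by (simp add: block_jprob_def distrib_right)
qed

lemma trans_mat_block:
  "trans_mat A P (x + t *\<^sub>R block_dir d i s) u s' =
     trans_mat A P x u s' + t * (if u = s then \<Sum>a\<in>joint A. block_jprob x d i s a * P s a s' else 0)"
  unfolding trans_mat_def jprob_block
  by (auto simp: distrib_right sum.distrib sum_distrib_left mult.assoc)

lemma rew_vec_block:
  "rew_vec A r (x + t *\<^sub>R block_dir d i s) i u =
     rew_vec A r x i u + t * (if u = s then \<Sum>a\<in>joint A. block_jprob x d i s a * r i s a else 0)"
  unfolding rew_vec_def jprob_block
  by (auto simp: distrib_right sum.distrib sum_distrib_left mult.assoc)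

text \<open>The difference of the state values solves Bellman's equation of the new profile with a
  source at \<open>s\<close> alone. The source is t times a factor evaluated at \<open>x\<close>, so
  the only other dependence on t is through the number of visits.\<close>

lemma performance_difference:
  fixes x :: "('i::finite, 's::finite, 'a::finite) pol"
  assumes x: "x \<in> transient_region A P" and xt: "x + t *\<^sub>R block_dir d i s \<in> transient_region A P"
  shows "game_value A P r \<rho> i (x + t *\<^sub>R block_dir d i s) - game_value A P r \<rho> i x =
    t * (\<Sum>a\<in>joint A. block_jprob x d i s a * (r i s a + (\<Sum>u\<in>UNIV. P s a u * state_value A P r x i u)))
      * (\<Sum>s0\<in>UNIV. \<rho> s0 * visits A P (x + t *\<^sub>R block_dir d i s) s0 s)"
proof -
  define y where "y = x + t *\<^sub>R block_dir d i s"
  define k where "k = (\<Sum>a\<in>joint A. block_jprob x d i s a * (r i s a + (\<Sum>u\<in>UNIV. P s a u * state_value A P r x i u)))"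
  define D where "D = (\<lambda>u. state_value A P r y i u - state_value A P r x i u)"
  have y: "y \<in> transient_region A P" using xt by (simp add: y_def)
  have bell: "D u = (if u = s then t * k else 0) + (\<Sum>u'\<in>UNIV. trans_mat A P y u u' * D u')" for u
  proof -
    have "D u = (rew_vec A r y i u + (\<Sum>u'\<in>UNIV. trans_mat A P y u u' * state_value A P r y i u'))
        - (rew_vec A r x i u + (\<Sum>u'\<in>UNIV. trans_mat A P x u u' * state_value A P r x i u'))"
      unfolding D_def by (subst bellman[OF x], subst bellman[OF y]) simp
    also have "\<dots> = (rew_vec A r y i u - rew_vec A r x i u)
        + (\<Sum>u'\<in>UNIV. (trans_mat A P y u u' - trans_mat A P x u u') * state_value A P r x i u')
        + (\<Sum>u'\<in>UNIV. trans_mat A P y u u' * D u')"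
      by (simp add: D_def left_diff_distrib right_diff_distrib sum_subtractf)
    also have "(rew_vec A r y i u - rew_vec A r x i u)
        + (\<Sum>u'\<in>UNIV. (trans_mat A P y u u' - trans_mat A P x u u') * state_value A P r x i u')
        = (if u = s then t * k else 0)"
    proof (cases "u = s")
      case True
      have "(\<Sum>u'\<in>UNIV. t * (\<Sum>a\<in>joint A. block_jprob x d i s a * P s a u') * state_value A P r x i u')
          = t * (\<Sum>a\<in>joint A. block_jprob x d i s a * (\<Sum>u\<in>UNIV. P s a u * state_value A P r x i u))"
        unfolding sum_distrib_left sum_distrib_right by (subst sum.swap) (simp add: mult.assoc)
      then show ?thesis
        unfolding y_def trans_mat_block rew_vec_block
        using True by (simp add: k_def distrib_left sum.distrib)
    qed (simp add: y_def trans_mat_block rew_vec_block)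
    finally show ?thesis .
  qed
  have Ds: "D s0 = visits A P y s0 s * (t * k)" for s0
    using bellman_unique[OF y bell, of s0] by (simp add: if_distrib[of "\<lambda>c. _ * c"] cong: if_cong)
  have "game_value A P r \<rho> i y - game_value A P r \<rho> i x = (\<Sum>s0\<in>UNIV. \<rho> s0 * D s0)"
    by (simp add: game_value_eq[OF x] game_value_eq[OF y] D_def right_diff_distrib sum_subtractf)
  also have "\<dots> = t * k * (\<Sum>s0\<in>UNIV. \<rho> s0 * visits A P y s0 s)"
    by (simp add: Ds sum_distrib_left mult_ac)
  finally show ?thesis by (simp add: y_def k_def)
qed

lemma polytope_polspace:
  fixes A :: "'i::finite \<Rightarrow> 'a::finite set"
  shows "polytope (polspace A :: ('i, 's::finite, 'a) pol set)"
proof -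
  let ?e = "\<lambda>j. axis j 1 :: ('i, 's, 'a) pol"
  have nth: "?e j \<bullet> x = x $ j" for j x by (simp add: inner_axis inner_commute[of "?e j"])
  have "polspace A = (\<Inter>j. {x. ?e j \<bullet> x \<ge> 0}) \<inter> (\<Inter>j\<in>{(i, s, a). a \<notin> A i}. {x. ?e j \<bullet> x = 0})
      \<inter> (\<Inter>(i, s)\<in>UNIV. {x. (\<Sum>a\<in>A i. ?e (i, s, a)) \<bullet> x = 1})"
    unfolding polspace_def nth inner_sum_left by auto
  moreover have "polyhedron \<dots>"
    by (intro polyhedron_Int polyhedron_Inter finite_imageI finite)
      (auto intro: polyhedron_halfspace_ge polyhedron_hyperplane)
  ultimately have "polyhedron (polspace A :: ('i, 's, 'a) pol set)" by simp
  moreover have "bounded (polspace A :: ('i, 's, 'a) pol set)"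
  proof -
    have "norm x \<le> (\<Sum>j\<in>(UNIV :: ('i \<times> 's \<times> 'a) set). 1)" if x: "x \<in> polspace A" for x :: "('i, 's, 'a) pol"
    proof -
      have "\<bar>x $ (i, s, a)\<bar> \<le> 1" for i s a
      proof (cases "a \<in> A i")
        case True
        have "x $ (i, s, a) \<le> (\<Sum>a\<in>A i. x $ (i, s, a))"
          using x True by (intro member_le_sum) (auto simp: polspace_def)
        then show ?thesis using x by (simp add: polspace_def)
      qed (use x in \<open>simp add: polspace_def\<close>)
      then have "\<bar>x $ j\<bar> \<le> 1" for j by (cases j) auto
      then have "(\<Sum>j\<in>UNIV. \<bar>x $ j\<bar>) \<le> (\<Sum>j\<in>(UNIV :: ('i \<times> 's \<times> 'a) set). 1)" by (intro sum_mono)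
      then show ?thesis using norm_le_l1_cart[of x] by linarith
    qed
    then show ?thesis unfolding bounded_iff by blast
  qed
  ultimately show ?thesis by (simp add: polytope_eq_bounded_polyhedron)
qed

text \<open>A block belongs to one player, so the gradient field paired with it is a derivative of
  that player's value alone. The field is 0 at actions outside \<open>A i\<close>, hence the
  condition on \<open>d\<close>.\<close>

lemma gradfield_inner_block:
  fixes x :: "('i::finite, 's::finite, 'a::finite) pol"
  assumes x: "x \<in> transient_region A P" and V': "(game_value A P r \<rho> i has_derivative V') (at x)"
    and d: "\<And>a. a \<notin> A i \<Longrightarrow> d $ (i, s, a) = 0"
  shows "gradfield A P r \<rho> x \<bullet> block_dir d i s = V' (block_dir d i s)"
proof -
  let ?d = "block_dir d i s"
  have lin: "linear V'" by (rule has_derivative_linear[OF V'])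
  have *: "gradfield A P r \<rho> x $ j * ?d $ j = ?d $ j * V' (axis j 1)" for j
  proof -
    obtain k u a where j: "j = (k, u, a)" by (cases j)
    show ?thesis
      using gradfield_nth[OF x V', of a s] d[of a] by (auto simp: j block_dir_def)
  qed
  have "?d = (\<Sum>j\<in>UNIV. ?d $ j *\<^sub>R axis j 1)"
    using basis_expansion[of ?d] by (simp add: scalar_mult_eq_scaleR)
  then have "V' ?d = V' (\<Sum>j\<in>UNIV. ?d $ j *\<^sub>R axis j 1)" by simp
  also have "\<dots> = (\<Sum>j\<in>UNIV. ?d $ j * V' (axis j 1))"
    by (simp add: linear_sum[OF lin] linear_scale[OF lin])
  finally show ?thesis by (simp only: inner_vec_def inner_real_def *)
qed

text \<open>Until the first visit to \<open>s\<close> the state distribution does not depend on the behaviour in \<open>s\<close>.\<close>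

lemma first_visit:
  fixes x :: "('i::finite, 's::finite, 'a::finite) pol"
  assumes "\<And>T'. T' < T \<Longrightarrow> (\<Sum>s0\<in>UNIV. \<rho> s0 * mpow A P x T' s0 s) = 0"
  shows "(\<Sum>s0\<in>UNIV. \<rho> s0 * mpow A P (x + t *\<^sub>R block_dir d i s) T s0 u) = (\<Sum>s0\<in>UNIV. \<rho> s0 * mpow A P x T s0 u)"
  using assms
proof (induction T arbitrary: u)
  case (Suc T)
  let ?y = "x + t *\<^sub>R block_dir d i s"
  have rec: "(\<Sum>s0\<in>UNIV. \<rho> s0 * mpow A P z (Suc T) s0 u) = (\<Sum>w\<in>UNIV. (\<Sum>s0\<in>UNIV. \<rho> s0 * mpow A P z T s0 w) * trans_mat A P z w u)" for z
    unfolding mpow.simps sum_distrib_left sum_distrib_right by (subst sum.swap) (simp add: mult.assoc)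
  have "(\<Sum>s0\<in>UNIV. \<rho> s0 * mpow A P ?y (Suc T) s0 u) = (\<Sum>w\<in>UNIV. (\<Sum>s0\<in>UNIV. \<rho> s0 * mpow A P x T s0 w) * trans_mat A P ?y w u)"
    unfolding rec using Suc by simp
  also have "\<dots> = (\<Sum>w\<in>UNIV. (\<Sum>s0\<in>UNIV. \<rho> s0 * mpow A P x T s0 w) * trans_mat A P x w u)"
  proof (intro sum.cong refl)
    fix w
    show "(\<Sum>s0\<in>UNIV. \<rho> s0 * mpow A P x T s0 w) * trans_mat A P ?y w u = (\<Sum>s0\<in>UNIV. \<rho> s0 * mpow A P x T s0 w) * trans_mat A P x w u"
      using Suc.prems[of T] by (cases "w = s") (auto simp: trans_mat_block)
  qed
  finally show ?case unfolding rec .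
qed simp

lemma block_step_in_polspace:
  fixes x y :: "('i::finite, 's::finite, 'a::finite) pol"
  assumes "x \<in> polspace A" "y \<in> polspace A"
  shows "x + block_dir (y - x) i s \<in> polspace A"
proof -
  have *: "(x + block_dir (y - x) i s) $ (k, u, a) = (if k = i \<and> u = s then y $ (k, u, a) else x $ (k, u, a))" for k u a
    by (simp add: block_dir_def)
  show ?thesis
    unfolding polspace_def mem_Collect_eq
  proof (intro allI conjI impI)
    fix k u
    show "0 \<le> (x + block_dir (y - x) i s) $ (k, u, a)" for a
      unfolding * using assms by (simp add: polspace_def)
    show "(x + block_dir (y - x) i s) $ (k, u, a) = 0" if "a \<notin> A k" for a
      unfolding * using assms that by (auto simp: polspace_def)
    show "(\<Sum>a\<in>A k. (x + block_dir (y - x) i s) $ (k, u, a)) = 1"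
      unfolding * using assms by (cases "k = i \<and> u = s") (auto simp: polspace_def)
  qed
qed

text \<open>In a direction moving only player i, the Jacobian's quadratic form is the second
  derivative of that player's value, so second-order stationarity rules out a flat value; Nash
  optimality fixes the sign in the remaining case.\<close>

lemma sos_block_strict:
  fixes xs :: "('i::finite, 's::finite, 'a::finite) pol"
  assumes game: "game_ok A P r \<rho>" and nash: "is_nash A P r \<rho> xs" and sos: "is_sos A P r \<rho> xs"
    and y: "y \<in> polspace A" and nz: "block_dir (y - xs) i s \<noteq> 0"
  shows "gradfield A P r \<rho> xs \<bullet> block_dir (y - xs) i s < 0"
proof -
  define d where "d = block_dir (y - xs) i s"
  let ?V = "game_value A P r \<rho> i" and ?O = "transient_region A P"
  have xs: "xs \<in> polspace A" using nash by (simp add: is_nash_def)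
  have xO: "xs \<in> ?O" by (rule polspace_transient[OF game xs])
  have d1: "xs + d \<in> polspace A" unfolding d_def by (rule block_step_in_polspace[OF xs y])
  have dA: "(y - xs) $ (i, s, a) = 0" if "a \<notin> A i" for a
    using xs y that by (simp add: polspace_def)
  have seg: "xs + t *\<^sub>R d \<in> polspace A" if "0 \<le> t" "t \<le> 1" for t
  proof -
    have "(1 - t) *\<^sub>R xs + t *\<^sub>R (xs + d) \<in> polspace A"
      using polytope_imp_convex[OF polytope_polspace] xs d1 that by (intro convexD) auto
    moreover have "(1 - t) *\<^sub>R xs + t *\<^sub>R (xs + d) = xs + t *\<^sub>R d" by (simp add: algebra_simps)
    ultimately show ?thesis by simp
  qed
  obtain V' where V': "\<And>i x. x \<in> ?O \<Longrightarrow> (game_value A P r \<rho> i has_derivative V' i x) (at x)"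
    "\<And>i x h. x \<in> ?O \<Longrightarrow> (\<lambda>x. V' i x h) differentiable (at x)"
    using game_value_smooth[of A P r \<rho>] by blast
  have grad: "gradfield A P r \<rho> (xs + t *\<^sub>R d) \<bullet> d = V' i (xs + t *\<^sub>R d) d" if "xs + t *\<^sub>R d \<in> ?O" for t
    using gradfield_inner_block[OF that V'(1)[OF that] dA] unfolding d_def .
  have der: "((\<lambda>t. ?V (xs + t *\<^sub>R d)) has_real_derivative V' i (xs + t *\<^sub>R d) d) (at t)" if t: "xs + t *\<^sub>R d \<in> ?O" for t
  proof -
    have "((\<lambda>t. xs + t *\<^sub>R d) has_derivative (\<lambda>t. t *\<^sub>R d)) (at t)"
      by (auto intro!: derivative_eq_intros)
    then have "((\<lambda>t. ?V (xs + t *\<^sub>R d)) has_derivative (\<lambda>h. V' i (xs + t *\<^sub>R d) (h *\<^sub>R d))) (at t)"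
      using V'(1)[OF t] by (rule has_derivative_compose)
    moreover have "V' i (xs + t *\<^sub>R d) (h *\<^sub>R d) = V' i (xs + t *\<^sub>R d) d * h" for h
      using linear_scale[OF has_derivative_linear[OF V'(1)[OF t]]] by simp
    ultimately show ?thesis by (simp add: has_field_derivative_def)
  qed
  define k where "k = (\<Sum>a\<in>joint A. block_jprob xs (y - xs) i s a * (r i s a + (\<Sum>u\<in>UNIV. P s a u * state_value A P r xs i u)))"
  define \<nu> where "\<nu> = (\<lambda>t. \<Sum>s0\<in>UNIV. \<rho> s0 * visits A P (xs + t *\<^sub>R d) s0 s)"
  have diff: "?V (xs + t *\<^sub>R d) - ?V xs = t * k * \<nu> t" if "xs + t *\<^sub>R d \<in> ?O" for t
    using performance_difference[OF xO] that unfolding d_def k_def \<nu>_def by blast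
  have nu: "\<nu> t = (\<Sum>T. \<Sum>s0\<in>UNIV. \<rho> s0 * mpow A P (xs + t *\<^sub>R d) T s0 s)"
    and nu_summable: "summable (\<lambda>T. \<Sum>s0\<in>UNIV. \<rho> s0 * mpow A P (xs + t *\<^sub>R d) T s0 s)"
    if "xs + t *\<^sub>R d \<in> ?O" for t
  proof -
    note sm = summable_mpow[OF that]
    show "summable (\<lambda>T. \<Sum>s0\<in>UNIV. \<rho> s0 * mpow A P (xs + t *\<^sub>R d) T s0 s)"
      by (intro summable_sum summable_mult sm)
    have "\<nu> t = (\<Sum>s0\<in>UNIV. \<Sum>T. \<rho> s0 * mpow A P (xs + t *\<^sub>R d) T s0 s)"
      unfolding \<nu>_def visits_def by (intro sum.cong refl suminf_mult[symmetric] sm)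
    also have "\<dots> = (\<Sum>T. \<Sum>s0\<in>UNIV. \<rho> s0 * mpow A P (xs + t *\<^sub>R d) T s0 s)"
      by (intro suminf_sum[symmetric] summable_mult sm)
    finally show "\<nu> t = (\<Sum>T. \<Sum>s0\<in>UNIV. \<rho> s0 * mpow A P (xs + t *\<^sub>R d) T s0 s)" .
  qed
  have rho: "\<rho> s0 \<ge> 0" for s0 using game by (simp add: game_ok_def)
  \<comment> \<open>A two-sided interval: points with t < 0 need not be policies, but the derivative
    at 0 involves them, and the value formula still holds in the open region.\<close>
  obtain \<epsilon> where eps: "\<epsilon> > 0" "\<And>t. \<bar>t\<bar> < \<epsilon> \<Longrightarrow> xs + t *\<^sub>R d \<in> ?O"
  proof -
    have "isCont (\<lambda>t. xs + t *\<^sub>R d) 0" by (intro continuous_intros)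
    then have "eventually (\<lambda>t. xs + t *\<^sub>R d \<in> ?O) (nhds 0)"
      using topological_tendstoD[of "\<lambda>t. xs + t *\<^sub>R d" _ "nhds 0", OF _ open_transient_region[of A P]] xO
      by (simp add: isCont_def tendsto_nhds_iff)
    then show thesis using that by (auto simp: eventually_nhds_metric dist_real_def)
  qed
  consider (const) "\<And>t. \<bar>t\<bar> < \<epsilon> \<Longrightarrow> ?V (xs + t *\<^sub>R d) = ?V xs"
    | (dec) c where "c > 0" "\<And>t. 0 \<le> t \<Longrightarrow> t \<le> 1 \<Longrightarrow> ?V (xs + t *\<^sub>R d) \<le> ?V xs - c * t"
  proof (cases "k = 0 \<or> (\<forall>T. (\<Sum>s0\<in>UNIV. \<rho> s0 * mpow A P xs T s0 s) = 0)")
    case True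
    \<comment> \<open>If \<open>s\<close> has weight 0 at all times under \<open>xs\<close>,
      \<open>first_visit\<close> carries this over to every perturbation, also for negative
      t.\<close>
    have "?V (xs + t *\<^sub>R d) = ?V xs" if "\<bar>t\<bar> < \<epsilon>" for t
    proof -
      have "k = 0 \<or> \<nu> t = 0"
      proof (cases "k = 0")
        case False
        with True have "(\<Sum>s0\<in>UNIV. \<rho> s0 * mpow A P (xs + t *\<^sub>R d) T s0 s) = 0" for T
          using first_visit[of T \<rho> A P xs s t "y - xs" i s] unfolding d_def by simp
        then show ?thesis using nu[OF eps(2)[OF that]] by simp
      qed simp
      then show ?thesis using diff[OF eps(2)[OF that]] by auto
    qed
    then show thesis by (rule const)
  next
    case False
    \<comment> \<open>The first time at which \<open>s\<close> is reached with positive probability.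
      That probability is not changed by perturbing the block, which bounds \<nu> below uniformly in
      t.\<close>
    define T where "T = (LEAST T. (\<Sum>s0\<in>UNIV. \<rho> s0 * mpow A P xs T s0 s) \<noteq> 0)"
    have T: "(\<Sum>s0\<in>UNIV. \<rho> s0 * mpow A P xs T s0 s) \<noteq> 0"
      unfolding T_def by (rule LeastI_ex) (use False in blast)
    have before: "(\<Sum>s0\<in>UNIV. \<rho> s0 * mpow A P xs T' s0 s) = 0" if "T' < T" for T'
      using not_less_Least[OF that[unfolded T_def]] by blast
    define c where "c = (\<Sum>s0\<in>UNIV. \<rho> s0 * mpow A P xs T s0 s)"
    have "c \<ge> 0"
      unfolding c_def by (intro sum_nonneg mult_nonneg_nonneg rho mpow_nonneg[OF game xs])
    then have c: "c > 0" using T unfolding c_def by linarith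
    have nuc: "\<nu> t \<ge> c" if "0 \<le> t" "t \<le> 1" for t
    proof -
      have t: "xs + t *\<^sub>R d \<in> ?O" by (rule polspace_transient[OF game seg[OF that]])
      have nn: "(\<Sum>s0\<in>UNIV. \<rho> s0 * mpow A P (xs + t *\<^sub>R d) T' s0 s) \<ge> 0" for T'
        by (intro sum_nonneg mult_nonneg_nonneg rho mpow_nonneg[OF game seg[OF that]])
      have "c = (\<Sum>s0\<in>UNIV. \<rho> s0 * mpow A P (xs + t *\<^sub>R d) T s0 s)"
        unfolding c_def d_def by (rule first_visit[OF before, symmetric])
      also have "\<dots> \<le> \<nu> t"
        unfolding nu[OF t] using sum_le_suminf[OF nu_summable[OF t], of "{T}"] nn by simp
      finally show ?thesis .
    qed
    have kneg: "k < 0"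
    proof (rule ccontr)
      assume "\<not> k < 0"
      with False have k: "k > 0" by auto
      \<comment> \<open>The full step t = 1 alters entries of player i only and is thus a unilateral
        deviation covered by the Nash property.\<close>
      have "deviate xs i (xs + 1 *\<^sub>R d) = xs + 1 *\<^sub>R d"
        by (simp add: vec_eq_iff deviate_def d_def block_dir_def split: prod.split)
      then have "?V (xs + 1 *\<^sub>R d) \<le> ?V xs"
        using nash seg[of 1] unfolding is_nash_def by (metis order_refl zero_le_one)
      moreover have "1 * k * \<nu> 1 > 0" using k nuc[of 1] c by simp
      ultimately show False using diff[OF polspace_transient[OF game seg[of 1]]] by simp
    qed
    have "?V (xs + t *\<^sub>R d) \<le> ?V xs - (- k * c) * t" if t: "0 \<le> t" "t \<le> 1" for t
    proof -
      have "(- k) * (t * c) \<le> (- k) * (t * \<nu> t)"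
        using kneg nuc[OF t] t by (intro mult_left_mono) auto
      then show ?thesis using diff[OF polspace_transient[OF game seg[OF t]]] by (simp add: algebra_simps)
    qed
    then show thesis using kneg c by (intro dec[of "- k * c"]) (auto simp: mult_neg_pos)
  qed
  then show ?thesis
  proof cases
    case const
    let ?J = "frechet_derivative (gradfield A P r \<rho>) (at xs)"
    \<comment> \<open>The first derivative vanishes on a whole interval; differentiating once more
      at 0 gives J d . d = 0, against second-order stationarity.\<close>
    have zero: "gradfield A P r \<rho> (xs + t *\<^sub>R d) \<bullet> d = 0" if t: "\<bar>t\<bar> < \<epsilon>" for t
    proof -
      have "((\<lambda>t. ?V (xs + t *\<^sub>R d)) has_real_derivative 0) (at t)"
      proof (rule has_field_derivative_transform_within_open[where S = "{-\<epsilon><..<\<epsilon>}"])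
        show "((\<lambda>t. ?V xs) has_real_derivative 0) (at t)" by simp
      qed (use t const in auto)
      then have "V' i (xs + t *\<^sub>R d) d = 0" using der[OF eps(2)[OF t]] DERIV_unique by blast
      then show ?thesis using grad[OF eps(2)[OF t]] by simp
    qed
    have J: "(gradfield A P r \<rho> has_derivative ?J) (at xs)"
      using gradfield_differentiable[OF xO] frechet_derivative_works by blast
    have "((\<lambda>t. xs + t *\<^sub>R d) has_derivative (\<lambda>t. t *\<^sub>R d)) (at 0)"
      by (auto intro!: derivative_eq_intros)
    moreover have "(gradfield A P r \<rho> has_derivative ?J) (at (xs + 0 *\<^sub>R d))" using J by simp
    ultimately have "((\<lambda>t. gradfield A P r \<rho> (xs + t *\<^sub>R d)) has_derivative (\<lambda>t. ?J (t *\<^sub>R d))) (at 0)"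
      by (rule has_derivative_compose)
    then have "((\<lambda>t. gradfield A P r \<rho> (xs + t *\<^sub>R d) \<bullet> d) has_derivative (\<lambda>t. ?J (t *\<^sub>R d) \<bullet> d)) (at 0)"
      by (rule has_derivative_inner_left)
    moreover have "?J (t *\<^sub>R d) \<bullet> d = (?J d \<bullet> d) * t" for t
      using linear_scale[OF has_derivative_linear[OF J]] by simp
    ultimately have "((\<lambda>t. gradfield A P r \<rho> (xs + t *\<^sub>R d) \<bullet> d) has_real_derivative ?J d \<bullet> d) (at 0)"
      by (simp add: has_field_derivative_def)
    moreover have "((\<lambda>t. gradfield A P r \<rho> (xs + t *\<^sub>R d) \<bullet> d) has_real_derivative 0) (at 0)"
    proof (rule has_field_derivative_transform_within_open[where S = "{-\<epsilon><..<\<epsilon>}"])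
      show "((\<lambda>t. 0) has_real_derivative 0) (at (0::real))" by simp
    qed (use eps zero in auto)
    ultimately have "?J d \<bullet> d = 0" by (rule DERIV_unique)
    moreover have "(xs + d - xs) \<bullet> ?J (xs + d - xs) < 0"
      using sos d1 nz unfolding is_sos_def d_def by (metis add_cancel_left_right)
    ultimately show ?thesis by (simp add: inner_commute)
  next
    case dec
    \<comment> \<open>A positive derivative here would make V + c t increase initially,
      contradicting the linear decrease.\<close>
    have D: "((\<lambda>t. ?V (xs + t *\<^sub>R d) + c * t) has_real_derivative V' i xs d + c) (at 0)"
      using der[of 0] xO by (auto intro!: derivative_eq_intros)
    have "V' i xs d + c \<le> 0"
    proof (rule ccontr)
      assume "\<not> ?thesis"
      then obtain e where e: "e > 0" "\<And>h. h > 0 \<Longrightarrow> h < e \<Longrightarrow>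
          ?V (xs + 0 *\<^sub>R d) + c * 0 < ?V (xs + (0 + h) *\<^sub>R d) + c * (0 + h)"
        using DERIV_pos_inc_right[OF D] by auto
      define h where "h = min (e / 2) 1"
      have h: "0 < h" "h < e" "h \<le> 1" using e(1) by (auto simp: h_def)
      show False using e(2)[OF h(1,2)] dec(2)[of h] h by simp
    qed
    then have "V' i xs d < 0" using dec(1) by simp
    then show ?thesis using grad[of 0] xO by (simp add: d_def)
  qed
qed

section \<open>Sharpness on the whole polytope\<close>

text \<open>Strict negativity gives a constant for each of the finitely many generating points;
  their minimum passes to the hull because y -> g . (y - z) + c |y - z| is convex.\<close>

lemma polytope_sharp:
  fixes g z :: "'b::euclidean_space"
  assumes S: "polytope S" and strict: "\<And>y. y \<in> S \<Longrightarrow> y \<noteq> z \<Longrightarrow> g \<bullet> (y - z) < 0"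
  obtains c where "c > 0" "\<And>y. y \<in> S \<Longrightarrow> g \<bullet> (y - z) \<le> - c * norm (y - z)"
proof -
  obtain W where W: "finite W" "S = convex hull W" using S unfolding polytope_def by blast
  \<comment> \<open>The inserted 1 keeps the minimum defined when \<open>z\<close> is the only
    generating point.\<close>
  define c where "c = Min (insert 1 ((\<lambda>y. - (g \<bullet> (y - z)) / norm (y - z)) ` (W - {z})))"
  have WS: "W \<subseteq> S" using W hull_subset by metis
  have c: "c > 0"
    unfolding c_def using W(1) WS strict by (subst Min_gr_iff) (auto intro!: divide_neg_pos)
  have cW: "g \<bullet> (y - z) + c * norm (y - z) \<le> 0" if "y \<in> W" for y
  proof (cases "y = z")
    case False
    then have "c \<le> - (g \<bullet> (y - z)) / norm (y - z)"
      unfolding c_def using W(1) that by (intro Min_le) auto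
    then have "c * norm (y - z) \<le> - (g \<bullet> (y - z))"
      using False by (subst (asm) pos_le_divide_eq) auto
    then show ?thesis by simp
  qed simp
  have "convex {y. g \<bullet> (y - z) + c * norm (y - z) \<le> 0}"
  proof (rule convexI, unfold mem_Collect_eq)
    fix a b and u v :: real
    assume a: "g \<bullet> (a - z) + c * norm (a - z) \<le> 0" and b: "g \<bullet> (b - z) + c * norm (b - z) \<le> 0"
      and uv: "0 \<le> u" "0 \<le> v" "u + v = 1"
    have eq: "u *\<^sub>R a + v *\<^sub>R b - z = u *\<^sub>R (a - z) + v *\<^sub>R (b - z)"
      using uv(3) by (simp add: algebra_simps flip: scaleR_add_left)
    have "norm (u *\<^sub>R a + v *\<^sub>R b - z) \<le> u * norm (a - z) + v * norm (b - z)"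
      unfolding eq using norm_triangle_ineq[of "u *\<^sub>R (a - z)" "v *\<^sub>R (b - z)"] uv by simp
    then have "c * norm (u *\<^sub>R a + v *\<^sub>R b - z) \<le> c * (u * norm (a - z) + v * norm (b - z))"
      using c by (intro mult_left_mono) auto
    moreover have "g \<bullet> (u *\<^sub>R a + v *\<^sub>R b - z) = u * (g \<bullet> (a - z)) + v * (g \<bullet> (b - z))"
      unfolding eq by (simp add: inner_add_right)
    moreover have "u * (g \<bullet> (a - z) + c * norm (a - z)) \<le> 0" "v * (g \<bullet> (b - z) + c * norm (b - z)) \<le> 0"
      using a b uv by (auto intro: mult_nonneg_nonpos)
    ultimately show "g \<bullet> (u *\<^sub>R a + v *\<^sub>R b - z) + c * norm (u *\<^sub>R a + v *\<^sub>R b - z) \<le> 0"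
      by (simp add: distrib_left mult.left_commute)
  qed
  then have "convex hull W \<subseteq> {y. g \<bullet> (y - z) + c * norm (y - z) \<le> 0}"
    using cW by (intro hull_minimal) auto
  then show thesis using W(2) by (intro that[OF c]) fastforce
qed

text \<open>Every direction is the sum of its blocks: nonzero blocks contribute strictly negative
  terms, and y \<noteq> xs has at least one.\<close>

lemma sos_nash_sharp:
  fixes xs :: "('i::finite, 's::finite, 'a::finite) pol"
  assumes game: "game_ok A P r \<rho>" and nash: "is_nash A P r \<rho> xs" and sos: "is_sos A P r \<rho> xs"
  obtains c where "c > 0"
    "\<And>y. y \<in> polspace A \<Longrightarrow> gradfield A P r \<rho> xs \<bullet> (y - xs) \<le> - c * norm (y - xs)"
proof (rule polytope_sharp[OF polytope_polspace])
  fix y assume y: "y \<in> polspace A" and ne: "y \<noteq> xs"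
  have split: "y - xs = (\<Sum>(i, s)\<in>UNIV. block_dir (y - xs) i s)"
  proof (rule vec_eq_iff[THEN iffD2, rule_format])
    fix j :: "'i \<times> 's \<times> 'a"
    obtain i s a where j: "j = (i, s, a)" by (cases j)
    have "(\<Sum>(k, u)\<in>UNIV. block_dir (y - xs) k u) $ j = (\<Sum>p\<in>UNIV. if p = (i, s) then (y - xs) $ j else 0)"
      unfolding sum_component by (intro sum.cong) (auto simp: j block_dir_def split: if_splits)
    then show "(y - xs) $ j = (\<Sum>(i, s)\<in>UNIV. block_dir (y - xs) i s) $ j" by simp
  qed
  have le: "gradfield A P r \<rho> xs \<bullet> block_dir (y - xs) i s \<le> 0" for i s
    using sos_block_strict[OF game nash sos y, of i s] by (cases "block_dir (y - xs) i s = 0") auto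
  obtain i s where ne_is: "block_dir (y - xs) i s \<noteq> 0"
  proof -
    have "\<exists>p. (case p of (i, s) \<Rightarrow> block_dir (y - xs) i s) \<noteq> 0"
    proof (rule ccontr)
      assume "\<not> ?thesis"
      then have "y - xs = 0" by (subst split, intro sum.neutral) auto
      then show False using ne by simp
    qed
    then show thesis using that by auto
  qed
  have "gradfield A P r \<rho> xs \<bullet> (y - xs) = (\<Sum>p\<in>UNIV. gradfield A P r \<rho> xs \<bullet> (case p of (i, s) \<Rightarrow> block_dir (y - xs) i s))"
    by (subst split) (simp add: inner_sum_right)
  also have "\<dots> < (\<Sum>p\<in>(UNIV :: ('i \<times> 's) set). 0)"
    using le sos_block_strict[OF game nash sos y ne_is]
    by (intro sum_strict_mono_ex1) (auto intro!: exI[of _ i] exI[of _ s])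
  finally show "gradfield A P r \<rho> xs \<bullet> (y - xs) < 0" by simp
qed (rule that)

theorem theorem2:
  fixes A :: "'i::finite \<Rightarrow> 'a::finite set"
    and P :: "'s::finite \<Rightarrow> ('i \<Rightarrow> 'a) \<Rightarrow> 's \<Rightarrow> real"
    and r :: "'i \<Rightarrow> 's \<Rightarrow> ('i \<Rightarrow> 'a) \<Rightarrow> real"
    and \<rho> :: "'s \<Rightarrow> real"
    and xs :: "('i,'s,'a) pol"
    and \<B> :: "('i,'s,'a) pol set"
    and \<mu> g p ls :: real
    and lb :: ereal
    and B sig :: "nat \<Rightarrow> real"
  assumes game: "game_ok A P r \<rho>"
    and nash: "is_nash A P r \<rho> xs"
    and sos: "is_sos A P r \<rho> xs"
    and mu: "\<mu> > 0"
    and nbB: "nbhd_in (polspace A) xs \<B>" and measB: "\<B> \<in> sets borel"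
    and strong: "\<forall>x\<in>\<B>. gradfield A P r \<rho> x \<bullet> (x - xs) \<le> - \<mu> * (norm (x - xs))\<^sup>2"
    and g: "g > 0"
    and p: "1/2 < p" "p \<le> 1"
    and bias: "(lb = \<infinity> \<and> (\<forall>n. B n = 0)) \<or>
               (\<exists>l. lb = ereal l \<and> B \<in> O(\<lambda>n. 1 / real n powr l))"
    and var: "sig \<in> O(\<lambda>n. real n powr ls)"
    and pb: "ereal p + lb > 1"
    and ps: "p - ls > 1/2"
  shows "\<exists>U. nbhd_in (polspace A) xs U \<and> U \<in> sets borel \<and>
     (\<forall>\<delta>>0. \<exists>m0. \<forall>m\<ge>m0. \<forall>(M :: 'w measure) \<pi> vh.
        pg_run M (polspace A) (gradfield A P r \<rho>) g p m B sig \<pi> vh \<longrightarrow>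
          measure M {w\<in>space M. \<pi> 1 w \<in> U \<and> (\<forall>n\<ge>1. \<pi> n w \<in> \<B>)}
            \<ge> (1 - \<delta>) * measure M {w\<in>space M. \<pi> 1 w \<in> U} \<and>
          measure M {w\<in>space M. \<pi> 1 w \<in> U \<and> (\<lambda>n. \<pi> n w) \<longlonglongrightarrow> xs}
            \<ge> (1 - \<delta>) * measure M {w\<in>space M. \<pi> 1 w \<in> U}) \<and>
     (\<forall>m\<ge>0. \<forall>(M :: 'w measure) \<pi> vh.
        pg_run M (polspace A) (gradfield A P r \<rho>) g p m B sig \<pi> vh \<longrightarrow>
          (let E = {w\<in>space M. \<forall>n\<ge>1. \<pi> n w \<in> \<B>};
               q = real_of_ereal (min lb (ereal (p - 2 * ls)));
               e = (\<lambda>n. (LINT w|M. indicator E w * (norm (\<pi> n w - xs))\<^sup>2) / measure M E)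
           in (AE w in M. w \<in> E \<longrightarrow> (\<lambda>n. \<pi> n w) \<longlonglongrightarrow> xs) \<and>
              (if p = 1 \<and> 2 * \<mu> * g < q then e \<in> O(\<lambda>n. 1 / real n powr (2 * \<mu> * g))
               else e \<in> O(\<lambda>n. 1 / real n powr q))))"
proof -
  have xs: "xs \<in> polspace A" using nash by (simp add: is_nash_def)
  have poly: "polytope (polspace A :: ('i, 's, 'a) pol set)" by (rule polytope_polspace)
  \<comment> \<open>Differentiability on the open region around the policy space gives the
    continuity that the estimates ask for.\<close>
  have cont: "continuous_on (polspace A) (gradfield A P r \<rho>)"
    by (intro continuous_at_imp_continuous_on ballI differentiable_imp_continuous_within
        gradfield_differentiable polspace_transient[OF game])
  obtain c where c: "c > 0"
    "\<And>y. y \<in> polspace A \<Longrightarrow> gradfield A P r \<rho> xs \<bullet> (y - xs) \<le> - c * norm (y - xs)"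
    using sos_nash_sharp[OF game nash sos] by blast
  show ?thesis
    by (rule pg_sharp_equilibrium[OF polytope_imp_convex[OF poly] polytope_imp_compact[OF poly] xs cont
          c mu nbB measB strong g p bias var pb ps])
qed

end
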